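(* There exists a $1/3$-quadratic closed $\mathrm{G}_2$-structure $\varphi$ on some 7-manifold which does not have special torsion; indeed, its torsion 2-form $\tau$ has pointwise stabiliser (in the stabiliser $\mathrm{G}_2$ of $\varphi$ at each point) a maximal torus $\mathrm{T}^2$.
   Context: A $\mathrm{G}_2$-structure on a 7-manifold $M$ is a 3-form $\varphi$ such that at each $x\in M$ there is a linear isomorphism $u:T_xM\to\mathbb{R}^7$ (an adapted coframe) with $\varphi_x=u^*\phi$, $\phi=e^{123}+e^{145}+e^{167}+e^{246}-e^{257}-e^{347}-e^{356}$; the stabiliser of $\varphi_x$ in $\mathrm{GL}(T_xM)$ is isomorphic to the compact group $\mathrm{G}_2$. It determines a metric $g_\varphi$, an orientation and a Hodge star $*_\varphi$. $\varphi$ is closed if $d\varphi=0$; then its torsion 2-form $\tau$ is the unique 2-form with $d{*_\varphi}\varphi=\tau\wedge\varphi$. For a real constant $\lambda$, a closed $\varphi$ is $\lambda$-quadratic if $$d\tau=\tfrac17|\tau|^2\varphi+\lambda\left(\tfrac17|\tau|^2\varphi+*_\varphi(\tau\wedge\tau)\right).$$ The torsion 2-form takes values in a bundle modelled on the Lie algebra $\mathfrak{g}_2$. $\varphi$ has special torsion of positive (resp. negative) type if at each point $\tau$ is, in some adapted coframe, a non-zero multiple of $e^{45}-e^{67}$ (resp. $-2e^{23}+e^{45}+e^{67}$); in both of these cases the pointwise stabiliser of $\tau$ is isomorphic to $\mathrm{U}(2)$. *)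

theory Defs
  imports "HOL-Analysis.Analysis" "HOL-Algebra.Group"
begin

section \<open>Alternating forms on a real vector space\<close>

text \<open>
  A \<open>k\<close>-covector is a function on lists of vectors which is multilinear and alternating on lists
  of length \<open>k\<close>.  It is required to vanish on all other lists, so that equality of covectors is
  equality of functions.
\<close>

type_synonym 'n covector = "(real^'n) list \<Rightarrow> real"

definition alternating_form :: "nat \<Rightarrow> 'n::finite covector \<Rightarrow> bool" where
  "alternating_form k \<alpha> \<longleftrightarrow>
     (\<forall>vs. length vs \<noteq> k \<longrightarrow> \<alpha> vs = 0) \<and>
     (\<forall>vs i. length vs = k \<and> i < k \<longrightarrow> linear (\<lambda>v. \<alpha> (vs[i := v]))) \<and>
     (\<forall>vs i j. length vs = k \<and> i < j \<and> j < k \<and> vs ! i = vs ! j \<longrightarrow> \<alpha> vs = 0)"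

text \<open>
  The wedge product of a \<open>k\<close>- and an \<open>l\<close>-covector is normalised by \<open>1/(k! l!)\<close>, so that
  \<open>e\<^sup>i \<and> e\<^sup>j\<close> takes the value \<open>1\<close> on \<open>[e\<^sub>i, e\<^sub>j]\<close>.
\<close>

definition wedge :: "nat \<Rightarrow> nat \<Rightarrow> 'n::finite covector \<Rightarrow> 'n covector \<Rightarrow> 'n covector" where
  "wedge k l \<alpha> \<beta> = (\<lambda>vs.
     if length vs = k + l then
       (\<Sum>p | p permutes {..<k + l}.
          of_int (sign p) * \<alpha> (take k (permute_list p vs)) * \<beta> (drop k (permute_list p vs)))
       / (fact k * fact l)
     else 0)"

text \<open>The elementary form \<open>e\<^bsup>i\<^sub>1\<dots>i\<^sub>k\<^esup> = e\<^bsup>i\<^sub>1\<^esup> \<and> \<dots> \<and> e\<^bsup>i\<^sub>k\<^esup>\<close>, as a determinant.\<close>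

definition elem_form :: "'n::finite list \<Rightarrow> 'n covector" where
  "elem_form I = (\<lambda>vs.
     if length vs = length I then
       (\<Sum>p | p permutes {..<length I}.
          of_int (sign p) * (\<Prod>j<length I. (vs ! p j) $ (I ! j)))
     else 0)"

definition pullback :: "real^'n^'m \<Rightarrow> 'm::finite covector \<Rightarrow> 'n::finite covector" where
  "pullback A \<alpha> = (\<lambda>vs. \<alpha> (map (\<lambda>v. A *v v) vs))"


section \<open>Smooth manifolds and differential forms\<close>

fun Ck_on :: "nat \<Rightarrow> 'a::real_normed_vector set \<Rightarrow> ('a \<Rightarrow> 'b::real_normed_vector) \<Rightarrow> bool" where
  "Ck_on 0 S f \<longleftrightarrow> continuous_on S f"
| "Ck_on (Suc k) S f \<longleftrightarrow>
     (\<forall>x\<in>S. f differentiable (at x)) \<and> (\<forall>v. Ck_on k S (\<lambda>x. frechet_derivative f (at x) v))"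

text \<open>This is only used for open \<open>S\<close>.\<close>

definition smooth_on :: "'a::real_normed_vector set \<Rightarrow> ('a \<Rightarrow> 'b::real_normed_vector) \<Rightarrow> bool" where
  "smooth_on S f \<longleftrightarrow> (\<forall>k. Ck_on k S f)"

text \<open>A chart is a pair of its domain and its coordinate map; only the values of the coordinate
  map on the domain matter.\<close>

type_synonym ('a, 'n) chart = "'a set \<times> ('a \<Rightarrow> real^'n)"

definition chart_image :: "('a, 'n::finite) chart \<Rightarrow> (real^'n) set" where
  "chart_image c = snd c ` fst c"

definition overlap :: "('a, 'n::finite) chart \<Rightarrow> ('a, 'n) chart \<Rightarrow> (real^'n) set" where
  "overlap c d = snd c ` (fst c \<inter> fst d)"

definition transition :: "('a, 'n::finite) chart \<Rightarrow> ('a, 'n) chart \<Rightarrow> real^'n \<Rightarrow> real^'n" where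
  "transition c d = snd d \<circ> inv_into (fst c) (snd c)"

definition smooth_manifold :: "'a topology \<Rightarrow> ('a, 'n::finite) chart set \<Rightarrow> bool" where
  "smooth_manifold X \<A> \<longleftrightarrow>
     Hausdorff_space X \<and> second_countable X \<and>
     (\<Union>c\<in>\<A>. fst c) = topspace X \<and>
     (\<forall>c\<in>\<A>. openin X (fst c) \<and> open (chart_image c) \<and>
        homeomorphic_map (subtopology X (fst c)) (top_of_set (chart_image c)) (snd c)) \<and>
     (\<forall>c\<in>\<A>. \<forall>d\<in>\<A>. smooth_on (overlap c d) (transition c d))"

text \<open>
  A differential form is given by its local expressions in the charts of the atlas.  In particular a
  tangent space is identified with \<open>\<real>\<^sup>n\<close> by means of a chart, and a linear map on it is a matrix.
\<close>

type_synonym ('a, 'n) form_field = "('a, 'n) chart \<Rightarrow> real^'n \<Rightarrow> 'n covector"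

definition differential_form ::
    "('a, 'n::finite) chart set \<Rightarrow> nat \<Rightarrow> ('a, 'n) form_field \<Rightarrow> bool" where
  "differential_form \<A> k \<omega> \<longleftrightarrow>
     (\<forall>c\<in>\<A>. \<forall>x\<in>chart_image c. alternating_form k (\<omega> c x)) \<and>
     (\<forall>c\<in>\<A>. \<forall>vs. smooth_on (chart_image c) (\<lambda>x. \<omega> c x vs)) \<and>
     (\<forall>c\<in>\<A>. \<forall>d\<in>\<A>. \<forall>x\<in>overlap c d.
        \<omega> c x = pullback (matrix (frechet_derivative (transition c d) (at x)))
                         (\<omega> d (transition c d x)))"

definition ext_deriv :: "nat \<Rightarrow> (real^'n \<Rightarrow> 'n::finite covector) \<Rightarrow> real^'n \<Rightarrow> 'n covector" where
  "ext_deriv k \<omega> x = (\<lambda>vs.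
     if length vs = Suc k then
       (\<Sum>i\<le>k. (-1) ^ i *
          frechet_derivative (\<lambda>y. \<omega> y (take i vs @ drop (Suc i) vs)) (at x) (vs ! i))
     else 0)"


section \<open>Linear algebra of \<open>G\<^sub>2\<close>-structures\<close>

text \<open>
  The index type \<open>7\<close> has the elements \<open>1, \<dots>, 7\<close>, where \<open>7 = 0\<close>.  Its order puts \<open>7\<close> first, which
  is harmless: the only sums over increasing multi-indices have summands that are symmetric in the
  indices.
\<close>

definition phi0 :: "7 covector" where
  "phi0 = (\<lambda>vs. elem_form [1,2,3] vs + elem_form [1,4,5] vs + elem_form [1,6,7] vs
              + elem_form [2,4,6] vs - elem_form [2,5,7] vs - elem_form [3,4,7] vs
              - elem_form [3,5,6] vs)"

definition vol0 :: "7 covector" where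
  "vol0 = elem_form [1,2,3,4,5,6,7]"

definition multi_indices :: "nat \<Rightarrow> 7 list set" where
  "multi_indices k = {I. sorted_wrt (<) I \<and> length I = k}"

definition basis_list :: "7 list \<Rightarrow> (real^7) list" where
  "basis_list I = map (\<lambda>i. axis i 1) I"

text \<open>Norm on \<open>k\<close>-forms for which the \<open>e\<^bsup>i\<^sub>1\<dots>i\<^sub>k\<^esup>\<close> with \<open>i\<^sub>1 < \<dots> < i\<^sub>k\<close> are orthonormal, and the Hodge
  star of the Euclidean metric and \<open>vol0\<close>, for which \<open>\<alpha> \<and> \<star>\<beta> = \<langle>\<alpha>, \<beta>\<rangle> vol0\<close>.\<close>

definition norm_sq0 :: "nat \<Rightarrow> 7 covector \<Rightarrow> real" where
  "norm_sq0 k \<alpha> = (\<Sum>I\<in>multi_indices k. (\<alpha> (basis_list I))\<^sup>2)"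

definition hodge0 :: "nat \<Rightarrow> 7 covector \<Rightarrow> 7 covector" where
  "hodge0 k \<alpha> = (\<lambda>ws.
     if length ws = 7 - k then
       (\<Sum>I\<in>multi_indices k. \<alpha> (basis_list I) * vol0 (basis_list I @ ws))
     else 0)"

definition adapted_coframe :: "7 covector \<Rightarrow> real^7^7 \<Rightarrow> bool" where
  "adapted_coframe \<phi> u \<longleftrightarrow> invertible u \<and> \<phi> = pullback u phi0"

text \<open>
  The metric and orientation of \<open>\<phi>\<close> are the pullbacks under an adapted coframe \<open>u\<close> of the Euclidean
  metric and of \<open>vol0\<close>; norm and Hodge star are transported accordingly.  As the stabiliser of \<open>phi0\<close>
  is contained in \<open>SO(7)\<close>, the choice of \<open>u\<close> is irrelevant.
\<close>

definition some_coframe :: "7 covector \<Rightarrow> real^7^7" where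
  "some_coframe \<phi> = (SOME u. adapted_coframe \<phi> u)"

definition g2_norm_sq :: "7 covector \<Rightarrow> nat \<Rightarrow> 7 covector \<Rightarrow> real" where
  "g2_norm_sq \<phi> k \<alpha> = norm_sq0 k (pullback (matrix_inv (some_coframe \<phi>)) \<alpha>)"

definition g2_hodge :: "7 covector \<Rightarrow> nat \<Rightarrow> 7 covector \<Rightarrow> 7 covector" where
  "g2_hodge \<phi> k \<alpha> =
     pullback (some_coframe \<phi>) (hodge0 k (pullback (matrix_inv (some_coframe \<phi>)) \<alpha>))"


section \<open>Closed \<open>G\<^sub>2\<close>-structures\<close>

definition G2_structure :: "('a, 7) chart set \<Rightarrow> ('a, 7) form_field \<Rightarrow> bool" where
  "G2_structure \<A> \<phi> \<longleftrightarrow> differential_form \<A> 3 \<phi> \<and>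
     (\<forall>c\<in>\<A>. \<forall>x\<in>chart_image c. \<exists>u. adapted_coframe (\<phi> c x) u)"

definition closed_G2_structure :: "('a, 7) chart set \<Rightarrow> ('a, 7) form_field \<Rightarrow> bool" where
  "closed_G2_structure \<A> \<phi> \<longleftrightarrow> G2_structure \<A> \<phi> \<and>
     (\<forall>c\<in>\<A>. \<forall>x\<in>chart_image c. ext_deriv 3 (\<phi> c) x = (\<lambda>vs. 0))"

text \<open>Unique existence holds because \<open>\<tau> \<mapsto> \<tau> \<and> \<phi>\<close> is an isomorphism from 2-forms to 5-forms.\<close>

definition torsion :: "('a, 7) form_field \<Rightarrow> ('a, 7) form_field" where
  "torsion \<phi> c x = (THE \<tau>. alternating_form 2 \<tau> \<and>
     ext_deriv 4 (\<lambda>y. g2_hodge (\<phi> c y) 3 (\<phi> c y)) x = wedge 2 3 \<tau> (\<phi> c x))"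

definition quadratic_closed_G2_structure ::
    "real \<Rightarrow> ('a, 7) chart set \<Rightarrow> ('a, 7) form_field \<Rightarrow> bool" where
  "quadratic_closed_G2_structure lam \<A> \<phi> \<longleftrightarrow> closed_G2_structure \<A> \<phi> \<and>
     (\<forall>c\<in>\<A>. \<forall>x\<in>chart_image c.
        let \<tau> = torsion \<phi> c x; n = g2_norm_sq (\<phi> c x) 2 \<tau> in
        ext_deriv 2 (torsion \<phi> c) x =
          (\<lambda>vs. 1/7 * n * \<phi> c x vs +
             lam * (1/7 * n * \<phi> c x vs + g2_hodge (\<phi> c x) 4 (wedge 2 2 \<tau> \<tau>) vs)))"

definition pointwise_multiple_of ::
    "('a, 7) chart set \<Rightarrow> ('a, 7) form_field \<Rightarrow> 7 covector \<Rightarrow> bool" where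
  "pointwise_multiple_of \<A> \<phi> \<beta> \<longleftrightarrow>
     (\<forall>c\<in>\<A>. \<forall>x\<in>chart_image c. \<exists>u r. adapted_coframe (\<phi> c x) u \<and> r \<noteq> 0 \<and>
        torsion \<phi> c x = pullback u (\<lambda>vs. r * \<beta> vs))"

definition special_torsion_positive :: "('a, 7) chart set \<Rightarrow> ('a, 7) form_field \<Rightarrow> bool" where
  "special_torsion_positive \<A> \<phi> \<longleftrightarrow>
     pointwise_multiple_of \<A> \<phi> (\<lambda>vs. elem_form [4,5] vs - elem_form [6,7] vs)"

definition special_torsion_negative :: "('a, 7) chart set \<Rightarrow> ('a, 7) form_field \<Rightarrow> bool" where
  "special_torsion_negative \<A> \<phi> \<longleftrightarrow>
     pointwise_multiple_of \<A> \<phi>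
       (\<lambda>vs. - 2 * elem_form [2,3] vs + elem_form [4,5] vs + elem_form [6,7] vs)"

definition special_torsion :: "('a, 7) chart set \<Rightarrow> ('a, 7) form_field \<Rightarrow> bool" where
  "special_torsion \<A> \<phi> \<longleftrightarrow> special_torsion_positive \<A> \<phi> \<or> special_torsion_negative \<A> \<phi>"


section \<open>Stabilisers and maximal tori\<close>

definition GL :: "(real^'n^'n::finite) monoid" where
  "GL = \<lparr>carrier = {A. invertible A}, mult = (**), one = mat 1\<rparr>"

definition stabiliser :: "(real^'n^'n) set \<Rightarrow> 'n::finite covector \<Rightarrow> (real^'n^'n) set" where
  "stabiliser G \<alpha> = {A \<in> G. pullback A \<alpha> = \<alpha>}"

text \<open>A compact subgroup of \<open>GL\<close> is closed and hence a Lie subgroup, so the following are the tori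
  of \<open>GL\<close>.\<close>

definition torus :: "(real^'n^'n::finite) set \<Rightarrow> bool" where
  "torus T \<longleftrightarrow> subgroup T GL \<and> compact T \<and> connected T \<and> (\<forall>A\<in>T. \<forall>B\<in>T. A ** B = B ** A)"

definition maximal_torus :: "(real^'n^'n::finite) set \<Rightarrow> (real^'n^'n) set \<Rightarrow> bool" where
  "maximal_torus G T \<longleftrightarrow> torus T \<and> T \<subseteq> G \<and> (\<forall>T'. torus T' \<and> T' \<subseteq> G \<and> T \<subseteq> T' \<longrightarrow> T' = T)"

definition isomorphic_to_T2 :: "(real^'n^'n::finite) set \<Rightarrow> bool" where
  "isomorphic_to_T2 T \<longleftrightarrow>
     (\<exists>f g. homeomorphism (sphere (0::complex) 1 \<times> sphere (0::complex) 1) T f g \<and>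
        (\<forall>z\<in>sphere 0 1. \<forall>w\<in>sphere 0 1. \<forall>z'\<in>sphere 0 1. \<forall>w'\<in>sphere 0 1.
           f (z * z', w * w') = f (z, w) ** f (z', w')))"

end

theory Submission
  imports Defs "Jordan_Normal_Form.Determinant" "HOL-Combinatorics.Multiset_Permutations"
begin

text \<open>
  The example lives on \<open>\<real>\<^sup>7\<close> with one chart. Consider the upper half-plane with coordinate
  \<open>z = x + i y\<close> and the flat bundle over it with fibre \<open>\<real>\<^sup>2 \<otimes> \<complex> = \<complex>\<^sup>2\<close>, on which \<open>SL(2, \<real>)\<close> acts
  together with the translations of the fibre and with \<open>U(1)\<close>. The isotropy group of this
  6-manifold is a 2-torus; its invariant 1-forms with values in the three weight spaces span three planes
  with area forms \<open>\<omega>\<^sub>1\<close>, \<open>\<omega>\<^sub>2\<close>, \<open>\<omega>\<^sub>3\<close>, and their product is a complex volume form \<open>\<Omega>\<close>. One has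
  \<open>d\<omega>\<^sub>3 = 0\<close>, while \<open>d\<omega>\<^sub>1\<close> and \<open>d\<omega>\<^sub>2\<close> are opposite multiples of \<open>Re \<Omega>\<close>. On the product with a half-line,
  the ansatz \<open>\<phi> = \<plusminus> dt \<and> (f\<^sub>1\<^sup>2 \<omega>\<^sub>1 + f\<^sub>2\<^sup>2 \<omega>\<^sub>2 + f\<^sub>3\<^sup>2 \<omega>\<^sub>3) + f\<^sub>1 f\<^sub>2 f\<^sub>3 Re \<Omega>\<close> with functions \<open>f\<^sub>i\<close> of \<open>t\<close> has
  a torsion form \<open>a e\<^sup>2\<^sup>3 + b e\<^sup>4\<^sup>5 + c e\<^sup>6\<^sup>7\<close> with \<open>a + b + c = 0\<close>, and the quadratic condition becomes
  a system of ordinary differential equations. For \<open>\<lambda> = 1/3\<close> it has a solution in powers of \<open>t\<close>, namely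
  \<open>f\<^sub>1\<^sup>2 = t\<^sup>-\<^sup>3\<close>, \<open>f\<^sub>2\<^sup>2 = 5 t\<^sup>-\<^sup>3\<close> and \<open>f\<^sub>3\<^sup>2\<close> proportional to \<open>t\<^sup>2\<close>, for which \<open>(a, b, c)\<close> is proportional to
  \<open>(1, -3, 2)\<close>. With \<open>t = exp (-2 s)\<close> and \<open>y = exp (2 h)\<close> all coefficients become products of
  exponentials and powers of \<open>x\<close>, the manifold becomes all of \<open>\<real>\<^sup>7\<close>, and \<open>\<phi>\<close> is the pullback of \<^const>\<open>phi0\<close> under
  the matrix \<open>coframe x\<close>. The lemmas \<open>ext_deriv_phi\<close>, \<open>ext_deriv_psi\<close> and \<open>ext_deriv_tau\<close> are the
  structure equations \<open>d\<phi> = 0\<close>, \<open>d*\<phi> = \<tau> \<and> \<phi>\<close> and the quadratic condition for this coframe.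

  Norm and Hodge star are defined by means of an arbitrary
  adapted coframe, so one has to know that the stabiliser of \<^const>\<open>phi0\<close> lies in \<open>SO(7)\<close>. This is \<open>phi0_stabiliser\<close>,
  which rests on the identity \<open>\<iota>\<^sub>u\<phi> \<and> \<iota>\<^sub>v\<phi> \<and> \<phi> = 6 \<langle>u, v\<rangle> vol\<close> (\<open>wedge_iota\<close>); the transport of norm and Hodge star
  is \<open>norm_sq0_pullback\<close> and \<open>hodge0_pullback\<close>. That the torsion form is well defined is the injectivity of
  \<open>\<tau> \<mapsto> \<tau> \<and> \<phi>\<close> (\<open>wedge_phi0_inj\<close>).

  A linear map that preserves \<open>\<phi>\<close> and \<open>\<tau>\<close> is orthogonal and hence commutes with the skew
  endomorphism of \<open>\<tau>\<close>. As \<open>a\<^sup>2\<close>, \<open>b\<^sup>2\<close>, \<open>c\<^sup>2\<close> are distinct and non-zero, it is complex linear on each of the three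
  planes (\<open>commuting_skew\<close>), and then \<open>\<phi>\<close> leaves exactly a 2-torus (\<open>T2_stabiliser\<close>). The same argument computes the
  centraliser of the torus, which gives its maximality (\<open>T2_torus\<close>). The special 2-forms of both types
  have stabilisers that are not commutative, so the torsion is not special (\<open>not_special_model\<close>).
\<close>

no_notation Matrix.vec_index (infixl "$" 100)

section \<open>Elementary forms as determinants\<close>

text \<open>
  The wedge product of a 1-form with an arbitrary form, by recursion on the list of arguments. This
  shape of the Laplace expansion needs no positions and is what the simplifier computes with.
\<close>

fun wedge1 :: "('v \<Rightarrow> real) \<Rightarrow> ('v list \<Rightarrow> real) \<Rightarrow> 'v list \<Rightarrow> real" where
  "wedge1 a F [] = 0"
| "wedge1 a F (v # vs) = a v * F vs - wedge1 a (\<lambda>ws. F (v # ws)) vs"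

lemma wedge1_eq_sum:
  "wedge1 a F vs = (\<Sum>i<length vs. (-1) ^ i * a (vs ! i) * F (take i vs @ drop (Suc i) vs))"
proof (induction vs arbitrary: F)
  case (Cons v vs)
  have "(\<Sum>i<length (v # vs). (-1) ^ i * a ((v # vs) ! i) * F (take i (v # vs) @ drop (Suc i) (v # vs)))
    = a v * F vs + (\<Sum>i<length vs. - ((-1) ^ i * a (vs ! i) * F (v # take i vs @ drop (Suc i) vs)))"
    by (simp add: sum.lessThan_Suc_shift del: sum.lessThan_Suc)
  then show ?case by (simp add: Cons.IH sum_negf)
qed simp

lemma wedge1_scale: "wedge1 a (\<lambda>vs. c * F vs) vs = c * wedge1 a F vs"
  by (simp add: wedge1_eq_sum sum_distrib_left mult_ac)

lemma wedge1_add: "wedge1 (\<lambda>v. a v + b v) F vs = wedge1 a F vs + wedge1 b F vs"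
  by (simp add: wedge1_eq_sum ring_distribs sum.distrib)

definition elem_mat :: "'n::finite list \<Rightarrow> (real^'n) list \<Rightarrow> real mat" where
  "elem_mat I vs = Matrix.mat (length I) (length I) (\<lambda>(r, c). (vs ! c) $ (I ! r))"

lemma elem_mat_carrier [simp]: "elem_mat I vs \<in> carrier_mat (length I) (length I)"
  by (simp add: elem_mat_def)

text \<open>
  This identification gives access to the theory of determinants: Laplace expansions, and the
  alternating behaviour in the vectors and in the indices.
\<close>

lemma elem_form_eq_det:
  assumes "length vs = length I"
  shows "elem_form I vs = Determinant.det (elem_mat I vs)"
proof -
  have "elem_form I vs = (\<Sum>p | p permutes {..<length I}. of_int (sign p) * (\<Prod>j<length I. (vs ! p j) $ (I ! j)))"
    using assms by (simp add: elem_form_def)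
  also have "\<dots> = Determinant.det (elem_mat I vs)"
    unfolding det_def'[OF elem_mat_carrier] atLeast0LessThan
  proof (rule sum.cong[OF refl])
    fix p assume "p \<in> {p. p permutes {..<length I}}"
    then have p: "p permutes {..<length I}" by simp
    then have "p j < length I" if "j < length I" for j
      using that permutes_in_image[OF p, of j] by simp
    then show "of_int (sign p) * (\<Prod>j<length I. (vs ! p j) $ (I ! j)) =
        signof p * (\<Prod>i<length I. elem_mat I vs $$ (i, p i))"
      by (auto simp: elem_mat_def intro!: prod.cong)
  qed
  finally show ?thesis .
qed

lemma elem_form_wrong_length: "length vs \<noteq> length I \<Longrightarrow> elem_form I vs = 0"
  by (simp add: elem_form_def)

lemma nth_remove_nth:
  "k < length xs - 1 \<Longrightarrow> (take i xs @ drop (Suc i) xs) ! k = xs ! (if k < i then k else Suc k)"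
  by (cases "i < length xs") (auto simp: nth_append min_def)

lemma elem_mat_delete:
  assumes "r < length I" "c < length I" "length vs = length I"
  shows "mat_delete (elem_mat I vs) r c =
     elem_mat (take r I @ drop (Suc r) I) (take c vs @ drop (Suc c) vs)"
  using assms by (auto simp: mat_delete_def elem_mat_def nth_remove_nth intro!: eq_matI)

lemma elem_form_Nil [simp]: "elem_form [] vs = (if vs = [] then 1 else 0)"
  by (auto simp: elem_form_def)

text \<open>
  Laplace expansion of the determinant along its first row.
\<close>

lemma elem_form_Cons:
  "elem_form (m # I) vs = wedge1 (\<lambda>v. v $ m) (elem_form I) vs"
proof (cases "length vs = Suc (length I)")
  case True
  have "elem_form (m # I) vs = (\<Sum>j<Suc (length I). elem_mat (m # I) vs $$ (0, j) * cofactor (elem_mat (m # I) vs) 0 j)"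
    using True laplace_expansion_row[OF elem_mat_carrier, of 0 "m # I" vs]
    by (simp add: elem_form_eq_det)
  also have "\<dots> = (\<Sum>j<Suc (length I). (-1) ^ j * (vs ! j) $ m * elem_form I (take j vs @ drop (Suc j) vs))"
  proof (rule sum.cong[OF refl])
    fix j assume j: "j \<in> {..<Suc (length I)}"
    have l: "length (take j vs @ drop (Suc j) vs) = length I" using j True by simp
    show "elem_mat (m # I) vs $$ (0, j) * cofactor (elem_mat (m # I) vs) 0 j =
       (-1) ^ j * (vs ! j) $ m * elem_form I (take j vs @ drop (Suc j) vs)"
      using j True unfolding cofactor_def elem_form_eq_det[OF l]
      by (subst elem_mat_delete) (auto simp: elem_mat_def)
  qed
  finally show ?thesis using True by (simp add: wedge1_eq_sum)
next
  case False
  have "elem_form I (take j vs @ drop (Suc j) vs) = 0" if "j < length vs" for j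
    using False that by (intro elem_form_wrong_length) simp
  then have "wedge1 (\<lambda>v. v $ m) (elem_form I) vs = 0"
    by (simp add: wedge1_eq_sum)
  then show ?thesis using False by (simp add: elem_form_wrong_length)
qed

text \<open>
  Laplace expansion along a column: the cofactors do not involve the vector in that column, whence
  the dependence on it is linear.
\<close>

lemma elem_form_slot:
  assumes "i < length I" "length vs = length I"
  shows "elem_form I (vs[i := v]) =
     (\<Sum>r<length I. v $ (I ! r) * cofactor (elem_mat I vs) r i)"
proof -
  have "elem_form I (vs[i := v]) = (\<Sum>r<length I. elem_mat I (vs[i := v]) $$ (r, i) * cofactor (elem_mat I (vs[i := v])) r i)"
    using assms laplace_expansion_column[OF elem_mat_carrier, of i I "vs[i := v]"]
    by (simp add: elem_form_eq_det)
  also have "\<dots> = (\<Sum>r<length I. v $ (I ! r) * cofactor (elem_mat I vs) r i)"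
  proof (intro sum.cong refl arg_cong2[of _ _ _ _ "(*)"])
    fix r assume "r \<in> {..<length I}"
    then show "elem_mat I (vs[i := v]) $$ (r, i) = v $ (I ! r)"
      "cofactor (elem_mat I (vs[i := v])) r i = cofactor (elem_mat I vs) r i"
      using assms by (simp_all add: elem_mat_def, simp add: cofactor_def elem_mat_delete flip: elem_mat_def)
  qed
  finally show ?thesis .
qed

lemma alternating_elem_form [simp]:
  assumes "k = length I"
  shows "alternating_form k (elem_form I)"
  unfolding alternating_form_def assms
proof (intro conjI allI impI)
  fix vs :: "(real^'a) list" and i
  assume "length vs = length I \<and> i < length I"
  then have *: "elem_form I (vs[i := v]) = (\<Sum>r<length I. v $ (I ! r) * cofactor (elem_mat I vs) r i)" for v
    by (intro elem_form_slot) auto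
  show "linear (\<lambda>v. elem_form I (vs[i := v]))"
    unfolding * by (intro linear_compose_sum ballI)
      (auto intro!: linearI simp: algebra_simps)
next
  fix vs :: "(real^'a) list" and i j
  assume a: "length vs = length I \<and> i < j \<and> j < length I \<and> vs ! i = vs ! j"
  then have "col (elem_mat I vs) i = col (elem_mat I vs) j"
    by (auto simp: elem_mat_def)
  then show "elem_form I vs = 0"
    using a det_identical_columns[OF elem_mat_carrier, of i j I vs]
    by (auto simp: elem_form_eq_det)
qed (simp add: elem_form_wrong_length)

lemma elem_form_not_distinct:
  assumes "\<not> distinct I"
  shows "elem_form I = (\<lambda>vs. 0)"
proof
  fix vs :: "(real^'a) list"
  obtain i j where ij: "i < length I" "j < length I" "i \<noteq> j" "I ! i = I ! j"
    using assms by (auto simp: distinct_conv_nth)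
  then have "row (elem_mat I vs) i = row (elem_mat I vs) j"
    by (auto simp: elem_mat_def)
  then have "length vs = length I \<Longrightarrow> elem_form I vs = 0"
    using det_identical_rows[OF elem_mat_carrier ij(3,1,2)] by (simp add: elem_form_eq_det)
  then show "elem_form I vs = 0" using elem_form_wrong_length by blast
qed

lemma elem_form_permute_list:
  assumes "p permutes {..<length I}"
  shows "elem_form (permute_list p I) vs = of_int (sign p) * elem_form I vs"
proof (cases "length vs = length I")
  case True
  have "elem_mat (permute_list p I) vs =
      Matrix.mat (length I) (length I) (\<lambda>(i, j). elem_mat I vs $$ (p i, j))"
    using permutes_in_image[OF assms] assms
    by (intro eq_matI) (auto simp: elem_mat_def permute_list_nth)
  moreover have "p permutes {0..<length I}" using assms by (simp add: atLeast0LessThan)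
  ultimately show ?thesis
    using True det_permute_rows[OF elem_mat_carrier, of p I vs] by (simp add: elem_form_eq_det)
qed (simp add: elem_form_wrong_length)

hide_const (open) Matrix.mat Matrix.vec Matrix.row Matrix.col Determinant.det

section \<open>Alternating forms are determined by their components\<close>

lemma alternating_wrong_length: "alternating_form k \<alpha> \<Longrightarrow> length vs \<noteq> k \<Longrightarrow> \<alpha> vs = 0"
  by (simp add: alternating_form_def)

lemma alternating_linear:
  "alternating_form k \<alpha> \<Longrightarrow> length vs = k \<Longrightarrow> i < k \<Longrightarrow> linear (\<lambda>v. \<alpha> (vs[i := v]))"
  by (simp add: alternating_form_def)

lemma alternating_zero [simp]: "alternating_form k (\<lambda>vs. 0)"
  by (simp add: alternating_form_def linear_zero)

lemma alternating_add [simp]: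
  "alternating_form k \<alpha> \<Longrightarrow> alternating_form k \<beta> \<Longrightarrow> alternating_form k (\<lambda>vs. \<alpha> vs + \<beta> vs)"
  unfolding alternating_form_def by (auto intro: linear_compose_add)

lemma alternating_scale [simp]:
  "alternating_form k \<alpha> \<Longrightarrow> alternating_form k (\<lambda>vs. c * \<alpha> vs)"
  unfolding alternating_form_def using linear_compose_scale_right[where 'b=real] by fastforce

lemma alternating_minus [simp]:
  "alternating_form k \<alpha> \<Longrightarrow> alternating_form k (\<lambda>vs. - \<alpha> vs)"
  using alternating_scale[of k \<alpha> "-1"] by simp

lemma alternating_diff [simp]:
  "alternating_form k \<alpha> \<Longrightarrow> alternating_form k \<beta> \<Longrightarrow> alternating_form k (\<lambda>vs. \<alpha> vs - \<beta> vs)"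
  using alternating_add[OF _ alternating_minus, of k \<alpha> \<beta>] by simp

lemma alternating_sum [simp]:
  "(\<And>i. i \<in> A \<Longrightarrow> alternating_form k (\<alpha> i)) \<Longrightarrow> alternating_form k (\<lambda>vs. \<Sum>i\<in>A. \<alpha> i vs)"
  by (induction A rule: infinite_finite_induct) auto

lemma alternating_not_distinct:
  assumes "alternating_form k \<alpha>" "\<not> distinct vs"
  shows "\<alpha> vs = 0"
proof (cases "length vs = k")
  case True
  obtain i j where "i < length vs" "j < length vs" "i \<noteq> j" "vs ! i = vs ! j"
    using assms(2) by (auto simp: distinct_conv_nth)
  then obtain i j where "i < j" "j < length vs" "vs ! i = vs ! j"
    by (metis linorder_neqE_nat)
  then show ?thesis using assms(1) True unfolding alternating_form_def by blast
qed (use assms alternating_wrong_length in blast)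

lemma alternating_pullback [simp]:
  fixes A :: "real^'n::finite^'m::finite"
  assumes "alternating_form k \<alpha>"
  shows "alternating_form k (pullback A \<alpha>)"
  unfolding alternating_form_def pullback_def
proof (intro conjI allI impI)
  fix vs :: "(real^'n) list" and i
  assume *: "length vs = k \<and> i < k"
  have "linear (\<lambda>v. \<alpha> ((map ((*v) A) vs)[i := v]))"
    using * by (intro alternating_linear[OF assms]) auto
  from linear_compose[OF matrix_vector_mul_linear this]
  show "linear (\<lambda>v. \<alpha> (map ((*v) A) (vs[i := v])))"
    by (simp add: map_update o_def)
next
  fix vs :: "(real^'n) list" and i j
  assume "length vs = k \<and> i < j \<and> j < k \<and> vs ! i = vs ! j"
  then have "\<not> distinct (map ((*v) A) vs)"
    unfolding distinct_conv_nth by (metis length_map less_trans nat_neq_iff nth_map)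
  then show "\<alpha> (map ((*v) A) vs) = 0" by (rule alternating_not_distinct[OF assms])
qed (simp add: alternating_wrong_length[OF assms])

text \<open>
  Polarisation of \<open>f u u = 0\<close>, where \<open>f\<close> is the form as a function of its arguments \<open>i\<close> and \<open>j\<close>.
\<close>

lemma alternating_swap:
  assumes "alternating_form k \<alpha>" "length vs = k" "i < k" "j < k" "i \<noteq> j"
  shows "\<alpha> (vs[i := vs ! j, j := vs ! i]) = - \<alpha> vs"
proof -
  define f where "f u v = \<alpha> (vs[i := u, j := v])" for u v
  have diag: "f u u = 0" for u
  proof -
    have "\<not> distinct (vs[i := u, j := u])"
      unfolding distinct_conv_nth not_all not_imp not_not using assms(2-5)
      by (intro exI[of _ i] exI[of _ j]) (auto simp: nth_list_update)
    then show ?thesis unfolding f_def by (rule alternating_not_distinct[OF assms(1)])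
  qed
  have l2: "linear (f u)" for u
    unfolding f_def using assms by (intro alternating_linear) auto
  have "linear (\<lambda>u. f u v)" for v
  proof -
    have "linear (\<lambda>u. \<alpha> ((vs[j := v])[i := u]))"
      using assms by (intro alternating_linear) auto
    then show ?thesis unfolding f_def using assms(5) by (simp add: list_update_swap)
  qed
  note l = linear_add[OF this] linear_add[OF l2]
  have "f (vs ! j) (vs ! i) + f (vs ! i) (vs ! j) = f (vs ! j + vs ! i) (vs ! j + vs ! i)"
    unfolding l by (simp only: diag add_0 add_0_right)
  then have "f (vs ! j) (vs ! i) = - f (vs ! i) (vs ! j)" using diag by simp
  then show ?thesis unfolding f_def by simp
qed

lemma alternating_permute_list:
  assumes "alternating_form k \<alpha>" "p permutes {..<k}" "length vs = k"
  shows "\<alpha> (permute_list p vs) = of_int (sign p) * \<alpha> vs"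
proof -
  have "\<forall>vs. length vs = k \<longrightarrow> \<alpha> (permute_list p vs) = of_int (sign p) * \<alpha> vs"
    using assms(2) finite_lessThan
  proof (induction p rule: permutes_induct)
    case id then show ?case by simp
  next
    case (swap a b p)
    show ?case
    proof (intro allI impI)
      fix vs :: "(real^'a) list" assume vs: "length vs = k"
      have t: "Transposition.transpose a b permutes {..<k}" using swap by (intro permutes_swap_id) auto
      have "permute_list (Transposition.transpose a b) vs = vs[a := vs ! b, b := vs ! a]"
        using swap(1-3) vs
        by (intro nth_equalityI) (simp_all add: permute_list_def nth_list_update Transposition.transpose_def)
      then have "\<alpha> (permute_list (Transposition.transpose a b) vs) = - \<alpha> vs"
        using alternating_swap[OF assms(1) vs] swap by simp
      moreover have "permute_list (Transposition.transpose a b \<circ> p) vs = permute_list p (permute_list (Transposition.transpose a b) vs)"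
        using swap(4) vs by (intro permute_list_compose) simp
      moreover have "sign (Transposition.transpose a b \<circ> p) = - sign p"
        using permutes_imp_permutation[OF finite_lessThan swap(4)] swap(3)
        by (simp add: sign_compose permutation_swap_id sign_swap_id)
      ultimately show "\<alpha> (permute_list (Transposition.transpose a b \<circ> p) vs) = of_int (sign (Transposition.transpose a b \<circ> p)) * \<alpha> vs"
        using swap(5) vs by simp
    qed
  qed
  then show ?thesis using assms(3) by blast
qed

definition multilinear :: "nat \<Rightarrow> ('v::real_vector list \<Rightarrow> real) \<Rightarrow> bool" where
  "multilinear k \<alpha> \<longleftrightarrow> (\<forall>vs i. length vs = k \<and> i < k \<longrightarrow> linear (\<lambda>v. \<alpha> (vs[i := v])))"

lemma alternating_multilinear: "alternating_form k \<alpha> \<Longrightarrow> multilinear k \<alpha>"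
  by (simp add: alternating_form_def multilinear_def)

lemma multilinear_Cons: "multilinear (Suc k) \<alpha> \<Longrightarrow> multilinear k (\<lambda>vs. \<alpha> (v # vs))"
  unfolding multilinear_def
proof (intro allI impI)
  fix vs :: "'a list" and i
  assume *: "\<forall>vs i. length vs = Suc k \<and> i < Suc k \<longrightarrow> linear (\<lambda>v. \<alpha> (vs[i := v]))"
    and "length vs = k \<and> i < k"
  then show "linear (\<lambda>w. \<alpha> (v # vs[i := w]))"
    using *[rule_format, of "v # vs" "Suc i"] by simp
qed

lemma multilinear_hd:
  assumes "multilinear (Suc k) \<alpha>" "length vs = k"
  shows "linear (\<lambda>v. \<alpha> (v # vs))"
  using assms(1)[unfolded multilinear_def, rule_format, of "undefined # vs" 0] assms(2) by simp

lemma linear_eq_on_axis: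
  fixes f g :: "real^'n::finite \<Rightarrow> real"
  assumes "linear f" "linear g" "\<And>i. f (axis i 1) = g (axis i 1)"
  shows "f = g"
proof
  fix v :: "real^'n"
  have v: "v = (\<Sum>i\<in>UNIV. v $ i *\<^sub>R axis i 1)"
    using basis_expansion[of v] by (simp add: scalar_mult_eq_scaleR)
  have "f v = (\<Sum>i\<in>UNIV. v $ i * f (axis i 1))"
    by (subst v) (simp add: linear_sum[OF assms(1)] linear_scale[OF assms(1)])
  also have "\<dots> = g v"
    by (subst (2) v) (simp add: linear_sum[OF assms(2)] linear_scale[OF assms(2)] assms(3))
  finally show "f v = g v" .
qed

text \<open>
  The head of the argument list is freed one vector at a time; the tail is then covered by the
  induction hypothesis.
\<close>

lemma multilinear_eqI:
  fixes \<alpha> \<beta> :: "(real^'n::finite) list \<Rightarrow> real"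
  assumes "multilinear k \<alpha>" "multilinear k \<beta>"
    and "\<And>K. length K = k \<Longrightarrow> \<alpha> (map (\<lambda>i. axis i 1) K) = \<beta> (map (\<lambda>i. axis i 1) K)"
    and "length vs = k"
  shows "\<alpha> vs = \<beta> vs"
  using assms
proof (induction k arbitrary: \<alpha> \<beta> vs)
  case 0
  from 0(3)[of "[]"] 0(4) show ?case by simp
next
  case (Suc k)
  obtain v ws where vs: "vs = v # ws" "length ws = k" using Suc.prems(4) by (cases vs) auto
  have "(\<lambda>v. \<alpha> (v # ws)) = (\<lambda>v. \<beta> (v # ws))"
  proof (rule linear_eq_on_axis)
    fix i
    show "\<alpha> (axis i 1 # ws) = \<beta> (axis i 1 # ws)"
    proof (rule Suc.IH[OF multilinear_Cons[OF Suc.prems(1)] multilinear_Cons[OF Suc.prems(2)] _ vs(2)])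
      fix K :: "'n list" assume "length K = k"
      then show "\<alpha> (axis i 1 # map (\<lambda>i. axis i 1) K) = \<beta> (axis i 1 # map (\<lambda>i. axis i 1) K)"
        using Suc.prems(3)[of "i # K"] by simp
    qed
  qed (use Suc.prems vs in \<open>auto intro: multilinear_hd\<close>)
  then show ?case unfolding vs by metis
qed

lemma length_basis_list [simp]: "length (basis_list I) = length I"
  by (simp add: basis_list_def)

lemma basis_list_simps [simp]:
  "basis_list [] = []" "basis_list (i # I) = axis i 1 # basis_list I"
  by (simp_all add: basis_list_def)

lemma basis_list_permute: "p permutes {..<length I} \<Longrightarrow> basis_list (permute_list p I) = permute_list p (basis_list I)"
  by (simp add: basis_list_def permute_list_map)

text \<open>
  The way in which nearly all identities between forms are proved below: it reduces them to finitely
  many scalar identities, 35 for 3-forms and 4-forms and 21 for 2-forms and 5-forms.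
\<close>

lemma alternating_eqI:
  assumes a: "alternating_form k \<alpha>" and b: "alternating_form k \<beta>"
    and eq: "\<And>I. I \<in> multi_indices k \<Longrightarrow> \<alpha> (basis_list I) = \<beta> (basis_list I)"
  shows "\<alpha> = \<beta>"
proof
  fix vs
  show "\<alpha> vs = \<beta> vs"
  proof (cases "length vs = k")
    case True
    show ?thesis
    proof (rule multilinear_eqI[OF alternating_multilinear[OF a] alternating_multilinear[OF b] _ True])
      fix K :: "7 list" assume K: "length K = k"
      have "\<alpha> (basis_list K) = \<beta> (basis_list K)"
      proof (cases "distinct K")
        case False
        then have "\<not> distinct (basis_list K)" by (auto simp: basis_list_def distinct_map)
        then show ?thesis using a b by (simp add: alternating_not_distinct)
      next
        case True
        obtain p where p: "p permutes {..<length (sort K)}" "permute_list p (sort K) = K"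
          using mset_eq_permutation[of K "sort K"] by auto
        have s: "sort K \<in> multi_indices k"
          using True K by (simp add: multi_indices_def strict_sorted_iff)
        have "\<gamma> (basis_list K) = of_int (sign p) * \<gamma> (basis_list (sort K))"
          if "alternating_form k \<gamma>" for \<gamma>
          using p K that alternating_permute_list[OF that, of p "basis_list (sort K)"]
          by (simp flip: basis_list_permute)
        from this[OF a] this[OF b] show ?thesis using eq[OF s] by simp
      qed
      then show "\<alpha> (map (\<lambda>i. axis i 1) K) = \<beta> (map (\<lambda>i. axis i 1) K)"
        by (simp add: basis_list_def)
    qed
  qed (simp add: alternating_wrong_length[OF a] alternating_wrong_length[OF b])
qed

section \<open>Wedge products of elementary forms\<close>

text \<open>
  A permutation of the last \<open>l\<close> of \<open>k + l\<close> positions.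
\<close>

definition shift_perm :: "nat \<Rightarrow> (nat \<Rightarrow> nat) \<Rightarrow> nat \<Rightarrow> nat" where
  "shift_perm k r i = (if i < k then i else k + r (i - k))"

lemma shift_perm:
  assumes "r permutes {..<l}"
  shows "shift_perm k r permutes {..<k + l}" "sign (shift_perm k r) = sign r"
proof -
  have "shift_perm k r permutes {..<k + l} \<and> sign (shift_perm k r) = sign r"
    using assms finite_lessThan
  proof (induction r rule: permutes_induct)
    case id
    have "shift_perm k id = id" by (auto simp: shift_perm_def)
    then show ?case by (simp only: permutes_id sign_id simp_thms)
  next
    case (swap a b r)
    have eq: "shift_perm k (Transposition.transpose a b \<circ> r) = Transposition.transpose (k + a) (k + b) \<circ> shift_perm k r"
      by (simp add: fun_eq_iff shift_perm_def Transposition.transpose_def)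
    have t: "Transposition.transpose (k + a) (k + b) permutes {..<k + l}"
      using swap by (intro permutes_swap_id) auto
    have "permutation r" "permutation (shift_perm k r)"
      using swap by (auto simp: permutation_permutes)
    then have "sign (shift_perm k (Transposition.transpose a b \<circ> r)) = sign (Transposition.transpose a b \<circ> r)"
      unfolding eq using swap by (simp add: sign_compose permutation_swap_id sign_swap_id)
    then show ?case unfolding eq using permutes_compose[OF _ t] swap(5) by blast
  qed
  then show "shift_perm k r permutes {..<k + l}" "sign (shift_perm k r) = sign r" by auto
qed

lemma prod_lessThan_add:
  fixes f :: "nat \<Rightarrow> 'a::comm_monoid_mult"
  shows "(\<Prod>j<k + l. f j) = (\<Prod>j<k. f j) * (\<Prod>j<l. f (k + j))"
proof (induction l)
  case (Suc l) then show ?case by (simp add: mult.assoc)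
qed simp

text \<open>
  Expanding both determinants turns the wedge product into a triple sum over permutations \<open>p\<close>, \<open>q\<close>,
  \<open>r\<close>. For fixed \<open>q\<close> and \<open>r\<close>, composition with \<open>q\<close> on the first \<open>k\<close> and \<open>r\<close> on the last \<open>l\<close> positions is
  a bijection of the permutations \<open>p\<close>, so that each of the \<open>k! l!\<close> pairs contributes the whole
  determinant; this is what the normalising factor cancels.
\<close>

lemma wedge_elem_form:
  fixes I J :: "'n::finite list"
  assumes [simp]: "length I = k" "length J = l"
  shows "wedge k l (elem_form I) (elem_form J) = elem_form (I @ J)"
proof
  fix vs :: "(real^'n) list"
  show "wedge k l (elem_form I) (elem_form J) vs = elem_form (I @ J) vs"
  proof (cases "length vs = k + l")
    case False then show ?thesis by (simp add: wedge_def elem_form_wrong_length)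
  next
    case vs: True
    let ?S = "\<lambda>n. {p. p permutes {..<n::nat}}"
    define G where "G p = of_int (sign p) * (\<Prod>j<k + l. (vs ! p j) $ ((I @ J) ! j))" for p
    have fin: "finite (?S n)" for n by (simp add: finite_permutations)
    have summand: "of_int (sign p) * elem_form I (take k (permute_list p vs)) * elem_form J (drop k (permute_list p vs))
      = (\<Sum>q\<in>?S k. \<Sum>r\<in>?S l. G (p \<circ> (q \<circ> shift_perm k r)))"
      if p: "p \<in> ?S (k + l)" for p
    proof -
      have p': "permutation p" using p by (auto simp: permutation_permutes)
      have pl: "permute_list p vs ! i = vs ! p i" if "i < k + l" for i
        using that vs p by (simp add: permute_list_nth)
      have I: "elem_form I (take k (permute_list p vs)) =
         (\<Sum>q\<in>?S k. of_int (sign q) * (\<Prod>j<k. (vs ! p (q j)) $ (I ! j)))"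
      proof -
        have "elem_form I (take k (permute_list p vs)) =
            (\<Sum>q\<in>?S k. of_int (sign q) * (\<Prod>j<k. (take k (permute_list p vs) ! q j) $ (I ! j)))"
          using vs by (simp add: elem_form_def)
        moreover have "take k (permute_list p vs) ! q j = vs ! p (q j)" if "q \<in> ?S k" "j < k" for q j
          using that permutes_in_image[of q "{..<k}" j] by (simp add: pl)
        ultimately show ?thesis by simp
      qed
      have J: "elem_form J (drop k (permute_list p vs)) =
         (\<Sum>r\<in>?S l. of_int (sign r) * (\<Prod>j<l. (vs ! p (k + r j)) $ (J ! j)))"
      proof -
        have "elem_form J (drop k (permute_list p vs)) =
            (\<Sum>r\<in>?S l. of_int (sign r) * (\<Prod>j<l. (drop k (permute_list p vs) ! r j) $ (J ! j)))"
          using vs by (simp add: elem_form_def)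
        moreover have "drop k (permute_list p vs) ! r j = vs ! p (k + r j)" if "r \<in> ?S l" "j < l" for r j
          using that permutes_in_image[of r "{..<l}" j] vs by (simp add: pl)
        ultimately show ?thesis by simp
      qed
      have "of_int (sign p) * (of_int (sign q) * (\<Prod>j<k. (vs ! p (q j)) $ (I ! j))) *
            (of_int (sign r) * (\<Prod>j<l. (vs ! p (k + r j)) $ (J ! j))) = G (p \<circ> (q \<circ> shift_perm k r))"
        if q: "q \<in> ?S k" and r: "r \<in> ?S l" for q r
      proof -
        have "permutation q" using q by (auto simp: permutation_permutes)
        moreover have "permutation (shift_perm k r)" using shift_perm(1)[of r l k] r
          by (auto simp: permutation_permutes)
        ultimately have s: "sign (p \<circ> (q \<circ> shift_perm k r)) = sign p * sign q * sign r"
          using p' r by (simp add: sign_compose permutation_compose shift_perm(2))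
        have "q (k + i) = k + i" for i using q by (auto intro: permutes_not_in)
        then show ?thesis
          unfolding G_def s prod_lessThan_add
          by (simp add: shift_perm_def nth_append)
      qed
      then show ?thesis
        unfolding I J by (simp add: sum_distrib_left sum_distrib_right mult.assoc) (rule sum.swap)
    qed
    have "(\<Sum>p\<in>?S (k + l). of_int (sign p) * elem_form I (take k (permute_list p vs)) * elem_form J (drop k (permute_list p vs)))
       = (\<Sum>p\<in>?S (k + l). \<Sum>q\<in>?S k. \<Sum>r\<in>?S l. G (p \<circ> (q \<circ> shift_perm k r)))"
      using summand by (rule sum.cong[OF refl])
    also have "\<dots> = (\<Sum>q\<in>?S k. \<Sum>r\<in>?S l. \<Sum>p\<in>?S (k + l). G (p \<circ> (q \<circ> shift_perm k r)))"
      by (subst sum.swap, rule sum.cong[OF refl], subst sum.swap) simp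
    also have "\<dots> = (\<Sum>q\<in>?S k. \<Sum>r\<in>?S l. \<Sum>p\<in>?S (k + l). G p)"
    proof (rule sum.cong[OF refl], rule sum.cong[OF refl])
      fix q r assume "q \<in> ?S k" "r \<in> ?S l"
      then have "q \<circ> shift_perm k r permutes {..<k + l}"
        using permutes_compose[OF shift_perm(1)[of r l k] permutes_subset[of q "{..<k}" "{..<k + l}"]] by auto
      from sum_permutations_compose_right[OF this, of G]
      show "(\<Sum>p\<in>?S (k + l). G (p \<circ> (q \<circ> shift_perm k r))) = (\<Sum>p\<in>?S (k + l). G p)" by simp
    qed
    also have "\<dots> = fact k * fact l * elem_form (I @ J) vs"
      using vs by (simp add: card_permutations elem_form_def G_def)
    finally show ?thesis using vs by (simp add: wedge_def)
  qed
qed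

lemma wedge_add:
  "wedge k l (\<lambda>vs. \<alpha> vs + \<alpha>' vs) \<beta> = (\<lambda>vs. wedge k l \<alpha> \<beta> vs + wedge k l \<alpha>' \<beta> vs)"
  "wedge k l \<alpha> (\<lambda>vs. \<beta> vs + \<beta>' vs) = (\<lambda>vs. wedge k l \<alpha> \<beta> vs + wedge k l \<alpha> \<beta>' vs)"
  by (auto simp: wedge_def fun_eq_iff ring_distribs sum.distrib add_divide_distrib)

lemma wedge_scale:
  "wedge k l (\<lambda>vs. c * \<alpha> vs) \<beta> = (\<lambda>vs. c * wedge k l \<alpha> \<beta> vs)"
  "wedge k l \<alpha> (\<lambda>vs. c * \<beta> vs) = (\<lambda>vs. c * wedge k l \<alpha> \<beta> vs)"
  by (auto simp: wedge_def fun_eq_iff sum_distrib_left mult_ac)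

lemma wedge_uminus:
  "wedge k l (\<lambda>vs. - \<alpha> vs) \<beta> = (\<lambda>vs. - wedge k l \<alpha> \<beta> vs)"
  "wedge k l \<alpha> (\<lambda>vs. - \<beta> vs) = (\<lambda>vs. - wedge k l \<alpha> \<beta> vs)"
  using wedge_scale(1)[of k l "-1" \<alpha> \<beta>] wedge_scale(2)[of k l \<alpha> "-1" \<beta>] by simp_all

lemma wedge_diff:
  "wedge k l (\<lambda>vs. \<alpha> vs - \<alpha>' vs) \<beta> = (\<lambda>vs. wedge k l \<alpha> \<beta> vs - wedge k l \<alpha>' \<beta> vs)"
  "wedge k l \<alpha> (\<lambda>vs. \<beta> vs - \<beta>' vs) = (\<lambda>vs. wedge k l \<alpha> \<beta> vs - wedge k l \<alpha> \<beta>' vs)"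
  by (simp_all only: diff_conv_add_uminus wedge_add wedge_uminus)

lemmas wedge_linear = wedge_add wedge_scale wedge_uminus wedge_diff

lemma wedge_zero [simp]: "wedge k l (\<lambda>vs. 0) \<beta> = (\<lambda>vs. 0)" "wedge k l \<alpha> (\<lambda>vs. 0) = (\<lambda>vs. 0)"
  by (auto simp: wedge_def fun_eq_iff)

lemma wedge_sum_left:
  assumes "finite A"
  shows "wedge k l (\<lambda>vs. \<Sum>i\<in>A. \<alpha> i vs) \<beta> = (\<lambda>vs. \<Sum>i\<in>A. wedge k l (\<alpha> i) \<beta> vs)"
  using assms
proof (induction A)
  case empty show ?case by (simp add: wedge_def fun_eq_iff)
qed (simp add: wedge_linear)

lemma wedge_sum_right:
  assumes "finite A"
  shows "wedge k l \<alpha> (\<lambda>vs. \<Sum>i\<in>A. \<beta> i vs) = (\<lambda>vs. \<Sum>i\<in>A. wedge k l \<alpha> (\<beta> i) vs)"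
  using assms
proof (induction A)
  case empty show ?case by (simp add: wedge_def fun_eq_iff)
qed (simp add: wedge_linear)

lemma pullback_wedge:
  fixes A :: "real^'n::finite^'m::finite"
  shows "pullback A (wedge k l \<alpha> \<beta>) = wedge k l (pullback A \<alpha>) (pullback A \<beta>)"
proof
  fix vs :: "(real^'n) list"
  have "permute_list p (map ((*v) A) vs) = map ((*v) A) (permute_list p vs)"
    if "p permutes {..<length vs}" for p
    using that by (simp add: permute_list_map)
  then show "pullback A (wedge k l \<alpha> \<beta>) vs = wedge k l (pullback A \<alpha>) (pullback A \<beta>) vs"
    by (auto simp: pullback_def wedge_def take_map drop_map intro!: sum.cong)
qed

section \<open>Computing with the index type\<close>

lemma less_7 [simp]:
  "(7::7) < 1" "(7::7) < 2" "(7::7) < 3" "(7::7) < 4" "(7::7) < 5" "(7::7) < 6"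
  "(1::7) < 2" "(1::7) < 3" "(1::7) < 4" "(1::7) < 5" "(1::7) < 6"
  "(2::7) < 3" "(2::7) < 4" "(2::7) < 5" "(2::7) < 6" "(3::7) < 4" "(3::7) < 5"
  "(3::7) < 6" "(4::7) < 5" "(4::7) < 6" "(5::7) < 6"
  by (simp_all add: less_bit1_def bit1.Rep_numeral bit1.Rep_1)

lemma UNIV_7: "(UNIV :: 7 set) = {7,1,2,3,4,5,6}"
  by (rule sym, rule card_subset_eq) simp_all

lemma sum_7: "(\<Sum>i\<in>(UNIV::7 set). f i) = f 1 + f 2 + f 3 + f 4 + f 5 + f 6 + (f 7 :: 'a::comm_monoid_add)"
  unfolding UNIV_7 by (simp add: add_ac)

lemma forall_7: "(\<forall>i::7. P i) \<longleftrightarrow> P 1 \<and> P 2 \<and> P 3 \<and> P 4 \<and> P 5 \<and> P 6 \<and> P 7"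
  using UNIV_7 by (metis UNIV_I insertE singletonD)

text \<open>
  An executable enumeration of \<^const>\<open>multi_indices\<close>.
\<close>

fun sublists_of :: "nat \<Rightarrow> 'a list \<Rightarrow> 'a list list" where
  "sublists_of 0 xs = [[]]"
| "sublists_of (Suc k) [] = []"
| "sublists_of (Suc k) (x # xs) = map ((#) x) (sublists_of k xs) @ sublists_of (Suc k) xs"

lemma sublists_of_numeral [simp]:
  "sublists_of (numeral n) [] = []"
  "sublists_of (numeral n) (x # xs) = map ((#) x) (sublists_of (pred_numeral n) xs) @ sublists_of (numeral n) xs"
  by (simp_all add: numeral_eq_Suc)

lemma set_sublists_of:
  assumes "sorted_wrt (<) (xs :: 'a::linorder list)"
  shows "set (sublists_of k xs) = {I. sorted_wrt (<) I \<and> length I = k \<and> set I \<subseteq> set xs}"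
  using assms
proof (induction k xs rule: sublists_of.induct)
  case (3 k x xs)
  have x: "\<And>z. z \<in> set xs \<Longrightarrow> x < z" and xs: "sorted_wrt (<) xs" using 3(3) by auto
  have "I \<in> (#) x ` {I. sorted_wrt (<) I \<and> length I = k \<and> set I \<subseteq> set xs} \<or>
        sorted_wrt (<) I \<and> length I = Suc k \<and> set I \<subseteq> set xs \<longleftrightarrow>
        sorted_wrt (<) I \<and> length I = Suc k \<and> set I \<subseteq> set (x # xs)" for I
  proof (cases I)
    case (Cons y J)
    show ?thesis
    proof (cases "y = x")
      case True
      have "set J \<subseteq> set xs" if "\<forall>z\<in>set J. x < z" "set J \<subseteq> insert x (set xs)"
        using that by blast
      then show ?thesis unfolding Cons using True x by (auto simp: image_iff)
    next
      case False
      have "set J \<subseteq> set xs" if "y \<in> set xs" "\<forall>z\<in>set J. y < z" "set J \<subseteq> insert x (set xs)"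
        using that x[of y] order.asym by blast
      then show ?thesis unfolding Cons using False by (auto simp: image_iff)
    qed
  qed auto
  then have "(#) x ` {I. sorted_wrt (<) I \<and> length I = k \<and> set I \<subseteq> set xs} \<union>
      {I. sorted_wrt (<) I \<and> length I = Suc k \<and> set I \<subseteq> set xs} =
      {I. sorted_wrt (<) I \<and> length I = Suc k \<and> set I \<subseteq> set (x # xs)}" by blast
  then show ?case using 3(1,2)[OF xs] by simp
qed auto

text \<open>
  The order of the index type begins with \<open>7 = 0\<close>.
\<close>

lemma multi_indices_eq: "multi_indices k = set (sublists_of k [7,1,2,3,4,5,6])"
proof -
  have "set [7,1,2,3,4,5,6::7] = UNIV" using UNIV_7 by simp
  then show ?thesis by (subst set_sublists_of) (auto simp: multi_indices_def)
qed

lemma finite_multi_indices [simp]: "finite (multi_indices k)"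
  by (simp add: multi_indices_eq del: sublists_of.simps sublists_of_numeral)

section \<open>Evaluating elementary forms on basis vectors\<close>

text \<open>
  Contraction with a basis vector. As a rewrite rule it follows a single branch of the expansion,
  whereas the general expansion of a \<open>k\<close>-form has \<open>k!\<close> branches.
\<close>

lemma elem_form_axis:
  assumes "distinct I"
  shows "elem_form I (axis m 1 # ws) =
    (if m \<in> set I
     then (if even (length (takeWhile (\<lambda>j. j \<noteq> m) I)) then 1 else -1) * elem_form (remove1 m I) ws
     else 0)"
  using assms
proof (induction I arbitrary: ws)
  case (Cons i I)
  let ?s = "if even (length (takeWhile (\<lambda>j. j \<noteq> m) I)) then 1 else - 1 :: real"
  have step: "elem_form (i # I) (axis m 1 # ws) =
      (if i = m then elem_form I ws else 0) - wedge1 (\<lambda>v. v $ i) (\<lambda>ws. elem_form I (axis m 1 # ws)) ws"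
    by (simp add: axis_def elem_form_Cons)
  have IH: "elem_form I (axis m 1 # ws) =
      (if m \<in> set I then ?s else 0) * elem_form (remove1 m I) ws" for ws
    using Cons by simp
  show ?case
    unfolding step IH wedge1_scale using Cons.prems by (cases "i = m") (auto simp: elem_form_Cons)
qed simp

lemma elem_form_diag: "distinct I \<Longrightarrow> elem_form I (map (\<lambda>i. axis i 1) I) = 1"
  by (induction I) (simp_all add: elem_form_axis)

lemma elem_form_reorder:
  assumes "distinct I" "distinct J" "set I = set J"
  shows "elem_form I = (\<lambda>vs. elem_form I (map (\<lambda>i. axis i 1) J) * elem_form J vs)"
proof -
  have "mset I = mset J" using assms by (metis mset_set_set)
  then obtain p where p: "p permutes {..<length J}" "permute_list p J = I"
    using mset_eq_permutation by metis
  have *: "elem_form I vs = of_int (sign p) * elem_form J vs" for vs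
    using elem_form_permute_list[OF p(1)] p(2) by simp
  show ?thesis using *[of "map (\<lambda>i. axis i 1) J"] * elem_form_diag[OF assms(2)] by auto
qed

section \<open>The model forms and their algebra\<close>

text \<open>
  The Hodge dual of \<^const>\<open>phi0\<close>.
\<close>

definition psi0 :: "7 covector" where
  "psi0 = (\<lambda>vs. elem_form [4,5,6,7] vs + elem_form [2,3,6,7] vs + elem_form [2,3,4,5] vs
     + elem_form [1,3,5,7] vs - elem_form [1,3,4,6] vs - elem_form [1,2,5,6] vs - elem_form [1,2,4,7] vs)"

lemma alternating_phi0 [simp]: "alternating_form 3 phi0"
  unfolding phi0_def by (intro alternating_add alternating_diff alternating_elem_form) simp_all

lemma alternating_psi0 [simp]: "alternating_form 4 psi0"
  unfolding psi0_def by (intro alternating_add alternating_diff alternating_elem_form) simp_all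

lemma alternating_vol0: "alternating_form 7 vol0"
  unfolding vol0_def by (intro alternating_elem_form) simp

lemma alternating_append_right:
  assumes \<alpha>: "alternating_form (k + l) \<alpha>" and us: "length us = l"
  shows "alternating_form k (\<lambda>vs. \<alpha> (vs @ us))"
  unfolding alternating_form_def
proof (intro conjI allI impI)
  fix vs :: "(real^'a) list" and i
  assume "length vs = k \<and> i < k"
  then show "linear (\<lambda>v. \<alpha> (vs[i := v] @ us))"
    using alternating_linear[OF \<alpha>, of "vs @ us" i] us by (simp add: list_update_append1)
next
  fix vs :: "(real^'a) list" and i j
  assume "length vs = k \<and> i < j \<and> j < k \<and> vs ! i = vs ! j"
  then have "\<not> distinct vs" unfolding distinct_conv_nth by (metis order.strict_trans order.strict_iff_not)
  then show "\<alpha> (vs @ us) = 0" using alternating_not_distinct[OF \<alpha>] by simp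
next
  fix vs :: "(real^'a) list" assume "length vs \<noteq> k"
  then show "\<alpha> (vs @ us) = 0" using us by (intro alternating_wrong_length[OF \<alpha>]) auto
qed

lemma hodge0_eq:
  assumes "k \<le> 7"
  shows "hodge0 k \<alpha> = (\<lambda>ws. \<Sum>I\<in>multi_indices k. \<alpha> (basis_list I) * vol0 (basis_list I @ ws))"
proof
  fix ws :: "(real^7) list"
  show "hodge0 k \<alpha> ws = (\<Sum>I\<in>multi_indices k. \<alpha> (basis_list I) * vol0 (basis_list I @ ws))"
  proof (cases "length ws = 7 - k")
    case False
    then have "vol0 (basis_list I @ ws) = 0" if "I \<in> multi_indices k" for I
      using that assms by (intro alternating_wrong_length[OF alternating_vol0]) (auto simp: multi_indices_def)
    then show ?thesis using False by (simp add: hodge0_def)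
  qed (simp add: hodge0_def)
qed

lemma sublists_of_subset: "I \<in> set (sublists_of k xs) \<Longrightarrow> set I \<subseteq> set xs"
proof (induction k xs arbitrary: I rule: sublists_of.induct)
  case (3 k x xs)
  then show ?case by fastforce
qed auto

lemma distinct_sublists_of: "distinct xs \<Longrightarrow> distinct (sublists_of k xs)"
proof (induction k xs rule: sublists_of.induct)
  case (3 k x xs)
  then have "x # J \<notin> set (sublists_of (Suc k) xs)" for J
    using sublists_of_subset[of "x # J" "Suc k" xs] by auto
  then show ?case using 3 by (auto simp: distinct_map)
qed auto

lemma sum_multi_indices:
  "(\<Sum>I\<in>multi_indices k. f I) = sum_list (map f (sublists_of k [7,1,2,3,4,5,6]))"
  by (simp only: multi_indices_eq) (simp add: sum_list_distinct_conv_sum_set distinct_sublists_of del: sublists_of.simps)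

text \<open>
  The sign of the permutation that takes \<open>I\<close> to \<open>K\<close>, and \<open>0\<close> if there is none.
\<close>

fun eps :: "'a list \<Rightarrow> 'a list \<Rightarrow> real" where
  "eps I [] = (if I = [] then 1 else 0)"
| "eps I (m # K) = (if m \<in> set I
     then (if even (length (takeWhile (\<lambda>j. j \<noteq> m) I)) then 1 else -1) * eps (remove1 m I) K else 0)"

lemma elem_form_basis: "distinct I \<Longrightarrow> elem_form I (map (\<lambda>i. axis i 1) K) = eps I K"
proof (induction K arbitrary: I)
  case Nil
  then show ?case by (cases I) (auto simp: elem_form_Cons)
next
  case (Cons m K)
  then show ?case by (simp add: elem_form_axis)
qed

text \<open>
  With a concrete target \<open>J\<close> this is a terminating rewrite rule; the side condition \<open>I \<noteq> J\<close> keeps it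
  from looping.
\<close>

lemma sort_elem_form:
  assumes "list_all (\<lambda>i. i \<in> set J) I" "distinct I" "distinct J" "length I = length J" "I \<noteq> J"
  shows "elem_form I = (\<lambda>vs. eps I J * elem_form J vs)"
proof -
  have "set I = set J"
    using assms by (intro card_subset_eq) (auto simp: list_all_iff distinct_card)
  then show ?thesis
    using elem_form_reorder[OF assms(2,3)] elem_form_basis[OF assms(2), of J] by simp
qed

lemma phi0_basis:
  "\<forall>J\<in>set (sublists_of 3 [7,1,2,3,4,5,6]). phi0 (basis_list J) =
     (if J = [1,2,3] \<or> J = [1,4,5] \<or> J = [7,1,6] \<or> J = [2,4,6] then 1
      else if J = [7,2,5] \<or> J = [7,3,4] \<or> J = [3,5,6] then -1 else 0)"
  by (simp add: phi0_def elem_form_axis)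

text \<open>
  Only seven components of \<^const>\<open>phi0\<close> are non-zero, so that the sum that defines the Hodge star has
  seven terms, and each is a contraction of \<^const>\<open>vol0\<close>.
\<close>

lemma hodge0_phi0: "hodge0 3 phi0 = psi0"
proof -
  have "hodge0 3 phi0 ws = vol0 (basis_list [1,2,3] @ ws) + vol0 (basis_list [1,4,5] @ ws)
      + vol0 (basis_list [7,1,6] @ ws) + vol0 (basis_list [2,4,6] @ ws) - vol0 (basis_list [7,2,5] @ ws)
      - vol0 (basis_list [7,3,4] @ ws) - vol0 (basis_list [3,5,6] @ ws)" for ws
    using phi0_basis by (simp add: hodge0_eq sum_multi_indices )
  then show ?thesis
    by (simp add: fun_eq_iff vol0_def psi0_def elem_form_axis)
qed

text \<open>
  The 2-forms on the sum of the three coordinate planes that a maximal torus of \<open>G\<^sub>2\<close> rotates. Those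
  with \<open>a + b + c = 0\<close> form the Lie algebra of that torus.
\<close>

definition beta0 :: "real \<Rightarrow> real \<Rightarrow> real \<Rightarrow> 7 covector" where
  "beta0 a b c = (\<lambda>vs. a * elem_form [2,3] vs + b * elem_form [4,5] vs + c * elem_form [6,7] vs)"

lemma alternating_beta0 [simp]: "alternating_form 2 (beta0 a b c)"
  unfolding beta0_def by (intro alternating_add alternating_scale alternating_elem_form) simp_all

lemma wedge_beta0_phi0:
  "wedge 2 3 (beta0 a b c) phi0 = (\<lambda>vs. (a + b) * elem_form [1,2,3,4,5] vs
     + (a + c) * elem_form [1,2,3,6,7] vs + (b + c) * elem_form [1,4,5,6,7] vs)"
  unfolding beta0_def phi0_def
  by (simp only: wedge_linear, simp add: wedge_elem_form elem_form_axis elem_form_not_distinct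
      sort_elem_form[of "[1,2,3,4,5]"] sort_elem_form[of "[1,2,3,6,7]"] sort_elem_form[of "[1,4,5,6,7]"]
     )
    (simp add: algebra_simps)

lemma wedge_beta0_beta0:
  "wedge 2 2 (beta0 a b c) (beta0 a b c) = (\<lambda>vs. 2 * a * b * elem_form [2,3,4,5] vs
     + 2 * a * c * elem_form [2,3,6,7] vs + 2 * b * c * elem_form [4,5,6,7] vs)"
  unfolding beta0_def
  by (simp only: wedge_linear, simp add: wedge_elem_form elem_form_axis elem_form_not_distinct
      sort_elem_form[of "[2,3,4,5]"] sort_elem_form[of "[2,3,6,7]"] sort_elem_form[of "[4,5,6,7]"]
     )
    (simp add: algebra_simps)

lemma hodge0_linear:
  assumes "k \<le> 7"
  shows "hodge0 k (\<lambda>vs. \<alpha> vs + \<beta> vs) = (\<lambda>vs. hodge0 k \<alpha> vs + hodge0 k \<beta> vs)"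
    "hodge0 k (\<lambda>vs. c * \<alpha> vs) = (\<lambda>vs. c * hodge0 k \<alpha> vs)"
  by (simp_all add: hodge0_eq[OF assms] ring_distribs sum.distrib sum_distrib_left mult.assoc)

lemma sum_elem_form_basis:
  "(\<Sum>I\<in>multi_indices 4. elem_form [2,3,4,5] (basis_list I) * f I) = f [2,3,4,5]"
  "(\<Sum>I\<in>multi_indices 4. elem_form [2,3,6,7] (basis_list I) * f I) = - f [7,2,3,6]"
  "(\<Sum>I\<in>multi_indices 4. elem_form [4,5,6,7] (basis_list I) * f I) = - f [7,4,5,6]"
  by (simp_all add: sum_multi_indices elem_form_axis)

lemma hodge0_elem_form:
  "hodge0 4 (elem_form [2,3,4,5]) = elem_form [1,6,7]"
  "hodge0 4 (elem_form [2,3,6,7]) = elem_form [1,4,5]"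
  "hodge0 4 (elem_form [4,5,6,7]) = elem_form [1,2,3]"
proof -
  have 4: "4 \<le> (7::nat)" by simp
  show "hodge0 4 (elem_form [2,3,4,5]) = elem_form [1,6,7]"
    "hodge0 4 (elem_form [2,3,6,7]) = elem_form [1,4,5]"
    "hodge0 4 (elem_form [4,5,6,7]) = elem_form [1,2,3]"
    unfolding hodge0_eq[OF 4] sum_elem_form_basis by (simp_all add: fun_eq_iff vol0_def elem_form_axis)
qed

lemma hodge0_wedge_beta0:
  "hodge0 4 (wedge 2 2 (beta0 a b c) (beta0 a b c)) = (\<lambda>vs. 2 * b * c * elem_form [1,2,3] vs
     + 2 * a * c * elem_form [1,4,5] vs + 2 * a * b * elem_form [1,6,7] vs)"
proof -
  have 4: "4 \<le> (7::nat)" by simp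
  show ?thesis
    unfolding wedge_beta0_beta0 hodge0_linear[OF 4] hodge0_elem_form by auto
qed

lemma norm_sq0_beta0: "norm_sq0 2 (beta0 a b c) = a\<^sup>2 + b\<^sup>2 + c\<^sup>2"
  unfolding norm_sq0_def sum_multi_indices beta0_def
  by (simp add: elem_form_axis)

section \<open>Uniqueness of the torsion form\<close>

text \<open>
  The matrix of \<open>\<tau> \<mapsto> \<tau> \<and> \<phi>\<close>, written with respect to elementary forms.
\<close>

definition wedge_coeff :: "7 list \<Rightarrow> 7 list \<Rightarrow> real" where
  "wedge_coeff I K = elem_form (I @ [1,2,3]) (basis_list K) + elem_form (I @ [1,4,5]) (basis_list K)
      + elem_form (I @ [1,6,7]) (basis_list K) + elem_form (I @ [2,4,6]) (basis_list K)
      - elem_form (I @ [2,5,7]) (basis_list K) - elem_form (I @ [3,4,7]) (basis_list K)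
      - elem_form (I @ [3,5,6]) (basis_list K)"

text \<open>
  The matrix splits into blocks of size 3, one for each basis vector \<open>e\<^sub>i\<close>; the three 2-forms of
  a block are the summands of the contraction of \<open>e\<^sub>i\<close> with \<open>\<phi>\<close>. Each equation omits one of
  the three, as \<open>e\<^sup>j\<^sup>k \<and> \<phi>\<close> does not contain the complement of \<open>e\<^sup>j\<^sup>k\<close>.
\<close>

lemma wedge_coeff_sums:
  "(\<Sum>I\<in>multi_indices 2. d I * wedge_coeff I [7,1,2,3,4]) = - d [7,4] - d [1,2]"
  "(\<Sum>I\<in>multi_indices 2. d I * wedge_coeff I [7,1,2,3,5]) = - d [7,5] + d [1,3]"
  "(\<Sum>I\<in>multi_indices 2. d I * wedge_coeff I [7,1,2,3,6]) = - d [7,6] + d [2,3]"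
  "(\<Sum>I\<in>multi_indices 2. d I * wedge_coeff I [7,1,2,4,5]) = - d [7,2] + d [1,4]"
  "(\<Sum>I\<in>multi_indices 2. d I * wedge_coeff I [7,1,2,4,6]) = d [7,1] + d [2,4]"
  "(\<Sum>I\<in>multi_indices 2. d I * wedge_coeff I [7,1,2,5,6]) = - d [1,6] + d [2,5]"
  "(\<Sum>I\<in>multi_indices 2. d I * wedge_coeff I [7,1,3,4,5]) = - d [7,3] - d [1,5]"
  "(\<Sum>I\<in>multi_indices 2. d I * wedge_coeff I [7,1,3,4,6]) = - d [1,6] + d [3,4]"
  "(\<Sum>I\<in>multi_indices 2. d I * wedge_coeff I [7,1,3,5,6]) = - d [7,1] + d [3,5]"
  "(\<Sum>I\<in>multi_indices 2. d I * wedge_coeff I [7,1,4,5,6]) = - d [7,6] + d [4,5]"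
  "(\<Sum>I\<in>multi_indices 2. d I * wedge_coeff I [7,2,3,4,5]) = - d [2,5] - d [3,4]"
  "(\<Sum>I\<in>multi_indices 2. d I * wedge_coeff I [7,2,3,4,6]) = - d [7,3] - d [2,6]"
  "(\<Sum>I\<in>multi_indices 2. d I * wedge_coeff I [7,2,3,5,6]) = - d [7,2] + d [3,6]"
  "(\<Sum>I\<in>multi_indices 2. d I * wedge_coeff I [7,2,4,5,6]) = d [7,5] + d [4,6]"
  "(\<Sum>I\<in>multi_indices 2. d I * wedge_coeff I [7,3,4,5,6]) = d [7,4] - d [5,6]"
  "(\<Sum>I\<in>multi_indices 2. d I * wedge_coeff I [1,2,3,4,5]) = d [2,3] + d [4,5]"
  "(\<Sum>I\<in>multi_indices 2. d I * wedge_coeff I [1,2,3,4,6]) = - d [1,3] + d [4,6]"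
  "(\<Sum>I\<in>multi_indices 2. d I * wedge_coeff I [1,2,3,5,6]) = - d [1,2] + d [5,6]"
  "(\<Sum>I\<in>multi_indices 2. d I * wedge_coeff I [1,2,4,5,6]) = d [1,5] + d [2,6]"
  "(\<Sum>I\<in>multi_indices 2. d I * wedge_coeff I [1,3,4,5,6]) = d [1,4] + d [3,6]"
  "(\<Sum>I\<in>multi_indices 2. d I * wedge_coeff I [2,3,4,5,6]) = d [2,4] - d [3,5]"

  by (simp_all add: sum_multi_indices wedge_coeff_def elem_form_axis elem_form_not_distinct)

lemma wedge_phi0_inj:
  assumes \<delta>: "alternating_form 2 \<delta>" and 0: "wedge 2 3 \<delta> phi0 = (\<lambda>vs. 0)"
  shows "\<delta> = (\<lambda>vs. 0)"
proof -
  define d where "d I = \<delta> (basis_list I)" for I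
  have exp: "\<delta> = (\<lambda>vs. \<Sum>I\<in>multi_indices 2. d I * elem_form I vs)"
  proof (rule alternating_eqI[OF \<delta>])
    show "alternating_form 2 (\<lambda>vs. \<Sum>I\<in>multi_indices 2. d I * elem_form I vs)"
      by (intro alternating_sum alternating_scale alternating_elem_form) (simp add: multi_indices_def)
    have "\<forall>K\<in>set (sublists_of 2 [7,1,2,3,4,5,6]). d K = (\<Sum>I\<in>multi_indices 2. d I * elem_form I (basis_list K))"
      by (simp add: sum_multi_indices elem_form_axis)
    then show "\<delta> (basis_list K) = (\<Sum>I\<in>multi_indices 2. d I * elem_form I (basis_list K))"
      if "K \<in> multi_indices 2" for K using that unfolding d_def[symmetric] multi_indices_eq by blast
  qed
  have "wedge 2 3 (elem_form I) phi0 (basis_list K) = wedge_coeff I K" if "I \<in> multi_indices 2" for I K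
    using that unfolding phi0_def
    by (simp only: wedge_linear) (simp add: wedge_elem_form multi_indices_def wedge_coeff_def)
  then have "wedge 2 3 \<delta> phi0 (basis_list K) = (\<Sum>I\<in>multi_indices 2. d I * wedge_coeff I K)" for K
    by (subst exp) (simp add: wedge_sum_left wedge_scale)
  then have sum0: "(\<Sum>I\<in>multi_indices 2. d I * wedge_coeff I K) = 0" for K by (simp add: 0)
  have "\<forall>I\<in>set (sublists_of 2 [7,1,2,3,4,5,6]). d I = 0"
    using wedge_coeff_sums[of d, unfolded sum0] by simp
  then have "\<delta> (basis_list I) = 0" if "I \<in> multi_indices 2" for I
    using that unfolding d_def multi_indices_eq by blast
  then show ?thesis by (intro alternating_eqI[OF \<delta>]) auto
qed

section \<open>Contractions, norms and the Hodge star under similarities\<close>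

text \<open>
  A similarity has a multiple of its transpose as inverse, and a left inverse of a square matrix is a
  right inverse.
\<close>

lemma gram_transpose:
  fixes A :: "real^'n::finite^'n"
  assumes "\<And>u v. (A *v u) \<bullet> (A *v v) = d * (u \<bullet> v)" "d \<noteq> 0"
  shows "A ** transpose A = d *\<^sub>R mat 1" "transpose A ** A = d *\<^sub>R mat 1"
proof -
  have "(transpose A ** A) $ i $ j = (d *\<^sub>R mat 1) $ i $ j" for i j
  proof -
    have "(transpose A ** A) $ i $ j = (A *v axis i 1) \<bullet> (A *v axis j 1)"
      by (simp add: matrix_matrix_mult_def Finite_Cartesian_Product.transpose_def inner_vec_def matrix_vector_mult_basis column_def)
    then show ?thesis unfolding assms by (simp add: inner_axis_axis Finite_Cartesian_Product.mat_def)
  qed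
  then show *: "transpose A ** A = d *\<^sub>R mat 1" by (simp add: Finite_Cartesian_Product.vec_eq_iff)
  have sc: "(c *\<^sub>R M) ** N = c *\<^sub>R (M ** N)" "M ** (c *\<^sub>R N) = c *\<^sub>R (M ** N)"
    for M N :: "real^'n^'n" and c :: real
    by (simp_all add: Finite_Cartesian_Product.vec_eq_iff matrix_matrix_mult_def sum_distrib_left mult_ac)
  have "((1/d) *\<^sub>R transpose A) ** A = mat 1"
    using assms(2) by (simp add: sc *)
  then have "A ** ((1/d) *\<^sub>R transpose A) = mat 1" by (simp only: matrix_left_right_inverse)
  then have "d *\<^sub>R ((1/d) *\<^sub>R (A ** transpose A)) = d *\<^sub>R mat 1" by (simp only: sc)
  then show "A ** transpose A = d *\<^sub>R mat 1" using assms(2) by simp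
qed

text \<open>
  The full contraction of two covariant \<open>k\<close>-tensors with the Euclidean metric. In contrast to sums
  over increasing multi-indices it can be transformed one index at a time.
\<close>

fun contr :: "nat \<Rightarrow> 'n::finite covector \<Rightarrow> 'n covector \<Rightarrow> real" where
  "contr 0 \<alpha> \<beta> = \<alpha> [] * \<beta> []"
| "contr (Suc k) \<alpha> \<beta> = (\<Sum>i\<in>UNIV. contr k (\<lambda>vs. \<alpha> (axis i 1 # vs)) (\<lambda>vs. \<beta> (axis i 1 # vs)))"

lemma contr_linear_left:
  "contr k (\<lambda>vs. \<Sum>a\<in>S. c a * \<alpha> a vs) \<beta> = (\<Sum>a\<in>S. c a * contr k (\<alpha> a) \<beta>)"
proof (induction k arbitrary: \<alpha> \<beta>)
  case (Suc k)
  then show ?case by (simp add: sum_distrib_left) (rule sum.swap)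
qed (simp add: sum_distrib_right mult.assoc)

lemma contr_linear_right:
  "contr k \<alpha> (\<lambda>vs. \<Sum>a\<in>S. c a * \<beta> a vs) = (\<Sum>a\<in>S. c a * contr k \<alpha> (\<beta> a))"
proof (induction k arbitrary: \<alpha> \<beta>)
  case (Suc k)
  then show ?case by (simp add: sum_distrib_left) (rule sum.swap)
qed (simp add: sum_distrib_left mult_ac)

lemma contr_cong:
  assumes "\<And>vs. length vs = k \<Longrightarrow> \<alpha> vs = \<alpha>' vs" "\<And>vs. length vs = k \<Longrightarrow> \<beta> vs = \<beta>' vs"
  shows "contr k \<alpha> \<beta> = contr k \<alpha>' \<beta>'"
  using assms
proof (induction k arbitrary: \<alpha> \<beta> \<alpha>' \<beta>')
  case (Suc k)
  show ?case unfolding contr.simps by (intro sum.cong refl Suc.IH) (simp_all add: Suc.prems)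
qed simp

lemma multilinear_expand_hd:
  fixes A :: "real^'n::finite^'n"
  assumes "multilinear (Suc k) \<alpha>" "length vs = k"
  shows "\<alpha> (column i A # vs) = (\<Sum>a\<in>UNIV. A $ a $ i * \<alpha> (axis a 1 # vs))"
proof -
  note l = linear_sum[OF multilinear_hd[OF assms]] linear_scale[OF multilinear_hd[OF assms]]
  have "column i A = (\<Sum>a\<in>UNIV. A $ a $ i *\<^sub>R axis a 1)"
    using basis_expansion[of "column i A"] by (simp add: scalar_mult_eq_scaleR column_def)
  then show ?thesis by (simp add: l)
qed

text \<open>
  Each of the \<open>k\<close> indices contributes the factor \<open>d\<close>.
\<close>

lemma contr_pullback:
  fixes A :: "real^'n::finite^'n"
  assumes A: "A ** transpose A = d *\<^sub>R mat 1" and "multilinear k \<alpha>" "multilinear k \<beta>"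
  shows "contr k (pullback A \<alpha>) (pullback A \<beta>) = d ^ k * contr k \<alpha> \<beta>"
  using assms(2-)
proof (induction k arbitrary: \<alpha> \<beta>)
  case (Suc k)
  let ?h = "\<lambda>\<alpha> v vs. \<alpha> (v # vs)"
  have gram: "(\<Sum>i\<in>UNIV. A $ a $ i * A $ b $ i) = (if a = b then d else 0)" for a b
    using arg_cong[OF A, of "\<lambda>M. M $ a $ b"] by (simp add: matrix_matrix_mult_def Finite_Cartesian_Product.transpose_def Finite_Cartesian_Product.mat_def)
  have "contr (Suc k) (pullback A \<alpha>) (pullback A \<beta>) =
      (\<Sum>i\<in>UNIV. contr k (pullback A (?h \<alpha> (column i A))) (pullback A (?h \<beta> (column i A))))"
    by (simp add: pullback_def matrix_vector_mult_basis)
  also have "\<dots> = (\<Sum>i\<in>UNIV. d ^ k * contr k (?h \<alpha> (column i A)) (?h \<beta> (column i A)))"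
    using Suc by (intro sum.cong refl Suc.IH multilinear_Cons) auto
  also have "\<dots> = (\<Sum>i\<in>UNIV. d ^ k * contr k (\<lambda>vs. \<Sum>a\<in>UNIV. A $ a $ i * ?h \<alpha> (axis a 1) vs)
       (\<lambda>vs. \<Sum>b\<in>UNIV. A $ b $ i * ?h \<beta> (axis b 1) vs))"
    using Suc.prems by (intro sum.cong refl arg_cong2[of _ _ _ _ "(*)"] contr_cong) (auto simp: multilinear_expand_hd)
  also have "\<dots> = d ^ k * (\<Sum>i\<in>UNIV. \<Sum>a\<in>UNIV. \<Sum>b\<in>UNIV. A $ a $ i * A $ b $ i * contr k (?h \<alpha> (axis a 1)) (?h \<beta> (axis b 1)))"
    by (simp add: contr_linear_left contr_linear_right sum_distrib_left mult_ac)
  also have "(\<Sum>i\<in>UNIV. \<Sum>a\<in>UNIV. \<Sum>b\<in>UNIV. A $ a $ i * A $ b $ i * contr k (?h \<alpha> (axis a 1)) (?h \<beta> (axis b 1)))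
      = (\<Sum>a\<in>UNIV. \<Sum>b\<in>UNIV. (\<Sum>i\<in>UNIV. A $ a $ i * A $ b $ i) * contr k (?h \<alpha> (axis a 1)) (?h \<beta> (axis b 1)))"
    unfolding sum_distrib_right by (subst sum.swap, rule sum.cong[OF refl], rule sum.swap)
  also have "\<dots> = (\<Sum>a\<in>UNIV. \<Sum>b\<in>UNIV. if a = b then d * contr k (?h \<alpha> (axis a 1)) (?h \<beta> (axis b 1)) else 0)"
    unfolding gram by (intro sum.cong refl) auto
  also have "\<dots> = d * contr (Suc k) \<alpha> \<beta>" by (simp add: sum_distrib_left)
  finally show ?case by simp
qed (simp add: pullback_def)

lemma contr_eq_sum_lists:
  "contr k \<alpha> \<beta> = (\<Sum>I | length I = k. \<alpha> (map (\<lambda>i. axis i 1) I) * \<beta> (map (\<lambda>i. axis i 1) I))"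
proof (induction k arbitrary: \<alpha> \<beta>)
  case (Suc k)
  let ?F = "\<lambda>I. \<alpha> (map (\<lambda>i. axis i 1) I) * \<beta> (map (\<lambda>i. axis i 1) I)"
  have "contr (Suc k) \<alpha> \<beta> = (\<Sum>i\<in>UNIV. \<Sum>I | length I = k. ?F (i # I))"
    by (simp add: Suc)
  also have "\<dots> = (\<Sum>(i, I)\<in>UNIV \<times> {I. length I = k}. ?F (i # I))"
    by (simp add: sum.cartesian_product)
  also have "\<dots> = (\<Sum>I | length I = Suc k. ?F I)"
    by (rule sum.reindex_bij_witness[where i = "\<lambda>I. (hd I, tl I)" and j = "\<lambda>(i, I). i # I"])
       (auto simp: length_Suc_conv)
  finally show ?case .
qed simp

text \<open>
  Every increasing multi-index stands for \<open>k!\<close> lists, on which the product of two alternating forms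
  takes the same value because the signs cancel.
\<close>

lemma contr_alternating:
  assumes a: "alternating_form k \<alpha>" and b: "alternating_form k \<beta>"
  shows "contr k \<alpha> \<beta> = fact k * (\<Sum>I\<in>multi_indices k. \<alpha> (basis_list I) * \<beta> (basis_list I))"
proof -
  let ?F = "\<lambda>I. \<alpha> (basis_list I) * \<beta> (basis_list I)"
  let ?D = "{I :: 7 list. length I = k \<and> distinct I}"
  have fin: "finite {I :: 7 list. length I = k}"
    using finite_lists_length_eq[of "UNIV :: 7 set" k] by simp
  have "contr k \<alpha> \<beta> = (\<Sum>I | length I = k. ?F I)"
    by (simp add: contr_eq_sum_lists basis_list_def)
  also have "\<dots> = (\<Sum>I\<in>?D. ?F I)"
    using fin by (intro sum.mono_neutral_right)
      (auto simp: basis_list_def distinct_map alternating_not_distinct[OF a])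
  also have "\<dots> = (\<Sum>J\<in>multi_indices k. \<Sum>I | I \<in> ?D \<and> sort I = J. ?F I)"
    by (rule sum.group[symmetric]) (use fin in \<open>auto simp: multi_indices_def strict_sorted_iff intro: finite_subset[OF _ fin]\<close>)
  also have "\<dots> = (\<Sum>J\<in>multi_indices k. fact k * ?F J)"
  proof (rule sum.cong[OF refl])
    fix J :: "7 list" assume J: "J \<in> multi_indices k"
    then have J': "sorted J" "distinct J" "length J = k" by (auto simp: multi_indices_def strict_sorted_iff)
    have set: "{I \<in> ?D. sort I = J} = permutations_of_set (set J)"
    proof (intro Set.set_eqI iffI)
      fix I assume "I \<in> permutations_of_set (set J)"
      then have I: "set I = set J" "distinct I" by (auto simp: permutations_of_set_def)
      then have "sort I = J" using J' by (intro sorted_distinct_set_unique) auto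
      moreover have "length I = k" using I J' by (metis distinct_card)
      ultimately show "I \<in> {I \<in> ?D. sort I = J}" using I by simp
    qed (auto simp: permutations_of_set_def)
    have "?F I = ?F J" if "I \<in> permutations_of_set (set J)" for I
    proof -
      have I: "sort I = J" "length I = k" using that set by auto
      obtain p where p: "p permutes {..<length J}" "permute_list p J = I"
        using mset_eq_permutation[of I J] I by (metis mset_sort)
      have "\<gamma> (basis_list I) = of_int (sign p) * \<gamma> (basis_list J)" if "alternating_form k \<gamma>" for \<gamma>
        using alternating_permute_list[OF that, of p "basis_list J"] p J'
        by (simp flip: basis_list_permute)
      from this[OF a] this[OF b] show ?thesis
        by (simp add: sign_def)
    qed
    then have "(\<Sum>I | I \<in> ?D \<and> sort I = J. ?F I) = (\<Sum>I\<in>permutations_of_set (set J). ?F J)"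
      unfolding set[symmetric] by (intro sum.cong) auto
    then show "(\<Sum>I | I \<in> ?D \<and> sort I = J. ?F I) = fact k * ?F J"
      using J' by (simp add: distinct_card)
  qed
  finally show ?thesis by (simp add: sum_distrib_left)
qed

lemma norm_sq0_pullback:
  assumes "A ** transpose A = mat 1" "alternating_form k \<alpha>"
  shows "norm_sq0 k (pullback A \<alpha>) = norm_sq0 k \<alpha>"
proof -
  have *: "fact k * norm_sq0 k \<beta> = contr k \<beta> \<beta>" if "alternating_form k \<beta>" for \<beta>
    using contr_alternating[OF that that] by (simp add: norm_sq0_def power2_eq_square)
  have "contr k (pullback A \<alpha>) (pullback A \<alpha>) = contr k \<alpha> \<alpha>"
    using contr_pullback[of A 1 k \<alpha> \<alpha>] assms by (simp add: alternating_multilinear)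
  then have "fact k * norm_sq0 k (pullback A \<alpha>) = fact k * norm_sq0 k \<alpha>"
    using *[of \<alpha>] *[of "pullback A \<alpha>"] assms(2) by simp
  then show ?thesis by simp
qed

section \<open>The stabiliser of the model form is contained in SO(7)\<close>

definition iota :: "real^7 \<Rightarrow> 7 covector" where
  "iota u = (\<lambda>vs. phi0 (u # vs))"

lemma iota_axis:
  "iota (axis 1 1) = (\<lambda>vs. elem_form [2,3] vs + elem_form [4,5] vs + elem_form [6,7] vs)"
  "iota (axis 2 1) = (\<lambda>vs. elem_form [4,6] vs - elem_form [1,3] vs - elem_form [5,7] vs)"
  "iota (axis 3 1) = (\<lambda>vs. elem_form [1,2] vs - elem_form [4,7] vs - elem_form [5,6] vs)"
  "iota (axis 4 1) = (\<lambda>vs. elem_form [3,7] vs - elem_form [1,5] vs - elem_form [2,6] vs)"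
  "iota (axis 5 1) = (\<lambda>vs. elem_form [1,4] vs + elem_form [2,7] vs + elem_form [3,6] vs)"
  "iota (axis 6 1) = (\<lambda>vs. elem_form [2,4] vs - elem_form [1,7] vs - elem_form [3,5] vs)"
  "iota (axis 7 1) = (\<lambda>vs. elem_form [1,6] vs - elem_form [2,5] vs - elem_form [3,4] vs)"
  by (simp_all add: iota_def phi0_def fun_eq_iff elem_form_axis)

lemma wedge_iota_phi0:
  "wedge 2 3 (iota (axis 1 1)) phi0 = (\<lambda>vs.  2 * elem_form [1,4,5,6,7] vs + 2 * elem_form [1,2,3,6,7] vs + 2 * elem_form [1,2,3,4,5] vs)"
  "wedge 2 3 (iota (axis 2 1)) phi0 = (\<lambda>vs.  2 * elem_form [2,4,5,6,7] vs - 2 * elem_form [1,2,3,5,7] vs + 2 * elem_form [1,2,3,4,6] vs)"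
  "wedge 2 3 (iota (axis 3 1)) phi0 = (\<lambda>vs.  2 * elem_form [3,4,5,6,7] vs - 2 * elem_form [1,2,3,5,6] vs - 2 * elem_form [1,2,3,4,7] vs)"
  "wedge 2 3 (iota (axis 4 1)) phi0 = (\<lambda>vs.  2 * elem_form [2,3,4,6,7] vs + 2 * elem_form [1,3,4,5,7] vs - 2 * elem_form [1,2,4,5,6] vs)"
  "wedge 2 3 (iota (axis 5 1)) phi0 = (\<lambda>vs.  2 * elem_form [2,3,5,6,7] vs + 2 * elem_form [1,3,4,5,6] vs + 2 * elem_form [1,2,4,5,7] vs)"
  "wedge 2 3 (iota (axis 6 1)) phi0 = (\<lambda>vs.  2 * elem_form [2,3,4,5,6] vs - 2 * elem_form [1,3,5,6,7] vs + 2 * elem_form [1,2,4,6,7] vs)"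
  "wedge 2 3 (iota (axis 7 1)) phi0 = (\<lambda>vs.  2 * elem_form [2,3,4,5,7] vs - 2 * elem_form [1,3,4,6,7] vs - 2 * elem_form [1,2,5,6,7] vs)"
  unfolding iota_axis unfolding phi0_def
  subgoal by (simp add: wedge_linear wedge_elem_form elem_form_not_distinct
    sort_elem_form[of "[1,4,5,6,7]"] sort_elem_form[of "[1,2,3,6,7]"] sort_elem_form[of "[1,2,3,4,5]"] algebra_simps)
  subgoal by (simp add: wedge_linear wedge_elem_form elem_form_not_distinct
    sort_elem_form[of "[2,4,5,6,7]"] sort_elem_form[of "[1,2,3,5,7]"] sort_elem_form[of "[1,2,3,4,6]"] algebra_simps)
  subgoal by (simp add: wedge_linear wedge_elem_form elem_form_not_distinct
    sort_elem_form[of "[3,4,5,6,7]"] sort_elem_form[of "[1,2,3,5,6]"] sort_elem_form[of "[1,2,3,4,7]"] algebra_simps)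
  subgoal by (simp add: wedge_linear wedge_elem_form elem_form_not_distinct
    sort_elem_form[of "[2,3,4,6,7]"] sort_elem_form[of "[1,3,4,5,7]"] sort_elem_form[of "[1,2,4,5,6]"] algebra_simps)
  subgoal by (simp add: wedge_linear wedge_elem_form elem_form_not_distinct
    sort_elem_form[of "[2,3,5,6,7]"] sort_elem_form[of "[1,3,4,5,6]"] sort_elem_form[of "[1,2,4,5,7]"] algebra_simps)
  subgoal by (simp add: wedge_linear wedge_elem_form elem_form_not_distinct
    sort_elem_form[of "[2,3,4,5,6]"] sort_elem_form[of "[1,3,5,6,7]"] sort_elem_form[of "[1,2,4,6,7]"] algebra_simps)
  subgoal by (simp add: wedge_linear wedge_elem_form elem_form_not_distinct
    sort_elem_form[of "[2,3,4,5,7]"] sort_elem_form[of "[1,3,4,6,7]"] sort_elem_form[of "[1,2,5,6,7]"] algebra_simps)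
  done

lemma wedge_iota_axis:
  "wedge 2 5 (iota (axis i 1)) (wedge 2 3 (iota (axis j 1)) phi0) = (\<lambda>vs. (if i = j then 6 else 0) * vol0 vs)"
proof -
  have "\<forall>i j. wedge 2 5 (iota (axis i 1)) (wedge 2 3 (iota (axis j 1)) phi0) = (\<lambda>vs. (if i = j then 6 else 0) * vol0 vs)"
    unfolding forall_7 wedge_iota_phi0 unfolding iota_axis vol0_def
    by (intro conjI)
      (simp_all add: wedge_linear wedge_elem_form elem_form_not_distinct
       sort_elem_form[of "[1,2,3,4,5,6,7]"])
  then show ?thesis by blast
qed

lemma iota_expand: "iota u = (\<lambda>vs. \<Sum>i\<in>UNIV. u $ i * iota (axis i 1) vs)"
proof
  fix vs :: "(real^7) list"
  have "linear (\<lambda>u. phi0 (u # vs))"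
  proof (cases "length vs = 2")
    case True
    then show ?thesis using multilinear_hd[of 2 phi0 vs] alternating_multilinear[OF alternating_phi0] by simp
  next
    case False
    then have "phi0 (u # vs) = 0" for u by (intro alternating_wrong_length[OF alternating_phi0]) simp
    then show ?thesis by (simp add: linear_zero)
  qed
  note l = linear_sum[OF this] linear_scale[OF this]
  have "iota u vs = iota (\<Sum>i\<in>UNIV. u $ i *\<^sub>R axis i 1) vs"
    using basis_expansion[of u] by (simp add: scalar_mult_eq_scaleR)
  then show "iota u vs = (\<Sum>i\<in>UNIV. u $ i * iota (axis i 1) vs)"
    by (simp add: iota_def l)
qed

text \<open>
  Bryant's identity, which recovers the metric and the orientation from \<open>\<phi>\<close> alone.
\<close>

lemma wedge_iota:
  "wedge 2 5 (iota u) (wedge 2 3 (iota v) phi0) = (\<lambda>vs. 6 * (u \<bullet> v) * vol0 vs)"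
proof
  fix vs
  have "wedge 2 5 (iota u) (wedge 2 3 (iota v) phi0) vs =
      (\<Sum>i\<in>UNIV. \<Sum>j\<in>UNIV. u $ i * (v $ j * ((if i = j then 6 else 0) * vol0 vs)))"
    by (subst iota_expand[of u], subst iota_expand[of v])
       (simp add: wedge_sum_left wedge_sum_right wedge_scale wedge_iota_axis sum_distrib_left
         cong: if_cong)
  also have "\<dots> = (\<Sum>i\<in>UNIV. u $ i * (v $ i * (6 * vol0 vs)))"
  proof (rule sum.cong[OF refl])
    fix i :: 7
    have "(\<Sum>j\<in>UNIV. u $ i * (v $ j * ((if i = j then 6 else 0) * vol0 vs))) =
        (\<Sum>j\<in>UNIV. if i = j then u $ i * (v $ j * (6 * vol0 vs)) else 0)"
      by (rule sum.cong) auto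
    then show "(\<Sum>j\<in>UNIV. u $ i * (v $ j * ((if i = j then 6 else 0) * vol0 vs))) = u $ i * (v $ i * (6 * vol0 vs))"
      by simp
  qed
  also have "\<dots> = 6 * (u \<bullet> v) * vol0 vs"
    by (simp add: inner_vec_def sum_distrib_left sum_distrib_right mult_ac)
  finally show "wedge 2 5 (iota u) (wedge 2 3 (iota v) phi0) vs = 6 * (u \<bullet> v) * vol0 vs" .
qed

lemma multi_indices_7: "multi_indices 7 = {[7,1,2,3,4,5,6]}"
  by (simp add: multi_indices_eq)

lemma vol0_std: "vol0 (basis_list [7,1,2,3,4,5,6]) = 1"
  by (simp add: vol0_def elem_form_axis)

lemma top_form:
  assumes "alternating_form 7 \<omega>"
  shows "\<omega> = (\<lambda>vs. \<omega> (basis_list [7,1,2,3,4,5,6]) * vol0 vs)"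
  by (rule alternating_eqI[OF assms alternating_scale[OF alternating_vol0]])
    (auto simp: multi_indices_7 vol0_std simp del: basis_list_simps)

lemma pullback_iota:
  assumes "pullback A phi0 = phi0"
  shows "pullback A (iota (A *v u)) = iota u"
  using fun_cong[OF assms, of "u # vs" for vs] by (simp add: pullback_def iota_def fun_eq_iff)

text \<open>
  A similarity with factor \<open>d\<close> multiplies this contraction by \<open>d\<^sup>3\<close>; since it is non-zero, a similarity that
  preserves \<open>\<phi>\<close> is an isometry.
\<close>

lemma contr_phi0_pos: "contr 3 phi0 phi0 > 0"
proof -
  have "contr 3 phi0 phi0 = 6 * (\<Sum>I\<in>multi_indices 3. (phi0 (basis_list I))\<^sup>2)"
    unfolding contr_alternating[OF alternating_phi0 alternating_phi0] by (simp add: power2_eq_square fact_numeral)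
  moreover have "(phi0 (basis_list [1,2,3]))\<^sup>2 \<le> (\<Sum>I\<in>multi_indices 3. (phi0 (basis_list I))\<^sup>2)"
    by (rule member_le_sum) (simp_all add: finite_multi_indices, simp add: multi_indices_def)
  moreover have "phi0 (basis_list [1,2,3]) = 1"
    by (simp add: phi0_def elem_form_axis)
  ultimately show ?thesis by simp
qed

text \<open>
  By naturality of \<open>wedge_iota\<close>, \<open>A\<close> multiplies the metric by \<open>1/c\<close> if it multiplies the volume form
  by \<open>c\<close>. Such a similarity multiplies the contraction of \<open>\<phi>\<close> with itself by \<open>c\<^sup>-\<^sup>3\<close>; as it
  preserves \<open>\<phi>\<close>, it follows that \<open>c = 1\<close>.
\<close>

lemma phi0_stabiliser:
  assumes A: "pullback A phi0 = phi0"
  shows "A ** transpose A = mat 1" "pullback A vol0 = vol0"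
proof -
  define c where "c = pullback A vol0 (basis_list [7,1,2,3,4,5,6])"
  have vol: "pullback A vol0 = (\<lambda>vs. c * vol0 vs)"
    unfolding c_def by (rule top_form[OF alternating_pullback[OF alternating_vol0]])
  have gram: "c * ((A *v u) \<bullet> (A *v v)) = u \<bullet> v" for u v
  proof -
    have "(\<lambda>vs. 6 * (u \<bullet> v) * vol0 vs) = wedge 2 5 (iota u) (wedge 2 3 (iota v) phi0)"
      by (simp add: wedge_iota)
    also have "\<dots> = pullback A (wedge 2 5 (iota (A *v u)) (wedge 2 3 (iota (A *v v)) phi0))"
      by (simp add: pullback_wedge pullback_iota[OF A] A)
    also have "\<dots> = (\<lambda>vs. 6 * ((A *v u) \<bullet> (A *v v)) * pullback A vol0 vs)"
      unfolding wedge_iota by (simp add: pullback_def)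
    finally have "6 * (u \<bullet> v) * vol0 vs = 6 * ((A *v u) \<bullet> (A *v v)) * (c * vol0 vs)" for vs
      unfolding vol by metis
    from this[of "basis_list [7,1,2,3,4,5,6]"] show ?thesis by (simp add: vol0_std del: basis_list_simps)
  qed
  define d where "d = 1 / c"
  have "c \<noteq> 0" using gram[of "axis 1 1" "axis 1 1"] by (auto simp: inner_axis_axis)
  then have d: "d \<noteq> 0" and gram': "(A *v u) \<bullet> (A *v v) = d * (u \<bullet> v)" for u v
    unfolding gram[of u v, symmetric] by (simp_all add: d_def)
  have AA: "A ** transpose A = d *\<^sub>R mat 1" by (rule gram_transpose(1)[OF gram' d])
  have "d ^ 3 * contr 3 phi0 phi0 = contr 3 phi0 phi0"
    using contr_pullback[OF AA, of 3 phi0 phi0] by (simp add: A alternating_multilinear)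
  then have "d ^ 3 = 1" using contr_phi0_pos by simp
  then have "root 3 (d ^ 3) = root 3 1" by simp
  then have "d = 1" by (simp add: odd_real_root_power_cancel)
  then have "c = 1" by (simp add: d_def)
  show "A ** transpose A = mat 1" using AA \<open>d = 1\<close> by simp
  show "pullback A vol0 = vol0" using vol \<open>c = 1\<close> by simp
qed

text \<open>
  The Hodge star of \<open>\<alpha>\<close> is the contraction of \<open>\<alpha>\<close> with the volume form, and both the contraction
  and the volume form are invariant.
\<close>

lemma hodge0_pullback:
  assumes A: "A ** transpose A = mat 1" "pullback A vol0 = vol0" and \<alpha>: "alternating_form k \<alpha>" and k: "k \<le> 7"
  shows "hodge0 k (pullback A \<alpha>) = pullback A (hodge0 k \<alpha>)"
proof
  fix ws :: "(real^7) list"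
  show "hodge0 k (pullback A \<alpha>) ws = pullback A (hodge0 k \<alpha>) ws"
  proof (cases "length ws = 7 - k")
    case False
    then show ?thesis by (simp add: hodge0_def pullback_def)
  next
    case True
    have swap: "alternating_form k (\<lambda>I. vol0 (I @ us))" if "length us = 7 - k" for us
      using that k by (intro alternating_append_right[of k "7 - k"]) (simp_all add: alternating_vol0)
    define V where "V us = (\<lambda>I. vol0 (I @ us))" for us
    have V: "alternating_form k (V us)" if "length us = 7 - k" for us
      unfolding V_def by (rule swap[OF that])
    have h: "fact k * hodge0 k \<beta> us = contr k \<beta> (V us)" if "alternating_form k \<beta>" "length us = 7 - k" for \<beta> us
      unfolding contr_alternating[OF that(1) V[OF that(2)]] by (simp add: hodge0_eq[OF k] V_def)
    have "contr k (pullback A \<alpha>) (V ws) = contr k (pullback A \<alpha>) (pullback A (V (map ((*v) A) ws)))"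
      using fun_cong[OF A(2)] by (simp add: V_def pullback_def flip: map_append)
    also have "\<dots> = contr k \<alpha> (V (map ((*v) A) ws))"
      using contr_pullback[of A 1 k \<alpha> "V (map ((*v) A) ws)"] A(1) \<alpha> V True by (simp add: alternating_multilinear)
    finally have "fact k * hodge0 k (pullback A \<alpha>) ws = fact k * hodge0 k \<alpha> (map ((*v) A) ws)"
      using h True \<alpha> by simp
    then show ?thesis by (simp add: pullback_def)
  qed
qed

section \<open>Smooth functions on a vector space\<close>

lemma Ck_on_const: "Ck_on k S (\<lambda>x. c)"
  by (induction k arbitrary: c) simp_all

text \<open>
  On the whole space differentiability at a point needs no care about boundary points, and the
  Frechet derivative is determined by any derivative that is known.
\<close>

lemma Ck_on_SucI:
  assumes "\<And>x. x \<in> S \<Longrightarrow> (f has_derivative f' x) (at x)" "\<And>v. Ck_on k UNIV (\<lambda>x. f' x v)" "S = UNIV"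
  shows "Ck_on (Suc k) S f"
proof -
  have "frechet_derivative f (at x) = f' x" for x
    using assms(1,3) by (intro frechet_derivative_at[symmetric]) auto
  then show ?thesis using assms by (auto simp: differentiable_def)
qed

lemma Ck_on_has_derivative:
  "Ck_on (Suc k) UNIV f \<Longrightarrow> (f has_derivative frechet_derivative f (at x)) (at x)"
  by (simp add: frechet_derivative_works)

lemma Ck_on_add:
  "Ck_on k UNIV f \<Longrightarrow> Ck_on k UNIV g \<Longrightarrow> Ck_on k UNIV (\<lambda>x. f x + g x)"
proof (induction k arbitrary: f g)
  case (Suc k)
  show ?case
    by (rule Ck_on_SucI[OF has_derivative_add[OF Suc.prems[THEN Ck_on_has_derivative]]])
       (use Suc in auto)
qed (auto intro: continuous_on_add)

lemma Ck_on_scale: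
  fixes f :: "'a::real_normed_vector \<Rightarrow> real"
  shows "Ck_on k UNIV f \<Longrightarrow> Ck_on k UNIV (\<lambda>x. c * f x)"
proof (induction k arbitrary: f)
  case (Suc k)
  show ?case
    by (rule Ck_on_SucI[OF has_derivative_mult_right[OF Suc.prems[THEN Ck_on_has_derivative]]])
       (use Suc in auto)
qed (auto intro: continuous_on_mult_left)

lemma Ck_on_id: "Ck_on k UNIV (\<lambda>x. x)"
proof (cases k)
  case (Suc j)
  show ?thesis unfolding Suc by (rule Ck_on_SucI[where f' = "\<lambda>x v. v"]) (auto intro: Ck_on_const)
qed auto

section \<open>Forms with exponential-polynomial coefficients\<close>

definition wexp :: "real \<Rightarrow> real \<Rightarrow> real^7 \<Rightarrow> real" where
  "wexp a b x = exp (a * x $ 1 + b * x $ 7)"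

lemma wexp_mult: "wexp a b x * wexp a' b' x = wexp (a + a') (b + b') x" "wexp a b x * (wexp a' b' x * z) = wexp (a + a') (b + b') x * z"
  by (simp_all add: wexp_def distrib_right algebra_simps flip: exp_add mult.assoc)

lemma wexp_nonzero [simp]: "wexp a b x \<noteq> 0" "wexp 0 0 x = 1"
  by (simp_all add: wexp_def)

text \<open>
  The coefficients of all forms of the example are sums of such monomials. They are closed under
  differentiation, which makes the exterior derivative a symbolic operation.
\<close>

definition emono :: "real \<Rightarrow> real \<Rightarrow> real \<Rightarrow> nat \<Rightarrow> real^7 \<Rightarrow> real" where
  "emono c a b m x = c * wexp a b x * (x $ 6) ^ m"

lemma has_derivative_emono:
  "(emono c a b m has_derivative (\<lambda>v. v $ 1 * emono (c * a) a b m x + v $ 7 * emono (c * b) a b m x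
      + v $ 6 * emono (c * real m) a b (m - 1) x)) (at x)"
proof -
  have *: "emono c a b m = (\<lambda>x. c * exp (a * x $ 1 + b * x $ 7) * (x $ 6) ^ m)"
    by (simp add: fun_eq_iff emono_def wexp_def)
  have nth: "((\<lambda>x :: real^7. x $ i) has_derivative (\<lambda>v. v $ i)) (at x)" for i
    by (intro bounded_linear_imp_has_derivative bounded_linear_vec_nth)
  show ?thesis
    unfolding emono_def[of "c * _"] unfolding * wexp_def
    by (auto intro!: derivative_eq_intros nth simp: algebra_simps)
qed

lemma Ck_on_emono: "Ck_on k UNIV (emono c a b m)"
proof (induction k arbitrary: c a b m)
  case 0
  have "continuous_on UNIV (emono c a b m)"
    using has_derivative_emono by (intro continuous_at_imp_continuous_on ballI) (rule has_derivative_continuous)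
  then show ?case by simp
next
  case (Suc k)
  show ?case
    by (rule Ck_on_SucI[OF has_derivative_emono _ refl]) (intro Ck_on_add Ck_on_scale Suc)
qed

type_synonym mono_term = "real \<times> real \<times> real \<times> nat \<times> 7 list"

text \<open>
  The form with the given coefficients with respect to the coordinate coframe.
\<close>

fun mform :: "mono_term list \<Rightarrow> real^7 \<Rightarrow> 7 covector" where
  "mform [] x vs = 0"
| "mform ((c, a, b, m, J) # L) x vs = emono c a b m x * elem_form J vs + mform L x vs"

text \<open>
  \<open>d (f e\<^sup>J) = \<partial>\<^sub>1 f e\<^sup>1\<^sup>J + \<partial>\<^sub>7 f e\<^sup>7\<^sup>J + \<partial>\<^sub>6 f e\<^sup>6\<^sup>J\<close>. For \<open>m = 0\<close> the truncated exponent
  \<open>m - 1\<close> comes with the coefficient \<open>0\<close>.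
\<close>

fun mform_d :: "mono_term list \<Rightarrow> mono_term list" where
  "mform_d [] = []"
| "mform_d ((c, a, b, m, J) # L) =
     (c * a, a, b, m, 1 # J) # (c * b, a, b, m, 7 # J) # (c * real m, a, b, m - 1, 6 # J) # mform_d L"

definition of_degree :: "nat \<Rightarrow> mono_term list \<Rightarrow> bool" where
  "of_degree k L \<longleftrightarrow> (\<forall>(c, a, b, m, J)\<in>set L. length J = k)"

lemma of_degree_simps [simp]:
  "of_degree k []" "of_degree k ((c, a, b, m, J) # L) \<longleftrightarrow> length J = k \<and> of_degree k L"
  by (auto simp: of_degree_def)

lemma alternating_mform: "of_degree k L \<Longrightarrow> alternating_form k (mform L x)"
proof (induction L)
  case Nil
  have "mform [] x = (\<lambda>vs. 0)" by auto
  then show ?case by simp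
next
  case (Cons t L)
  obtain c a b m J where t: "t = (c, a, b, m, J)" by (cases t)
  have "mform (t # L) x = (\<lambda>vs. emono c a b m x * elem_form J vs + mform L x vs)"
    by (auto simp: t)
  then show ?case using Cons by (simp add: t)
qed

lemma of_degree_mform_d: "of_degree k L \<Longrightarrow> of_degree (Suc k) (mform_d L)"
  by (induction L rule: mform_d.induct) auto

lemma Ck_on_mform: "Ck_on k UNIV (\<lambda>x. mform L x vs)"
proof (induction L rule: mform_d.induct)
  case (2 c a b m J L)
  have "Ck_on k UNIV (\<lambda>x. elem_form J vs * emono c a b m x + mform L x vs)"
    by (intro Ck_on_add Ck_on_scale Ck_on_emono 2)
  then show ?case by (simp add: mult.commute)
qed (simp add: Ck_on_const)

fun mform_diff :: "mono_term list \<Rightarrow> real^7 \<Rightarrow> real^7 \<Rightarrow> 7 covector" where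
  "mform_diff [] x v us = 0"
| "mform_diff ((c, a, b, m, J) # L) x v us =
     (v $ 1 * emono (c * a) a b m x + v $ 7 * emono (c * b) a b m x
      + v $ 6 * emono (c * real m) a b (m - 1) x) * elem_form J us + mform_diff L x v us"

lemma has_derivative_mform:
  "((\<lambda>y. mform L y us) has_derivative (\<lambda>v. mform_diff L x v us)) (at x)"
proof (induction L rule: mform_d.induct)
  case (2 c a b m J L)
  show ?case
    unfolding mform.simps mform_diff.simps
    by (intro has_derivative_add has_derivative_mult_left has_derivative_emono 2)
qed simp

text \<open>
  Both sides are alternating sums over the arguments, the right one by the Laplace expansion along the
  new first index.
\<close>

lemma ext_deriv_mform:
  assumes "of_degree k L"
  shows "ext_deriv k (mform L) x = mform (mform_d L) x"
proof
  fix vs :: "(real^7) list"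
  show "ext_deriv k (mform L) x vs = mform (mform_d L) x vs"
  proof (cases "length vs = Suc k")
    case False
    then show ?thesis
      using alternating_wrong_length[OF alternating_mform[OF of_degree_mform_d[OF assms]]]
      by (simp add: ext_deriv_def)
  next
    case True
    have "ext_deriv k (mform L) x vs =
        (\<Sum>i<length vs. (-1) ^ i * mform_diff L x (vs ! i) (take i vs @ drop (Suc i) vs))"
      using True
      by (simp add: ext_deriv_def lessThan_Suc_atMost frechet_derivative_at[OF has_derivative_mform, symmetric])
    also have "\<dots> = mform (mform_d L) x vs"
    proof (induction L rule: mform_d.induct)
      case (2 c a b m J L)
      show ?case
        unfolding mform_diff.simps mform_d.simps mform.simps 2[symmetric] elem_form_Cons wedge1_eq_sum
        by (simp add: sum.distrib sum_distrib_left ring_distribs mult_ac)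
    qed simp
    finally show ?thesis .
  qed
qed

text \<open>
  The minors of a matrix, as components of pullbacks of elementary forms.
\<close>

fun minor :: "real^'m^'n \<Rightarrow> 'n list \<Rightarrow> 'm list \<Rightarrow> real" where
  "minor A [] K = (if K = [] then 1 else 0)"
| "minor A (i # I) K = wedge1 (\<lambda>j. A $ i $ j) (minor A I) K"

declare minor.simps(2) [simp del]

lemma pullback_elem_form_basis:
  fixes A :: "real^7^7"
  shows "pullback A (elem_form I) (basis_list K) = minor A I K"
proof (induction I arbitrary: K)
  case (Cons i I)
  then show ?case
    by (simp add: elem_form_Cons minor.simps(2) pullback_def wedge1_eq_sum basis_list_def take_map drop_map o_def map_append[symmetric] del: map_append)
       (simp add: matrix_vector_mult_basis column_def)
qed (simp add: pullback_def basis_list_def)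

section \<open>The coframe of the example\<close>

text \<open>
  The rows are the 1-forms \<open>e\<^sup>1, \<dots>, e\<^sup>7\<close> in the coordinates \<open>(s, p\<^sub>1, p\<^sub>2, q\<^sub>1, q\<^sub>2, x, h)\<close>. With
  \<open>z = x + i y\<close>, \<open>y = exp (2 h)\<close>, \<open>t = exp (-2 s)\<close>, \<open>P = p\<^sub>1 + i p\<^sub>2\<close> and \<open>Q = q\<^sub>1 + i q\<^sub>2\<close> they are
  \<open>e\<^sup>1 = - dt\<close>, \<open>e\<^sup>2 + i e\<^sup>3 = t\<^sup>-\<^sup>3\<^sup>/\<^sup>2 y\<^sup>-\<^sup>1\<^sup>/\<^sup>2 (dP - \<zeta> dQ)\<close>,
  \<open>e\<^sup>4 + i e\<^sup>5 = \<surd>5 t\<^sup>-\<^sup>3\<^sup>/\<^sup>2 y\<^sup>-\<^sup>1\<^sup>/\<^sup>2 (dP\<^sup>* - \<zeta> dQ\<^sup>*)\<close> and \<open>e\<^sup>6 + i e\<^sup>7 = t dz / (\<surd>5 y)\<close>, where \<open>\<zeta>\<close>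
  is the conjugate of \<open>z\<close> and the star denotes conjugation of \<open>P\<close> and \<open>Q\<close>.
\<close>

definition coframe :: "real^7 \<Rightarrow> real^7^7" where
  "coframe x = (\<chi> i.
     if i = 1 then (2 * wexp (-2) 0 x) *\<^sub>R axis 1 1
     else if i = 2 then wexp 3 (-1) x *\<^sub>R (axis 2 1 - x $ 6 *\<^sub>R axis 4 1) - wexp 3 1 x *\<^sub>R axis 5 1
     else if i = 3 then wexp 3 (-1) x *\<^sub>R (axis 3 1 - x $ 6 *\<^sub>R axis 5 1) + wexp 3 1 x *\<^sub>R axis 4 1
     else if i = 4 then sqrt 5 *\<^sub>R (wexp 3 (-1) x *\<^sub>R (axis 2 1 - x $ 6 *\<^sub>R axis 4 1) + wexp 3 1 x *\<^sub>R axis 5 1)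
     else if i = 5 then sqrt 5 *\<^sub>R (wexp 3 1 x *\<^sub>R axis 4 1 - wexp 3 (-1) x *\<^sub>R (axis 3 1 - x $ 6 *\<^sub>R axis 5 1))
     else if i = 6 then (sqrt 5 / 5 * wexp (-2) (-2) x) *\<^sub>R axis 6 1
     else (2 * sqrt 5 / 5 * wexp (-2) 0 x) *\<^sub>R axis 7 1)"

definition expand_at :: "'m \<Rightarrow> ('m list \<Rightarrow> real) \<Rightarrow> 'm list \<Rightarrow> real" where
  "expand_at m F K = (if m \<in> set K
     then (if even (length (takeWhile (\<lambda>j. j \<noteq> m) K)) then 1 else -1) * F (remove1 m K) else 0)"

lemma wedge1_single:
  assumes "distinct K"
  shows "wedge1 (\<lambda>j. if j = m then c else 0) F K = c * expand_at m F K"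
  using assms
proof (induction K arbitrary: F)
  case (Cons j K)
  then show ?case by (cases "j = m") (auto simp: expand_at_def)
qed (simp add: expand_at_def)

text \<open>
  Expansion along a row that is given by its non-zero entries only; the rows of the matrices to which
  it is applied have at most three.
\<close>

lemma minor_Cons:
  assumes "\<And>j. A $ i $ j = (\<Sum>(c, m)\<leftarrow>L. if j = m then c else 0)" "distinct K"
  shows "minor A (i # I) K = (\<Sum>(c, m)\<leftarrow>L. c * expand_at m (minor A I) K)"
proof -
  have "wedge1 (\<lambda>j. \<Sum>(c, m)\<leftarrow>L. if j = m then c else 0) F K = (\<Sum>(c, m)\<leftarrow>L. c * expand_at m F K)" for F
  proof (induction L)
    case Nil
    show ?case by (simp add: wedge1_eq_sum)
  next
    case (Cons t L)
    then show ?case using assms(2) by (cases t) (simp add: wedge1_add wedge1_single)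
  qed
  moreover have "($) (A $ i) = (\<lambda>j. \<Sum>(c, m)\<leftarrow>L. if j = m then c else 0)"
    using assms(1) by (intro ext)
  ultimately show ?thesis by (simp add: minor.simps(2))
qed

lemma minor_coframe:
  assumes "distinct K"
  shows "minor (coframe x) (1 # I) K = 2 * wexp (-2) 0 x * expand_at 1 (minor (coframe x) I) K"
   "minor (coframe x) (2 # I) K = wexp 3 (-1) x * expand_at 2 (minor (coframe x) I) K
      - x $ 6 * wexp 3 (-1) x * expand_at 4 (minor (coframe x) I) K - wexp 3 1 x * expand_at 5 (minor (coframe x) I) K"
   "minor (coframe x) (3 # I) K = wexp 3 (-1) x * expand_at 3 (minor (coframe x) I) K
      - x $ 6 * wexp 3 (-1) x * expand_at 5 (minor (coframe x) I) K + wexp 3 1 x * expand_at 4 (minor (coframe x) I) K"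
   "minor (coframe x) (4 # I) K = sqrt 5 * wexp 3 (-1) x * expand_at 2 (minor (coframe x) I) K
      - sqrt 5 * (x $ 6 * wexp 3 (-1) x) * expand_at 4 (minor (coframe x) I) K + sqrt 5 * wexp 3 1 x * expand_at 5 (minor (coframe x) I) K"
   "minor (coframe x) (5 # I) K = - (sqrt 5 * wexp 3 (-1) x * expand_at 3 (minor (coframe x) I) K)
      + sqrt 5 * (x $ 6 * wexp 3 (-1) x) * expand_at 5 (minor (coframe x) I) K + sqrt 5 * wexp 3 1 x * expand_at 4 (minor (coframe x) I) K"
   "minor (coframe x) (6 # I) K = sqrt 5 / 5 * wexp (-2) (-2) x * expand_at 6 (minor (coframe x) I) K"
   "minor (coframe x) (7 # I) K = 2 * sqrt 5 / 5 * wexp (-2) 0 x * expand_at 7 (minor (coframe x) I) K"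
  subgoal by (subst minor_Cons[OF _ assms, where L = "[(2 * wexp (-2) 0 x, 1)]"]) (simp_all add: coframe_def axis_def)
  subgoal by (subst minor_Cons[OF _ assms, where L = "[(wexp 3 (-1) x, 2), (- (x $ 6 * wexp 3 (-1) x), 4), (- wexp 3 1 x, 5)]"])
      (simp_all add: coframe_def axis_def)
  subgoal by (subst minor_Cons[OF _ assms, where L = "[(wexp 3 (-1) x, 3), (- (x $ 6 * wexp 3 (-1) x), 5), (wexp 3 1 x, 4)]"])
      (simp_all add: coframe_def axis_def)
  subgoal by (subst minor_Cons[OF _ assms, where L = "[(sqrt 5 * wexp 3 (-1) x, 2), (- (sqrt 5 * (x $ 6 * wexp 3 (-1) x)), 4), (sqrt 5 * wexp 3 1 x, 5)]"])
      (simp_all add: coframe_def axis_def)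
  subgoal by (subst minor_Cons[OF _ assms, where L = "[(- (sqrt 5 * wexp 3 (-1) x), 3), (sqrt 5 * (x $ 6 * wexp 3 (-1) x), 5), (sqrt 5 * wexp 3 1 x, 4)]"])
      (simp_all add: coframe_def axis_def)
  subgoal by (subst minor_Cons[OF _ assms, where L = "[(sqrt 5 / 5 * wexp (-2) (-2) x, 6)]"]) (simp_all add: coframe_def axis_def)
  subgoal by (subst minor_Cons[OF _ assms, where L = "[(2 * sqrt 5 / 5 * wexp (-2) 0 x, 7)]"]) (simp_all add: coframe_def axis_def)
  done

section \<open>Structure equations of the example\<close>

text \<open>
  The coordinate expressions of \<open>\<phi>\<close>, \<open>*\<phi>\<close> and \<open>\<tau>\<close>, obtained by multiplying out the 1-forms of the
  coframe.
\<close>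

definition phi_terms :: "mono_term list" where
  "phi_terms =
    [(-8, 4, -2, 0, [1,2,3]), (12, 4, 0, 0, [1,2,4]), (8, 4, -2, 1, [1,2,5]),
    (-8, 4, -2, 1, [1,3,4]), (12, 4, 0, 0, [1,3,5]), (-8, 4, -2, 2, [1,4,5]),
    (-8, 4, 2, 0, [1,4,5]), (4/5, -6, -2, 0, [1,6,7]), (4, 4, -2, 0, [2,3,7]),
    (2, 4, -2, 0, [2,5,6]), (-4, 4, -2, 1, [2,5,7]), (-2, 4, -2, 0, [3,4,6]),
    (4, 4, -2, 1, [3,4,7]), (-4, 4, -2, 1, [4,5,6]), (4, 4, -2, 2, [4,5,7]),
    (-4, 4, 2, 0, [4,5,7])]"

definition psi_terms :: "mono_term list" where
  "psi_terms =
    [(4, 2, -4, 0, [1,2,3,6]), (-4, 2, -4, 1, [1,2,5,6]), (-8, 2, 0, 0, [1,2,5,7]),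
    (4, 2, -4, 1, [1,3,4,6]), (8, 2, 0, 0, [1,3,4,7]), (4, 2, -4, 2, [1,4,5,6]),
    (-4, 2, 0, 0, [1,4,5,6]), (16, 2, 0, 1, [1,4,5,7]), (-20, 12, 0, 0, [2,3,4,5]),
    (-8/5, 2, -4, 0, [2,3,6,7]), (12/5, 2, -2, 0, [2,4,6,7]), (8/5, 2, -4, 1, [2,5,6,7]),
    (-8/5, 2, -4, 1, [3,4,6,7]), (12/5, 2, -2, 0, [3,5,6,7]), (-8/5, 2, -4, 2, [4,5,6,7]),
    (-8/5, 2, 0, 0, [4,5,6,7])]"

definition tau_terms :: "mono_term list" where
  "tau_terms =
    [(-48, 8, -2, 0, [2,3]), (42, 8, 0, 0, [2,4]), (48, 8, -2, 1, [2,5]), (-48, 8, -2, 1, [3,4]),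
    (42, 8, 0, 0, [3,5]), (-48, 8, -2, 2, [4,5]), (-48, 8, 2, 0, [4,5]),
    (-12/5, -2, -2, 0, [6,7])]"

lemma sqrt5_mult: "sqrt 5 * (sqrt 5 * z) = 5 * z" for z :: real
  by (simp flip: mult.assoc)

lemma pullback_phi0_basis:
  "pullback A phi0 (basis_list K) = minor A [1,2,3] K + minor A [1,4,5] K + minor A [1,6,7] K
     + minor A [2,4,6] K - minor A [2,5,7] K - minor A [3,4,7] K - minor A [3,5,6] K"
  by (simp only: pullback_elem_form_basis[symmetric] pullback_def phi0_def)

lemmas mform_eval = emono_def elem_form_axis elem_form_not_distinct minor_coframe expand_at_def wexp_mult sqrt5_mult power2_eq_square algebra_simps

lemma pullback_phi0: "pullback (coframe x) phi0 = mform phi_terms x"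
proof (rule alternating_eqI[of 3])
  have "\<forall>K\<in>set (sublists_of 3 [7,1,2,3,4,5,6]). pullback (coframe x) phi0 (basis_list K) = mform phi_terms x (basis_list K)"
    unfolding pullback_phi0_basis
    by (simp add: phi_terms_def mform_eval)
  then show "pullback (coframe x) phi0 (basis_list K) = mform phi_terms x (basis_list K)"
    if "K \<in> multi_indices 3" for K using that unfolding multi_indices_eq by blast
qed (auto simp: phi_terms_def intro!: alternating_mform)

lemma pullback_psi0_basis:
  "pullback A psi0 (basis_list K) = minor A [4,5,6,7] K + minor A [2,3,6,7] K + minor A [2,3,4,5] K
     + minor A [1,3,5,7] K - minor A [1,3,4,6] K - minor A [1,2,5,6] K - minor A [1,2,4,7] K"
  by (simp only: pullback_elem_form_basis[symmetric] pullback_def psi0_def)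

lemma pullback_beta0_basis:
  "pullback A (beta0 a b c) (basis_list K) = a * minor A [2,3] K + b * minor A [4,5] K + c * minor A [6,7] K"
  by (simp only: pullback_elem_form_basis[symmetric] pullback_def beta0_def)

text \<open>
  The torsion form in the adapted coframe.
\<close>

definition tau_form :: "real^7 \<Rightarrow> 7 covector" where
  "tau_form x = beta0 (- 3 * wexp 2 0 x) (9 * wexp 2 0 x) (- 6 * wexp 2 0 x)"

lemma pullback_tau: "pullback (coframe x) (tau_form x) = mform tau_terms x"
proof (rule alternating_eqI[of 2])
  have "\<forall>K\<in>set (sublists_of 2 [7,1,2,3,4,5,6]). pullback (coframe x) (tau_form x) (basis_list K) = mform tau_terms x (basis_list K)"
    unfolding tau_form_def pullback_beta0_basis
    by (simp add: tau_terms_def mform_eval)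
  then show "pullback (coframe x) (tau_form x) (basis_list K) = mform tau_terms x (basis_list K)"
    if "K \<in> multi_indices 2" for K using that unfolding multi_indices_eq by blast
qed (auto simp: tau_terms_def tau_form_def intro!: alternating_mform)

lemma ext_deriv_phi: "ext_deriv 3 (mform phi_terms) x = (\<lambda>vs. 0)"
proof -
  have d: "of_degree 3 phi_terms" by (simp add: phi_terms_def)
  have "mform (mform_d phi_terms) x = (\<lambda>vs. 0)"
  proof (rule alternating_eqI[of 4])
    show "alternating_form 4 (mform (mform_d phi_terms) x)"
      using alternating_mform[OF of_degree_mform_d[OF d]] by simp
    have "\<forall>K\<in>set (sublists_of 4 [7,1,2,3,4,5,6]). mform (mform_d phi_terms) x (basis_list K) = 0"
      by (simp add: phi_terms_def mform_eval)
    then show "mform (mform_d phi_terms) x (basis_list K) = 0"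
      if "K \<in> multi_indices 4" for K using that unfolding multi_indices_eq by blast
  qed simp
  then show ?thesis by (simp add: ext_deriv_mform[OF d])
qed

lemma pullback_psi0: "pullback (coframe x) psi0 = mform psi_terms x"
proof (rule alternating_eqI[of 4])
  have "\<forall>K\<in>set (sublists_of 4 [7,1,2,3,4,5,6]). pullback (coframe x) psi0 (basis_list K) = mform psi_terms x (basis_list K)"
    unfolding pullback_psi0_basis
    by (simp add: psi_terms_def mform_eval)
  then show "pullback (coframe x) psi0 (basis_list K) = mform psi_terms x (basis_list K)"
    if "K \<in> multi_indices 4" for K using that unfolding multi_indices_eq by blast
qed (auto simp: psi_terms_def intro!: alternating_mform)

lemma ext_deriv_psi:
  "ext_deriv 4 (mform psi_terms) x = pullback (coframe x) (wedge 2 3 (tau_form x) phi0)"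
proof -
  have d: "of_degree 4 psi_terms" by (simp add: psi_terms_def)
  have w: "wedge 2 3 (tau_form x) phi0 = (\<lambda>vs. wexp 2 0 x * (6 * elem_form [1,2,3,4,5] vs
      - 9 * elem_form [1,2,3,6,7] vs + 3 * elem_form [1,4,5,6,7] vs))"
    unfolding tau_form_def wedge_beta0_phi0 by (simp add: algebra_simps)
  have p: "pullback (coframe x) (wedge 2 3 (tau_form x) phi0) (basis_list K) = wexp 2 0 x *
     (6 * minor (coframe x) [1,2,3,4,5] K - 9 * minor (coframe x) [1,2,3,6,7] K + 3 * minor (coframe x) [1,4,5,6,7] K)" for K
    unfolding w by (simp only: pullback_elem_form_basis[symmetric] pullback_def)
  have "mform (mform_d psi_terms) x = pullback (coframe x) (wedge 2 3 (tau_form x) phi0)"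
  proof (rule alternating_eqI[of 5])
    show "alternating_form 5 (mform (mform_d psi_terms) x)"
      using alternating_mform[OF of_degree_mform_d[OF d]] by simp
    show "alternating_form 5 (pullback (coframe x) (wedge 2 3 (tau_form x) phi0))"
      unfolding w by (intro alternating_pullback alternating_scale alternating_add alternating_diff alternating_elem_form) simp_all
    have "\<forall>K\<in>set (sublists_of 5 [7,1,2,3,4,5,6]). mform (mform_d psi_terms) x (basis_list K)
       = pullback (coframe x) (wedge 2 3 (tau_form x) phi0) (basis_list K)"
      unfolding p by (simp add: psi_terms_def mform_eval)
    then show "mform (mform_d psi_terms) x (basis_list K)
       = pullback (coframe x) (wedge 2 3 (tau_form x) phi0) (basis_list K)"
      if "K \<in> multi_indices 5" for K using that unfolding multi_indices_eq by blast
  qed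
  then show ?thesis by (simp add: ext_deriv_mform[OF d])
qed

text \<open>
  The right-hand side of the quadratic condition for \<open>\<lambda> = 1/3\<close>. With \<open>(a, b, c) = (-3, 9, -6)\<close> and up
  to the factor \<open>exp (4 s)\<close>, \<open>|\<tau>|\<^sup>2\<close> is 126, which accounts for the coefficient
  \<open>4/3 * 126/7 = 24\<close>, and the other coefficients are \<open>2/3 b c\<close>, \<open>2/3 a c\<close> and \<open>2/3 a b\<close>.
\<close>

definition dtau_form :: "real^7 \<Rightarrow> 7 covector" where
  "dtau_form x = (\<lambda>vs. wexp 4 0 x * (24 * phi0 vs - 36 * elem_form [1,2,3] vs
     + 12 * elem_form [1,4,5] vs - 18 * elem_form [1,6,7] vs))"

lemma ext_deriv_tau: "ext_deriv 2 (mform tau_terms) x = pullback (coframe x) (dtau_form x)"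
proof -
  have d: "of_degree 2 tau_terms" by (simp add: tau_terms_def)
  have p: "pullback (coframe x) (dtau_form x) (basis_list K) = wexp 4 0 x * (24 * pullback (coframe x) phi0 (basis_list K)
     - 36 * minor (coframe x) [1,2,3] K + 12 * minor (coframe x) [1,4,5] K - 18 * minor (coframe x) [1,6,7] K)" for K
    unfolding dtau_form_def by (simp only: pullback_elem_form_basis[symmetric] pullback_def)
  have wexp_numeral: "wexp a b x * (numeral n * wexp a' b' x) = numeral n * wexp (a + a') (b + b') x" for a b a' b' n
    by (simp add: mult.left_commute[of "wexp _ _ _"] wexp_mult)
  have "mform (mform_d tau_terms) x = pullback (coframe x) (dtau_form x)"
  proof (rule alternating_eqI[of 3])
    show "alternating_form 3 (mform (mform_d tau_terms) x)"
      using alternating_mform[OF of_degree_mform_d[OF d]] by simp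
    show "alternating_form 3 (pullback (coframe x) (dtau_form x))"
      unfolding dtau_form_def
      by (intro alternating_pullback alternating_scale alternating_add alternating_diff alternating_elem_form) simp_all
    have "\<forall>K\<in>set (sublists_of 3 [7,1,2,3,4,5,6]). mform (mform_d tau_terms) x (basis_list K)
       = pullback (coframe x) (dtau_form x) (basis_list K)"
      unfolding p pullback_phi0 by (simp add: tau_terms_def phi_terms_def mform_eval wexp_numeral)
    then show "mform (mform_d tau_terms) x (basis_list K) = pullback (coframe x) (dtau_form x) (basis_list K)"
      if "K \<in> multi_indices 3" for K using that unfolding multi_indices_eq by blast
  qed
  then show ?thesis by (simp add: ext_deriv_mform[OF d])
qed

section \<open>Block matrices and the maximal torus\<close>

text \<open>
  The real matrix of multiplication by \<open>r\<close> on the first axis and by \<open>a\<close>, \<open>b\<close>, \<open>c\<close> on the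
  complex coordinates \<open>e\<^sup>2 + i e\<^sup>3\<close>, \<open>e\<^sup>4 + i e\<^sup>5\<close>, \<open>e\<^sup>6 + i e\<^sup>7\<close>.
\<close>

definition bmat :: "real \<Rightarrow> complex \<Rightarrow> complex \<Rightarrow> complex \<Rightarrow> real^7^7" where
  "bmat r a b c = (\<chi> i.
     if i = 1 then r *\<^sub>R axis 1 1
     else if i = 2 then Re a *\<^sub>R axis 2 1 - Im a *\<^sub>R axis 3 1
     else if i = 3 then Im a *\<^sub>R axis 2 1 + Re a *\<^sub>R axis 3 1
     else if i = 4 then Re b *\<^sub>R axis 4 1 - Im b *\<^sub>R axis 5 1
     else if i = 5 then Im b *\<^sub>R axis 4 1 + Re b *\<^sub>R axis 5 1
     else if i = 6 then Re c *\<^sub>R axis 6 1 - Im c *\<^sub>R axis 7 1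
     else Im c *\<^sub>R axis 6 1 + Re c *\<^sub>R axis 7 1)"

lemma bmat_row:
  "bmat r a b c $ 1 $ j = (if j = 1 then r else 0)"
  "bmat r a b c $ 2 $ j = (if j = 2 then Re a else if j = 3 then - Im a else 0)"
  "bmat r a b c $ 3 $ j = (if j = 2 then Im a else if j = 3 then Re a else 0)"
  "bmat r a b c $ 4 $ j = (if j = 4 then Re b else if j = 5 then - Im b else 0)"
  "bmat r a b c $ 5 $ j = (if j = 4 then Im b else if j = 5 then Re b else 0)"
  "bmat r a b c $ 6 $ j = (if j = 6 then Re c else if j = 7 then - Im c else 0)"
  "bmat r a b c $ 7 $ j = (if j = 6 then Im c else if j = 7 then Re c else 0)"
  by (simp_all add: bmat_def axis_def)

lemma bmat_mult: "bmat r a b c ** bmat r' a' b' c' = bmat (r * r') (a * a') (b * b') (c * c')"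
  unfolding Finite_Cartesian_Product.vec_eq_iff forall_7
  by (simp add: matrix_matrix_mult_def sum_7 bmat_row)

lemma bmat_one: "bmat 1 1 1 1 = mat 1"
  unfolding Finite_Cartesian_Product.vec_eq_iff forall_7
  by (simp add: bmat_row Finite_Cartesian_Product.mat_def)

lemma bmat_diff: "bmat r a b c - bmat r' a' b' c' = bmat (r - r') (a - a') (b - b') (c - c')"
  unfolding Finite_Cartesian_Product.vec_eq_iff forall_7
  by (simp add: bmat_row)

lemma bmat_inj: "bmat r a b c = bmat r' a' b' c' \<longleftrightarrow> r = r' \<and> a = a' \<and> b = b' \<and> c = c'"
  unfolding Finite_Cartesian_Product.vec_eq_iff forall_7
  by (auto simp add: bmat_row complex_eq_iff)

text \<open>
  The skew-symmetric matrix of the 2-form \<^const>\<open>beta0\<close>.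
\<close>

abbreviation skew :: "real \<Rightarrow> real \<Rightarrow> real \<Rightarrow> real^7^7" where
  "skew a b c \<equiv> bmat 0 (- (\<i> * of_real a)) (- (\<i> * of_real b)) (- (\<i> * of_real c))"

text \<open>
  The entries that link two planes intertwine infinitesimal rotations of speeds \<open>p\<close> and \<open>q\<close>.
\<close>

lemma pair_zero:
  fixes x y p q :: real
  assumes "p * x = q * y" "p * y = q * x" "p\<^sup>2 \<noteq> q\<^sup>2"
  shows "x = 0" "y = 0"
proof -
  have "(p\<^sup>2 - q\<^sup>2) * x = p * (p * x) - q * (q * x)" "(p\<^sup>2 - q\<^sup>2) * y = p * (p * y) - q * (q * y)"
    by (simp_all add: power2_eq_square algebra_simps)
  then have "(p\<^sup>2 - q\<^sup>2) * x = 0" "(p\<^sup>2 - q\<^sup>2) * y = 0"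
    using assms(1,2) by (simp_all add: mult.left_commute)
  then show "x = 0" "y = 0" using assms(3) by simp_all
qed

text \<open>
  The kernel and the three planes of the skew matrix belong to different eigenvalues of its square, so
  they are preserved by \<open>A\<close>; on each plane \<open>A\<close> commutes with a rotation by a right angle.
\<close>

lemma commuting_skew:
  fixes A :: "real^7^7"
  assumes comm: "skew p q r ** A = A ** skew p q r"
    and nz: "p \<noteq> 0" "q \<noteq> 0" "r \<noteq> 0" and dist: "p\<^sup>2 \<noteq> q\<^sup>2" "p\<^sup>2 \<noteq> r\<^sup>2" "q\<^sup>2 \<noteq> r\<^sup>2"
  shows "\<exists>t a b c. A = bmat t a b c"
proof -
  have e: "(skew p q r ** A) $ i $ j = (A ** skew p q r) $ i $ j" for i j by (simp add: comm)
  note ev = matrix_matrix_mult_def sum_7 bmat_row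
  have z1: "A$1$2 = 0" "A$1$3 = 0" "A$1$4 = 0" "A$1$5 = 0" "A$1$6 = 0" "A$1$7 = 0"
    using e[of 1 2] e[of 1 3] e[of 1 4] e[of 1 5] e[of 1 6] e[of 1 7] nz by (simp_all add: ev)
  have z2: "A$2$1 = 0" "A$3$1 = 0" "A$4$1 = 0" "A$5$1 = 0" "A$6$1 = 0" "A$7$1 = 0"
    using e[of 2 1] e[of 3 1] e[of 4 1] e[of 5 1] e[of 6 1] e[of 7 1] nz by (simp_all add: ev)
  have d: "A$3$3 = A$2$2" "A$5$5 = A$4$4" "A$7$7 = A$6$6"
    using e[of 2 3] e[of 4 5] e[of 6 7] nz by (simp_all add: ev)
  have "p * (A$3$2 + A$2$3) = 0" "q * (A$5$4 + A$4$5) = 0" "r * (A$7$6 + A$6$7) = 0"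
    using e[of 2 2] e[of 4 4] e[of 6 6] by (simp_all add: ev distrib_left mult.commute)
  then have d': "A$2$3 = - A$3$2" "A$4$5 = - A$5$4" "A$6$7 = - A$7$6"
    using nz by (simp_all add: add_eq_0_iff)
  note dist = dist dist[symmetric]
  have "p * A$2$4 = q * A$3$5" "p * A$3$5 = q * A$2$4" "p * A$2$5 = q * (- A$3$4)" "p * (- A$3$4) = q * A$2$5"
    using e[of 3 4] e[of 2 5] e[of 3 5] e[of 2 4] by (simp_all add: ev mult.commute)
  note o1 = pair_zero[OF this(1,2)] pair_zero[OF this(3,4)]
  have "p * A$2$6 = r * A$3$7" "p * A$3$7 = r * A$2$6" "p * A$2$7 = r * (- A$3$6)" "p * (- A$3$6) = r * A$2$7"
    using e[of 3 6] e[of 2 7] e[of 3 7] e[of 2 6] by (simp_all add: ev mult.commute)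
  note o2 = pair_zero[OF this(1,2)] pair_zero[OF this(3,4)]
  have "q * A$4$2 = p * A$5$3" "q * A$5$3 = p * A$4$2" "q * A$4$3 = p * (- A$5$2)" "q * (- A$5$2) = p * A$4$3"
    using e[of 5 2] e[of 4 3] e[of 5 3] e[of 4 2] by (simp_all add: ev mult.commute)
  note o3 = pair_zero[OF this(1,2)] pair_zero[OF this(3,4)]
  have "q * A$4$6 = r * A$5$7" "q * A$5$7 = r * A$4$6" "q * A$4$7 = r * (- A$5$6)" "q * (- A$5$6) = r * A$4$7"
    using e[of 5 6] e[of 4 7] e[of 5 7] e[of 4 6] by (simp_all add: ev mult.commute)
  note o4 = pair_zero[OF this(1,2)] pair_zero[OF this(3,4)]
  have "r * A$6$2 = p * A$7$3" "r * A$7$3 = p * A$6$2" "r * A$6$3 = p * (- A$7$2)" "r * (- A$7$2) = p * A$6$3"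
    using e[of 7 2] e[of 6 3] e[of 7 3] e[of 6 2] by (simp_all add: ev mult.commute)
  note o5 = pair_zero[OF this(1,2)] pair_zero[OF this(3,4)]
  have "r * A$6$4 = q * A$7$5" "r * A$7$5 = q * A$6$4" "r * A$6$5 = q * (- A$7$4)" "r * (- A$7$4) = q * A$6$5"
    using e[of 7 4] e[of 6 5] e[of 7 5] e[of 6 4] by (simp_all add: ev mult.commute)
  note o6 = pair_zero[OF this(1,2)] pair_zero[OF this(3,4)]
  have "A = bmat (A$1$1) (Complex (A$2$2) (A$3$2)) (Complex (A$4$4) (A$5$4)) (Complex (A$6$6) (A$7$6))"
    unfolding Finite_Cartesian_Product.vec_eq_iff forall_7
    using z1 z2 d d' dist o1 o2 o3 o4 o5 o6 by (simp add: bmat_row)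
  then show ?thesis by blast
qed

lemma phi0_at:
  "phi0 [u, v, w] =
     u$1 * (v$2 * w$3 - v$3 * w$2) - u$2 * (v$1 * w$3 - v$3 * w$1) + u$3 * (v$1 * w$2 - v$2 * w$1)
   + u$1 * (v$4 * w$5 - v$5 * w$4) - u$4 * (v$1 * w$5 - v$5 * w$1) + u$5 * (v$1 * w$4 - v$4 * w$1)
   + u$1 * (v$6 * w$7 - v$7 * w$6) - u$6 * (v$1 * w$7 - v$7 * w$1) + u$7 * (v$1 * w$6 - v$6 * w$1)
   + (u$2 * (v$4 * w$6 - v$6 * w$4) - u$4 * (v$2 * w$6 - v$6 * w$2) + u$6 * (v$2 * w$4 - v$4 * w$2))
   - (u$2 * (v$5 * w$7 - v$7 * w$5) - u$5 * (v$2 * w$7 - v$7 * w$2) + u$7 * (v$2 * w$5 - v$5 * w$2))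
   - (u$3 * (v$4 * w$7 - v$7 * w$4) - u$4 * (v$3 * w$7 - v$7 * w$3) + u$7 * (v$3 * w$4 - v$4 * w$3))
   - (u$3 * (v$5 * w$6 - v$6 * w$5) - u$5 * (v$3 * w$6 - v$6 * w$3) + u$6 * (v$3 * w$5 - v$5 * w$3))"
  by (simp add: phi0_def elem_form_Cons algebra_simps)

text \<open>
  \<open>\<phi>\<close> is \<open>e\<^sup>1 \<and> \<omega> + Re \<Omega>\<close>, where \<open>\<omega>\<close> is the sum of the area forms of the three complex lines and
  \<open>\<Omega>\<close> is their complex volume form. Thus \<open>t |a|\<^sup>2 = t |b|\<^sup>2 = t |c|\<^sup>2 = 1\<close> and \<open>a b c = 1\<close>; taking norms in
  the latter gives \<open>t\<^sup>3 = 1\<close>.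
\<close>

lemma bmat_stabiliser_iff:
  "pullback (bmat t a b c) phi0 = phi0 \<longleftrightarrow> t = 1 \<and> norm a = 1 \<and> norm b = 1 \<and> norm c = 1 \<and> a * b * c = 1"
proof
  assume *: "pullback (bmat t a b c) phi0 = phi0"
  have ev: "pullback A phi0 (basis_list [i, j, k]) = phi0 [column i A, column j A, column k A]" for A :: "real^7^7" and i j k
    by (simp add: pullback_def matrix_vector_mult_basis)
  have e: "phi0 [column i (bmat t a b c), column j (bmat t a b c), column k (bmat t a b c)] = phi0 (basis_list [i, j, k])" for i j k
    by (simp only: * ev[symmetric])
  note ev' = phi0_at column_def bmat_row axis_def
  have n: "t * (norm a)\<^sup>2 = 1" "t * (norm b)\<^sup>2 = 1" "t * (norm c)\<^sup>2 = 1"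
    using e[of 1 2 3] e[of 1 4 5] e[of 1 6 7]
    by (simp_all add: ev' cmod_power2, simp_all add: power2_eq_square algebra_simps)
  have abc: "a * b * c = 1"
    using e[of 2 4 6] e[of 2 4 7]
    by (simp add: ev' complex_eq_iff algebra_simps)
  then have "(norm a)\<^sup>2 * (norm b)\<^sup>2 * (norm c)\<^sup>2 = 1"
    by (metis norm_mult norm_one one_power2 power_mult_distrib)
  then have "t ^ 3 = (t * (norm a)\<^sup>2) * (t * (norm b)\<^sup>2) * (t * (norm c)\<^sup>2)"
    by (simp add: power3_eq_cube algebra_simps)
  then have "t ^ 3 = 1" by (simp only: n mult_1)
  then have "root 3 (t ^ 3) = root 3 1" by simp
  then have t: "t = 1" by (simp add: odd_real_root_power_cancel)
  with n abc show "t = 1 \<and> norm a = 1 \<and> norm b = 1 \<and> norm c = 1 \<and> a * b * c = 1"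
    by (simp add: abs_square_eq_1)
next
  assume r: "t = 1 \<and> norm a = 1 \<and> norm b = 1 \<and> norm c = 1 \<and> a * b * c = 1"
  have n: "(Re a)\<^sup>2 + (Im a)\<^sup>2 = 1" "(Re b)\<^sup>2 + (Im b)\<^sup>2 = 1" "(Re c)\<^sup>2 + (Im c)\<^sup>2 = 1"
    using r by (simp_all flip: cmod_power2)
  have "Re (a * b * c) = 1" "Im (a * b * c) = 0" using r by simp_all
  then have abc: "1 + (Im a * (Im b * Re c) + (Im a * (Im c * Re b) + Im b * (Im c * Re a))) = Re a * (Re b * Re c)"
    "Im a * (Re b * Re c) + (Im b * (Re a * Re c) + Im c * (Re a * Re b)) = Im a * (Im b * Im c)"
    unfolding times_complex.simps by argo+
  have t: "t = 1" using r by simp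
  show "pullback (bmat t a b c) phi0 = phi0"
  proof (rule alternating_eqI[of 3])
    have "\<forall>K\<in>set (sublists_of 3 [7,1,2,3,4,5,6]). pullback (bmat t a b c) phi0 (basis_list K) = phi0 (basis_list K)"
      using n
      by (simp add: t pullback_def matrix_vector_mult_basis phi0_at column_def bmat_row)
         (simp add: axis_def power2_eq_square algebra_simps abc)
    then show "pullback (bmat t a b c) phi0 (basis_list K) = phi0 (basis_list K)"
      if "K \<in> multi_indices 3" for K using that unfolding multi_indices_eq by blast
  qed simp_all
qed

lemma beta0_at: "beta0 p q r [u, v] = u \<bullet> (skew p q r *v v)"
  by (simp add: beta0_def elem_form_Cons inner_vec_def sum_7 matrix_vector_mult_def bmat_row algebra_simps)

lemma pullback_bmat_beta0:
  assumes "norm a = 1" "norm b = 1" "norm c = 1"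
  shows "pullback (bmat t a b c) (beta0 p q r) = beta0 p q r"
proof (rule alternating_eqI[of 2])
  have n: "Re a * Re a + Im a * Im a = 1" "Re b * Re b + Im b * Im b = 1" "Re c * Re c + Im c * Im c = 1"
    using assms by (simp_all flip: cmod_power2 power2_eq_square)
  have n': "p * (Re a * Re a) + p * (Im a * Im a) = p" "q * (Re b * Re b) + q * (Im b * Im b) = q" "r * (Re c * Re c) + r * (Im c * Im c) = r"
    by (simp_all only: n distrib_left[symmetric] mult_1_right)
  have "\<forall>K\<in>set (sublists_of 2 [7,1,2,3,4,5,6]). pullback (bmat t a b c) (beta0 p q r) (basis_list K) = beta0 p q r (basis_list K)"
    using n' by (simp add: pullback_def matrix_vector_mult_basis beta0_def elem_form_Cons column_def bmat_row) (simp add: axis_def algebra_simps)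
  then show "pullback (bmat t a b c) (beta0 p q r) (basis_list K) = beta0 p q r (basis_list K)"
    if "K \<in> multi_indices 2" for K using that unfolding multi_indices_eq by blast
qed simp_all

text \<open>
  \<open>A\<^sup>T S A = S\<close> for the skew matrix \<open>S\<close> of the 2-form, and \<open>A\<close> is orthogonal because it
  preserves \<open>\<phi>\<close>.
\<close>

lemma beta0_stabiliser_commutes:
  assumes A: "pullback A phi0 = phi0" and B: "pullback A (beta0 p q r) = beta0 p q r"
  shows "skew p q r ** A = A ** skew p q r"
proof -
  have tr: "u \<bullet> (transpose A *v w) = (A *v u) \<bullet> w" for u w
    by (metis dot_lmul_matrix inner_commute transpose_matrix_vector)
  have orth: "A ** transpose A = mat 1" by (rule phi0_stabiliser(1)[OF A])
  have "(transpose A ** (skew p q r ** A)) $ i $ j = skew p q r $ i $ j" for i j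
  proof -
    have "(transpose A ** (skew p q r ** A)) $ i $ j = axis i 1 \<bullet> ((transpose A ** (skew p q r ** A)) *v axis j 1)"
      by (simp add: matrix_vector_mult_basis column_def inner_axis')
    also have "\<dots> = (A *v axis i 1) \<bullet> (skew p q r *v (A *v axis j 1))"
      by (simp only: matrix_vector_mul_assoc[symmetric] tr)
    also have "\<dots> = pullback A (beta0 p q r) [axis i 1, axis j 1]"
      by (simp only: beta0_at pullback_def list.map)
    also have "\<dots> = axis i 1 \<bullet> (skew p q r *v axis j 1)" by (simp only: B beta0_at)
    also have "\<dots> = skew p q r $ i $ j" by (simp add: matrix_vector_mult_basis column_def inner_axis')
    finally show ?thesis .
  qed
  then have "transpose A ** (skew p q r ** A) = skew p q r" by (simp add: Finite_Cartesian_Product.vec_eq_iff)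
  then have "A ** (transpose A ** (skew p q r ** A)) = A ** skew p q r" by simp
  then show ?thesis by (simp add: matrix_mul_assoc orth)
qed

definition T2 :: "(real^7^7) set" where
  "T2 = {bmat 1 z w (cnj (z * w)) | z w. norm z = 1 \<and> norm w = 1}"

lemma bmat_in_T2:
  assumes "pullback (bmat t a b c) phi0 = phi0"
  shows "bmat t a b c \<in> T2"
proof -
  have r: "t = 1" "norm a = 1" "norm b = 1" "norm c = 1" "a * b * c = 1"
    using assms by (auto simp: bmat_stabiliser_iff)
  have "cnj (a * b) = cnj (a * b) * (a * b * c)" using r by simp
  also have "\<dots> = (a * b) * cnj (a * b) * c" by (simp add: mult_ac)
  also have "\<dots> = c" unfolding complex_norm_square[symmetric] using r by (simp add: norm_mult)
  finally show ?thesis using r by (auto simp: T2_def)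
qed

lemma T2_phi0: "A \<in> T2 \<Longrightarrow> pullback A phi0 = phi0"
proof -
  have "z * w * cnj (z * w) = 1" if "norm z = 1" "norm w = 1" for z w
    unfolding complex_norm_square[symmetric] using that by (simp add: norm_mult)
  then show "A \<in> T2 \<Longrightarrow> pullback A phi0 = phi0"
    by (auto simp: T2_def bmat_stabiliser_iff norm_mult)
qed

lemma T2_beta0: "A \<in> T2 \<Longrightarrow> pullback A (beta0 p q r) = beta0 p q r"
  by (auto simp: T2_def norm_mult intro!: pullback_bmat_beta0)

lemma T2_stabiliser:
  assumes "p \<noteq> 0" "q \<noteq> 0" "r \<noteq> 0" "p\<^sup>2 \<noteq> q\<^sup>2" "p\<^sup>2 \<noteq> r\<^sup>2" "q\<^sup>2 \<noteq> r\<^sup>2"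
  shows "A \<in> T2 \<longleftrightarrow> pullback A phi0 = phi0 \<and> pullback A (beta0 p q r) = beta0 p q r"
proof
  assume A: "pullback A phi0 = phi0 \<and> pullback A (beta0 p q r) = beta0 p q r"
  then have "skew p q r ** A = A ** skew p q r" by (intro beta0_stabiliser_commutes) auto
  from commuting_skew[OF this assms] obtain t a b c where "A = bmat t a b c" by blast
  then show "A \<in> T2" using bmat_in_T2 A by blast
qed (simp add: T2_phi0 T2_beta0)

text \<open>
  The commutation with one element and its inverse implies that with their difference, which is a skew
  matrix as in \<open>commuting_skew\<close> if the rotation angles are sufficiently general.
\<close>

lemma T2_centraliser:
  assumes A: "pullback A phi0 = phi0" and comm: "\<And>B. B \<in> T2 \<Longrightarrow> A ** B = B ** A"
  shows "A \<in> T2"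
proof -
  \<comment> \<open>The imaginary parts of \<open>z\<close>, \<open>w\<close> and \<open>z w = i\<close> are the distinct non-zero numbers 4/5, 3/5 and 1.\<close>
  define z w where "z = Complex (3/5) (4/5)" and "w = Complex (4/5) (3/5)"
  have n: "norm z = 1" "norm w = 1"
    by (simp_all add: z_def w_def cmod_def power2_eq_square)
  let ?B = "bmat 1 z w (cnj (z * w))" and ?C = "bmat 1 (cnj z) (cnj w) (cnj (cnj z * cnj w))"
  have "?B \<in> T2" "?C \<in> T2" using n unfolding T2_def by (auto simp del: complex_cnj_mult) (metis complex_mod_cnj)
  note c = comm[OF this(1)] comm[OF this(2)]
  have S: "?C - ?B = skew (8/5) (6/5) (-2)"
    unfolding bmat_diff bmat_inj by (simp add: z_def w_def complex_eq_iff)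
  have sub: "A ** (?C - ?B) = A ** ?C - A ** ?B" "(?C - ?B) ** A = ?C ** A - ?B ** A"
    by (simp_all add: matrix_matrix_mult_def Finite_Cartesian_Product.vec_eq_iff algebra_simps sum_subtractf)
  have "skew (8/5) (6/5) (-2) ** A = A ** skew (8/5) (6/5) (-2)"
    unfolding S[symmetric] sub c ..
  from commuting_skew[OF this] obtain t a b c where "A = bmat t a b c"
    by (auto simp: power2_eq_square)
  then show ?thesis using bmat_in_T2 A by blast
qed

lemma T2_mult: "A \<in> T2 \<Longrightarrow> B \<in> T2 \<Longrightarrow> A ** B \<in> T2"
proof -
  assume "A \<in> T2" "B \<in> T2"
  then obtain z w z' w' where A: "A = bmat 1 z w (cnj (z * w))" and B: "B = bmat 1 z' w' (cnj (z' * w'))"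
    and n: "norm z = 1" "norm w = 1" "norm z' = 1" "norm w' = 1"
    unfolding T2_def by blast
  have "A ** B = bmat 1 (z * z') (w * w') (cnj (z * z' * (w * w')))"
    unfolding A B bmat_mult bmat_inj by (simp add: mult_ac)
  moreover have "norm (z * z') = 1" "norm (w * w') = 1" using n by (simp_all add: norm_mult)
  ultimately show ?thesis unfolding T2_def by blast
qed

lemma T2_commute: "A \<in> T2 \<Longrightarrow> B \<in> T2 \<Longrightarrow> A ** B = B ** A"
  by (auto simp: T2_def bmat_mult mult_ac)

lemma T2_one: "mat 1 \<in> T2"
  unfolding T2_def bmat_one[symmetric] by (intro CollectI exI[of _ 1]) simp

lemma T2_inverse: "A \<in> T2 \<Longrightarrow> \<exists>B\<in>T2. B ** A = mat 1"
proof -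
  assume "A \<in> T2"
  then obtain z w where A: "A = bmat 1 z w (cnj (z * w))" and n: "norm z = 1" "norm w = 1"
    by (auto simp: T2_def)
  have u: "cnj z * z = 1" "cnj w * w = 1" "cnj (cnj z * cnj w) * cnj (z * w) = 1"
    using n complex_norm_square[of z] complex_norm_square[of w] complex_norm_square[of "z * w"]
    by (simp_all add: mult_ac norm_mult)
  show ?thesis
  proof (rule bexI)
    show "bmat 1 (cnj z) (cnj w) (cnj (cnj z * cnj w)) ** A = mat 1"
      unfolding A bmat_mult u by (simp add: bmat_one)
    show "bmat 1 (cnj z) (cnj w) (cnj (cnj z * cnj w)) \<in> T2"
      unfolding T2_def using n by (intro CollectI exI[of _ "cnj z"] exI[of _ "cnj w"]) simp
  qed
qed

section \<open>Conjugated stabilisers and tori\<close>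

lemma pullback_pullback:
  fixes A :: "real^'n::finite^'m::finite" and B :: "real^'k::finite^'n"
  shows "pullback B (pullback A \<alpha>) = pullback (A ** B) \<alpha>"
  by (simp add: pullback_def fun_eq_iff o_def matrix_vector_mul_assoc)

lemma pullback_mat_1 [simp]: "pullback (mat 1) \<alpha> = \<alpha>"
  by (simp add: pullback_def fun_eq_iff)

lemma matrix_inv_mult:
  fixes U :: "real^'n::finite^'n"
  assumes "invertible U"
  shows "matrix_inv U ** U = mat 1" "U ** matrix_inv U = mat 1"
  using someI_ex[OF assms[unfolded invertible_def]] unfolding matrix_inv_def by blast+

text \<open>
  \<open>U\<close> is an adapted coframe of \<open>U\<^sup>*\<phi>\<close>; conjugation by it takes symmetries of the model forms to
  symmetries of their pullbacks.
\<close>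

definition conj_by :: "real^7^7 \<Rightarrow> real^7^7 \<Rightarrow> real^7^7" where
  "conj_by U A = matrix_inv U ** A ** U"

context
  fixes U :: "real^7^7"
  assumes U: "invertible U"
begin

lemma conj_by_mult: "conj_by U A ** conj_by U B = conj_by U (A ** B)"
proof -
  have "conj_by U A ** conj_by U B = matrix_inv U ** A ** (U ** matrix_inv U) ** B ** U"
    by (simp add: conj_by_def matrix_mul_assoc)
  then show ?thesis by (simp add: matrix_inv_mult[OF U] conj_by_def matrix_mul_assoc)
qed

lemma conj_by_one: "conj_by U (mat 1) = mat 1"
  by (simp add: conj_by_def matrix_inv_mult[OF U])

lemma conj_by_surj: "\<exists>B. A = conj_by U B"
proof
  have "conj_by U (U ** A ** matrix_inv U) = (matrix_inv U ** U) ** A ** (matrix_inv U ** U)"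
    by (simp add: conj_by_def matrix_mul_assoc)
  then show "A = conj_by U (U ** A ** matrix_inv U)" by (simp add: matrix_inv_mult[OF U])
qed

lemma conj_by_inj: "conj_by U A = conj_by U B \<longleftrightarrow> A = B"
proof
  assume "conj_by U A = conj_by U B"
  then have "U ** conj_by U A ** matrix_inv U = U ** conj_by U B ** matrix_inv U" by simp
  moreover have "U ** conj_by U A ** matrix_inv U = (U ** matrix_inv U) ** A ** (U ** matrix_inv U)" for A
    by (simp add: conj_by_def matrix_mul_assoc)
  ultimately show "A = B" by (simp add: matrix_inv_mult[OF U])
qed simp

lemma pullback_conj_by: "pullback (conj_by U A) (pullback U \<alpha>) = pullback U \<alpha> \<longleftrightarrow> pullback A \<alpha> = \<alpha>"
proof -
  have eq: "pullback (conj_by U A) (pullback U \<alpha>) = pullback U (pullback A \<alpha>)"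
    unfolding pullback_pullback conj_by_def by (simp add: matrix_mul_assoc matrix_inv_mult[OF U])
  have inj: "pullback (matrix_inv U) (pullback U \<beta>) = \<beta>" for \<beta> :: "7 covector"
    by (simp add: pullback_pullback matrix_inv_mult[OF U])
  show ?thesis unfolding eq by (metis inj)
qed

end

lemma invertible_T2: "A \<in> T2 \<Longrightarrow> invertible A"
  using T2_inverse by (metis invertible_left_inverse)

lemma phi0_stabiliser_invertible: "pullback A phi0 = phi0 \<Longrightarrow> invertible A"
  using phi0_stabiliser(1) by (metis invertible_right_inverse)

lemma invertible_conj_by:
  assumes "invertible U" "invertible A"
  shows "invertible (conj_by U A)"
proof -
  have "invertible (matrix_inv U)"
    using matrix_inv_mult(1)[OF assms(1)] invertible_right_inverse by blast
  then show ?thesis unfolding conj_by_def by (intro invertible_mult assms)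
qed

lemma group_GL: "group (GL :: (real^'n::finite^'n) monoid)"
proof (rule groupI)
  fix A :: "real^'n^'n" assume "A \<in> carrier GL"
  then show "\<exists>B\<in>carrier GL. B \<otimes>\<^bsub>GL\<^esub> A = \<one>\<^bsub>GL\<^esub>"
    by (auto simp: GL_def invertible_def)
qed (auto simp: GL_def invertible_mult matrix_mul_assoc invertible_def[of "mat 1"])

lemma inverse_GL:
  assumes "B ** A = mat 1" "invertible A" "invertible B"
  shows "inv\<^bsub>GL\<^esub> A = B"
  using group.inv_equality[OF group_GL, of B A] assms by (simp add: GL_def)

lemma stabiliser_T2:
  assumes U: "invertible U"
    and pqr: "p \<noteq> 0" "q \<noteq> 0" "r \<noteq> 0" "p\<^sup>2 \<noteq> q\<^sup>2" "p\<^sup>2 \<noteq> r\<^sup>2" "q\<^sup>2 \<noteq> r\<^sup>2"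
  shows "stabiliser (stabiliser (carrier GL) (pullback U phi0)) (pullback U (beta0 p q r)) = conj_by U ` T2"
proof (intro Set.set_eqI iffI)
  fix A assume A: "A \<in> stabiliser (stabiliser (carrier GL) (pullback U phi0)) (pullback U (beta0 p q r))"
  obtain B where B: "A = conj_by U B" using conj_by_surj[OF U] by blast
  have "B \<in> T2"
    using A T2_stabiliser[OF pqr] by (simp add: stabiliser_def B pullback_conj_by[OF U])
  then show "A \<in> conj_by U ` T2" using B by blast
next
  fix A assume "A \<in> conj_by U ` T2"
  then obtain B where B: "A = conj_by U B" "B \<in> T2" by blast
  then show "A \<in> stabiliser (stabiliser (carrier GL) (pullback U phi0)) (pullback U (beta0 p q r))"
    using T2_phi0 T2_beta0 invertible_conj_by[OF U invertible_T2]
    by (simp add: stabiliser_def GL_def pullback_conj_by[OF U])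
qed

definition T2_param :: "real^7^7 \<Rightarrow> complex \<times> complex \<Rightarrow> real^7^7" where
  "T2_param U zw = conj_by U (bmat 1 (fst zw) (snd zw) (cnj (fst zw * snd zw)))"

lemma T2_param_image: "T2_param U ` (sphere 0 1 \<times> sphere 0 1) = conj_by U ` T2"
  by (force simp: T2_param_def T2_def)

lemma continuous_bmat: "continuous_on S (\<lambda>zw. bmat 1 (fst zw) (snd zw) (cnj (fst zw * snd zw)))"
  unfolding bmat_def
proof (rule continuous_on_vec_lambda)
  fix i :: 7
  show "continuous_on S (\<lambda>x. if i = 1 then 1 *\<^sub>R axis 1 (1::real)
     else if i = 2 then Re (fst x) *\<^sub>R axis 2 1 - Im (fst x) *\<^sub>R axis 3 1
     else if i = 3 then Im (fst x) *\<^sub>R axis 2 1 + Re (fst x) *\<^sub>R axis 3 1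
     else if i = 4 then Re (snd x) *\<^sub>R axis 4 1 - Im (snd x) *\<^sub>R axis 5 1
     else if i = 5 then Im (snd x) *\<^sub>R axis 4 1 + Re (snd x) *\<^sub>R axis 5 1
     else if i = 6 then Re (cnj (fst x * snd x)) *\<^sub>R axis 6 1 - Im (cnj (fst x * snd x)) *\<^sub>R axis 7 1
     else Im (cnj (fst x * snd x)) *\<^sub>R axis 6 1 + Re (cnj (fst x * snd x)) *\<^sub>R axis 7 1 :: real^7)"
    by (cases "i = 1"; cases "i = 2"; cases "i = 3"; cases "i = 4"; cases "i = 5"; cases "i = 6";
        simp; intro continuous_intros)
qed

lemma continuous_T2_param: "continuous_on S (T2_param U)"
proof -
  have "linear (\<lambda>A. matrix_inv U ** A ** U)"
    by (rule linearI) (simp_all add: matrix_matrix_mult_def Finite_Cartesian_Product.vec_eq_iff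
        ring_distribs sum.distrib sum_distrib_left sum_distrib_right mult_ac)
  then have "continuous_on UNIV (\<lambda>A. matrix_inv U ** A ** U)"
    by (intro linear_continuous_on) (simp add: linear_conv_bounded_linear)
  then show ?thesis
    unfolding T2_param_def[abs_def] conj_by_def
    by (rule continuous_on_compose2[OF _ continuous_bmat]) simp
qed

text \<open>
  A torus that contains \<open>T\<^sup>2\<close> centralises it, and the centraliser of \<open>T\<^sup>2\<close> in \<open>G\<^sub>2\<close> is \<open>T\<^sup>2\<close>.
\<close>

lemma T2_torus:
  assumes U: "invertible U"
  shows "maximal_torus (stabiliser (carrier GL) (pullback U phi0)) (conj_by U ` T2)"
    and "isomorphic_to_T2 (conj_by U ` T2)"
proof -
  let ?T = "conj_by U ` T2" and ?S = "sphere (0::complex) 1 \<times> sphere (0::complex) 1"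
  have img: "T2_param U ` ?S = ?T" by (rule T2_param_image)
  have comm: "A ** B = B ** A" if "A \<in> ?T" "B \<in> ?T" for A B
    using that T2_commute by (auto simp: conj_by_mult[OF U])
  have S: "compact ?S" "connected ?S"
    by (auto intro!: compact_Times connected_Times connected_sphere)
  have sub: "subgroup ?T GL"
  proof
    show "?T \<subseteq> carrier GL"
      using invertible_conj_by[OF U invertible_T2] by (auto simp: GL_def)
    show "A \<otimes>\<^bsub>GL\<^esub> B \<in> ?T" if "A \<in> ?T" "B \<in> ?T" for A B
      using that T2_mult by (auto simp: GL_def conj_by_mult[OF U])
    show "\<one>\<^bsub>GL\<^esub> \<in> ?T" using T2_one conj_by_one[OF U] by (auto simp: GL_def image_iff) metis
    show "inv\<^bsub>GL\<^esub> A \<in> ?T" if "A \<in> ?T" for A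
    proof -
      obtain B where B: "A = conj_by U B" "B \<in> T2" using \<open>A \<in> ?T\<close> by blast
      obtain C where C: "C \<in> T2" "C ** B = mat 1" using T2_inverse[OF B(2)] by blast
      have "inv\<^bsub>GL\<^esub> A = conj_by U C"
        unfolding B(1) using C B(2) invertible_conj_by[OF U invertible_T2] conj_by_mult[OF U] conj_by_one[OF U]
        by (intro inverse_GL) auto
      then show ?thesis using C(1) by blast
    qed
  qed
  have torus: "torus ?T"
    unfolding torus_def
  proof (intro conjI sub ballI)
    show "compact ?T" unfolding img[symmetric] by (intro compact_continuous_image continuous_T2_param S)
    show "connected ?T" unfolding img[symmetric] by (intro connected_continuous_image continuous_T2_param S)
  qed (rule comm)
  show "maximal_torus (stabiliser (carrier GL) (pullback U phi0)) ?T"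
    unfolding maximal_torus_def
  proof (intro conjI torus allI impI)
    show "?T \<subseteq> stabiliser (carrier GL) (pullback U phi0)"
      using T2_phi0 invertible_conj_by[OF U invertible_T2]
      by (auto simp: stabiliser_def GL_def pullback_conj_by[OF U])
    fix T' assume T': "torus T' \<and> T' \<subseteq> stabiliser (carrier GL) (pullback U phi0) \<and> ?T \<subseteq> T'"
    have "T' \<subseteq> ?T"
    proof
      fix A assume A: "A \<in> T'"
      obtain B where B: "A = conj_by U B" using conj_by_surj[OF U] by blast
      have "pullback B phi0 = phi0"
        using A T' B pullback_conj_by[OF U] by (auto simp: stabiliser_def)
      moreover have "B ** C = C ** B" if "C \<in> T2" for C
      proof -
        have "A ** conj_by U C = conj_by U C ** A"
          using T' A that unfolding torus_def by blast
        then show ?thesis by (simp add: B conj_by_mult[OF U] conj_by_inj[OF U])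
      qed
      ultimately have "B \<in> T2" by (rule T2_centraliser)
      then show "A \<in> ?T" using B by blast
    qed
    then show "T' = ?T" using T' by blast
  qed
  have "inj_on (T2_param U) ?S"
    by (auto simp: inj_on_def T2_param_def conj_by_inj[OF U] bmat_inj)
  then obtain g where "homeomorphism ?S ?T (T2_param U) g"
    using homeomorphism_compact[OF S(1) continuous_T2_param img] by blast
  moreover have "T2_param U (z * z', w * w') = T2_param U (z, w) ** T2_param U (z', w')" for z w z' w'
    by (simp add: T2_param_def conj_by_mult[OF U] bmat_mult mult_ac)
  ultimately show "isomorphic_to_T2 ?T" unfolding isomorphic_to_T2_def by blast
qed

section \<open>Non-commuting symmetries of the special 2-forms\<close>

text \<open>
  Complex structures on the span of \<open>e\<^sub>4, \<dots>, e\<^sub>7\<close>, extended to \<open>\<real>\<^sup>7\<close> as elements of \<open>G\<^sub>2\<close>. The first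
  preserves \<open>e\<^sup>4\<^sup>5 - e\<^sup>6\<^sup>7\<close> and reflects the plane of \<open>e\<^sub>2\<close> and \<open>e\<^sub>3\<close>, the second preserves \<open>- 2 e\<^sup>2\<^sup>3 + e\<^sup>4\<^sup>5 + e\<^sup>6\<^sup>7\<close>
  and exchanges the other two planes; hence neither commutes with the maximal torus.
\<close>

definition J1 :: "real^7^7" where
  "J1 = (\<chi> i. if i = 1 then - axis 1 1 else if i = 2 then axis 2 1 else if i = 3 then - axis 3 1
     else if i = 4 then - axis 6 1 else if i = 5 then axis 7 1 else if i = 6 then axis 4 1 else - axis 5 1)"

definition J2 :: "real^7^7" where
  "J2 = (\<chi> i. if i = 1 then axis 1 1 else if i = 2 then axis 2 1 else if i = 3 then axis 3 1
     else if i = 4 then - axis 6 1 else if i = 5 then - axis 7 1 else if i = 6 then axis 4 1 else axis 5 1)"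

lemma J_row:
  "J1 $ 1 $ j = (if j = 1 then -1 else 0)"
  "J1 $ 2 $ j = (if j = 2 then 1 else 0)"
  "J1 $ 3 $ j = (if j = 3 then -1 else 0)"
  "J1 $ 4 $ j = (if j = 6 then -1 else 0)"
  "J1 $ 5 $ j = (if j = 7 then 1 else 0)"
  "J1 $ 6 $ j = (if j = 4 then 1 else 0)"
  "J1 $ 7 $ j = (if j = 5 then -1 else 0)"
  "J2 $ 1 $ j = (if j = 1 then 1 else 0)"
  "J2 $ 2 $ j = (if j = 2 then 1 else 0)"
  "J2 $ 3 $ j = (if j = 3 then 1 else 0)"
  "J2 $ 4 $ j = (if j = 6 then -1 else 0)"
  "J2 $ 5 $ j = (if j = 7 then -1 else 0)"
  "J2 $ 6 $ j = (if j = 4 then 1 else 0)"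
  "J2 $ 7 $ j = (if j = 5 then 1 else 0)"
  by (simp_all add: J1_def J2_def axis_def)

lemma J_phi0: "pullback J1 phi0 = phi0" "pullback J2 phi0 = phi0"
proof -
  have "\<forall>K\<in>set (sublists_of 3 [7,1,2,3,4,5,6]). pullback J1 phi0 (basis_list K) = phi0 (basis_list K)"
    "\<forall>K\<in>set (sublists_of 3 [7,1,2,3,4,5,6]). pullback J2 phi0 (basis_list K) = phi0 (basis_list K)"
    by (simp_all add: pullback_def matrix_vector_mult_basis phi0_at column_def J_row) (simp_all add: axis_def)
  then show "pullback J1 phi0 = phi0" "pullback J2 phi0 = phi0"
    by (auto intro!: alternating_eqI[of 3] simp: multi_indices_eq simp del: sublists_of_numeral)
qed

lemma J_beta0: "pullback J1 (beta0 0 q (- q)) = beta0 0 q (- q)" "pullback J2 (beta0 p q q) = beta0 p q q"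
proof -
  have "\<forall>K\<in>set (sublists_of 2 [7,1,2,3,4,5,6]). pullback J1 (beta0 0 q (- q)) (basis_list K) = beta0 0 q (- q) (basis_list K)"
    "\<forall>K\<in>set (sublists_of 2 [7,1,2,3,4,5,6]). pullback J2 (beta0 p q q) (basis_list K) = beta0 p q q (basis_list K)"
    by (simp_all add: pullback_def matrix_vector_mult_basis beta0_def elem_form_Cons column_def J_row) (simp_all add: axis_def)
  then show "pullback J1 (beta0 0 q (- q)) = beta0 0 q (- q)" "pullback J2 (beta0 p q q) = beta0 p q q"
    by (auto intro!: alternating_eqI[of 2] simp: multi_indices_eq simp del: sublists_of_numeral)
qed

lemma J_not_commute:
  "J1 ** bmat 1 \<i> 1 (-\<i>) \<noteq> bmat 1 \<i> 1 (-\<i>) ** J1" "J2 ** bmat 1 1 \<i> (-\<i>) \<noteq> bmat 1 1 \<i> (-\<i>) ** J2"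
proof -
  have "(J1 ** bmat 1 \<i> 1 (-\<i>)) $ 2 $ 3 \<noteq> (bmat 1 \<i> 1 (-\<i>) ** J1) $ 2 $ 3"
    "(J2 ** bmat 1 1 \<i> (-\<i>)) $ 4 $ 7 \<noteq> (bmat 1 1 \<i> (-\<i>) ** J2) $ 4 $ 7"
    by (simp_all add: matrix_matrix_mult_def sum_7 bmat_row J_row)
  then show "J1 ** bmat 1 \<i> 1 (-\<i>) \<noteq> bmat 1 \<i> 1 (-\<i>) ** J1" "J2 ** bmat 1 1 \<i> (-\<i>) \<noteq> bmat 1 1 \<i> (-\<i>) ** J2"
    by metis+
qed

text \<open>
  A 2-form with maximal torus stabiliser has only commuting symmetries, in whatever adapted coframe it
  is written.
\<close>

lemma symmetries_commute:
  fixes V A B :: "real^7^7"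
  assumes U: "invertible U" and V: "invertible V"
    and pqr: "p \<noteq> 0" "q \<noteq> 0" "r \<noteq> 0" "p\<^sup>2 \<noteq> q\<^sup>2" "p\<^sup>2 \<noteq> r\<^sup>2" "q\<^sup>2 \<noteq> r\<^sup>2"
    and phi: "pullback U phi0 = pullback V phi0"
    and tau: "pullback U (beta0 p q r) = pullback V \<beta>"
    and A: "pullback A phi0 = phi0" "pullback A \<beta> = \<beta>"
    and B: "pullback B phi0 = phi0" "pullback B \<beta> = \<beta>"
  shows "A ** B = B ** A"
proof -
  have "conj_by V C \<in> conj_by U ` T2" if C: "pullback C phi0 = phi0" "pullback C \<beta> = \<beta>" for C
    unfolding stabiliser_T2[OF U pqr, symmetric] unfolding phi tau
    using C invertible_conj_by[OF V phi0_stabiliser_invertible[OF C(1)]]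
    by (simp add: stabiliser_def GL_def pullback_conj_by[OF V])
  from this[OF A] this[OF B] obtain A' B' where
    "conj_by V A = conj_by U A'" "A' \<in> T2" "conj_by V B = conj_by U B'" "B' \<in> T2" by blast
  then have "conj_by V (A ** B) = conj_by V (B ** A)"
    using T2_commute by (simp add: conj_by_mult[OF U] conj_by_mult[OF V, symmetric])
  then show ?thesis by (simp add: conj_by_inj[OF V])
qed

section \<open>The example\<close>

lemma alternating_tau_form [simp]: "alternating_form 2 (tau_form x)"
  by (simp add: tau_form_def)

lemma invertible_coframe: "invertible (coframe x)"
proof -
  have "v = 0" if v: "coframe x *v v = 0" for v
  proof -
    have r: "(coframe x *v v) $ i = 0" for i by (simp add: v)
    note ev = matrix_vector_mult_def sum_7 coframe_def axis_def
    have e: "v $ 1 = 0" "v $ 6 = 0" "v $ 7 = 0" using r[of 1] r[of 6] r[of 7] by (simp_all add: ev)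
    have 2: "wexp 3 (-1) x * (v $ 2 - x $ 6 * v $ 4) - wexp 3 1 x * v $ 5 = 0"
      and 3: "wexp 3 (-1) x * (v $ 3 - x $ 6 * v $ 5) + wexp 3 1 x * v $ 4 = 0"
      using r[of 2] r[of 3] by (simp_all add: ev algebra_simps)
    have "sqrt 5 * (wexp 3 (-1) x * (v $ 2 - x $ 6 * v $ 4) + wexp 3 1 x * v $ 5) = 0"
      "sqrt 5 * (wexp 3 1 x * v $ 4 - wexp 3 (-1) x * (v $ 3 - x $ 6 * v $ 5)) = 0"
      using r[of 4] r[of 5] by (simp_all add: ev algebra_simps)
    then have 45: "wexp 3 (-1) x * (v $ 2 - x $ 6 * v $ 4) + wexp 3 1 x * v $ 5 = 0"
      "wexp 3 1 x * v $ 4 - wexp 3 (-1) x * (v $ 3 - x $ 6 * v $ 5) = 0"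
      unfolding mult_eq_0_iff by simp_all
    have "wexp 3 1 x * v $ 5 = 0" "wexp 3 1 x * v $ 4 = 0"
      "wexp 3 (-1) x * (v $ 2 - x $ 6 * v $ 4) = 0" "wexp 3 (-1) x * (v $ 3 - x $ 6 * v $ 5) = 0"
      using 2 3 45 by linarith+
    then have "v $ 5 = 0" "v $ 4 = 0" "v $ 2 = 0" "v $ 3 = 0" by simp_all
    then show "v = 0" using e by (simp add: Finite_Cartesian_Product.vec_eq_iff forall_7)
  qed
  then show ?thesis by (metis invertible_left_inverse matrix_left_invertible_ker)
qed

text \<open>
  The coframe that the definitions choose differs from \<open>U\<close> by an element of the stabiliser of
  \<^const>\<open>phi0\<close>, under which norm and Hodge star of the model are invariant.
\<close>

lemma
  assumes U: "invertible U" and \<alpha>: "alternating_form k \<alpha>" and k: "k \<le> 7"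
  shows g2_hodge_pullback: "g2_hodge (pullback U phi0) k (pullback U \<alpha>) = pullback U (hodge0 k \<alpha>)"
    and g2_norm_sq_pullback: "g2_norm_sq (pullback U phi0) k (pullback U \<alpha>) = norm_sq0 k \<alpha>"
proof -
  define V where "V = some_coframe (pullback U phi0)"
  have "adapted_coframe (pullback U phi0) U" using U by (simp add: adapted_coframe_def)
  then have "adapted_coframe (pullback U phi0) V" unfolding V_def some_coframe_def by (rule someI)
  then have V: "invertible V" "pullback V phi0 = pullback U phi0" by (simp_all add: adapted_coframe_def)
  define h where "h = U ** matrix_inv V"
  have "pullback h phi0 = pullback (matrix_inv V) (pullback V phi0)"
    by (simp add: h_def V(2) pullback_pullback)
  then have h: "pullback h phi0 = phi0" by (simp add: pullback_pullback matrix_inv_mult[OF V(1)])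
  have hV: "h ** V = U" by (simp add: h_def matrix_inv_mult[OF V(1)] flip: matrix_mul_assoc)
  have 1: "pullback (matrix_inv V) (pullback U \<alpha>) = pullback h \<alpha>" by (simp add: pullback_pullback h_def)
  show "g2_hodge (pullback U phi0) k (pullback U \<alpha>) = pullback U (hodge0 k \<alpha>)"
    unfolding g2_hodge_def V_def[symmetric] 1 hodge0_pullback[OF phi0_stabiliser[OF h] \<alpha> k]
    by (simp add: pullback_pullback hV)
  show "g2_norm_sq (pullback U phi0) k (pullback U \<alpha>) = norm_sq0 k \<alpha>"
    unfolding g2_norm_sq_def V_def[symmetric] 1 by (rule norm_sq0_pullback[OF phi0_stabiliser(1)[OF h] \<alpha>])
qed

definition model_atlas :: "(real^7, 7) chart set" where
  "model_atlas = {(UNIV, id)}"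

definition model_phi :: "(real^7, 7) form_field" where
  "model_phi c x = pullback (coframe x) phi0"

lemma chart_image_model: "c \<in> model_atlas \<Longrightarrow> chart_image c = UNIV"
  by (auto simp: model_atlas_def chart_image_def)

lemma model_phi_mform: "model_phi c = mform phi_terms"
  by (simp add: model_phi_def[abs_def] pullback_phi0)

lemma smooth_on_mform: "smooth_on UNIV (\<lambda>x. mform L x vs)"
  by (simp add: smooth_on_def Ck_on_mform)

lemma smooth_manifold_model: "smooth_manifold (euclidean :: (real^7) topology) model_atlas"
proof -
  have "second_countable (euclidean :: (real^7) topology)"
  proof -
    obtain B :: "(real^7) set set" where B: "countable B" "topological_basis B"
      using ex_countable_basis by blast
    show ?thesis
      unfolding second_countable_def
    proof (intro exI[of _ B] conjI ballI allI impI)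
      show "openin euclidean V" if "V \<in> B" for V
        using topological_basis_open[OF B(2) that] by simp
      show "\<exists>V\<in>B. x \<in> V \<and> V \<subseteq> W" if "openin euclidean W \<and> x \<in> W" for W x
        using topological_basisE[OF B(2)] that by (metis open_openin)
    qed (rule B(1))
  qed
  moreover have "smooth_on UNIV (id :: real^7 \<Rightarrow> real^7)"
    unfolding id_def by (simp add: smooth_on_def Ck_on_id)
  ultimately show ?thesis
    by (simp add: smooth_manifold_def model_atlas_def chart_image_def overlap_def transition_def)
qed

lemma G2_structure_model: "G2_structure model_atlas model_phi"
  unfolding G2_structure_def differential_form_def
proof (intro conjI ballI allI)
  fix c d :: "(real^7, 7) chart" and x :: "real^7" and vs
  assume c: "c \<in> model_atlas"
  show "alternating_form 3 (model_phi c x)" by (simp add: model_phi_def)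
  show "smooth_on (chart_image c) (\<lambda>x. model_phi c x vs)"
    unfolding chart_image_model[OF c] model_phi_mform by (rule smooth_on_mform)
  show "\<exists>u. adapted_coframe (model_phi c x) u"
    using invertible_coframe by (auto simp: adapted_coframe_def model_phi_def)
  assume d: "d \<in> model_atlas"
  have "transition c d = id" using c d by (auto simp: transition_def model_atlas_def)
  then show "model_phi c x = pullback (matrix (frechet_derivative (transition c d) (at x))) (model_phi d (transition c d x))"
    by (simp add: matrix_id_mat_1 model_phi_def id_def[symmetric])
qed

lemma hodge_model_phi: "g2_hodge (model_phi c x) 3 (model_phi c x) = mform psi_terms x"
  by (simp add: model_phi_def g2_hodge_pullback invertible_coframe hodge0_phi0 pullback_psi0)

text \<open>
  The 2-form satisfies the defining equation by \<open>ext_deriv_psi\<close>; it is the only one by \<open>wedge_phi0_inj\<close>,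
  transported to the model by the inverse of the coframe.
\<close>

lemma torsion_model: "torsion model_phi c x = pullback (coframe x) (tau_form x)"
proof -
  have *: "ext_deriv 4 (\<lambda>y. g2_hodge (model_phi c y) 3 (model_phi c y)) x =
      wedge 2 3 (pullback (coframe x) (tau_form x)) (model_phi c x)"
    unfolding hodge_model_phi ext_deriv_psi by (simp only: pullback_wedge model_phi_def)
  show ?thesis
    unfolding torsion_def *
  proof (rule the_equality)
    fix \<tau> assume \<tau>: "alternating_form 2 \<tau> \<and>
      wedge 2 3 (pullback (coframe x) (tau_form x)) (model_phi c x) = wedge 2 3 \<tau> (model_phi c x)"
    let ?V = "matrix_inv (coframe x)"
    have inv: "pullback ?V (pullback (coframe x) \<alpha>) = \<alpha>" "pullback (coframe x) (pullback ?V \<alpha>) = \<alpha>" for \<alpha>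
      by (simp_all add: pullback_pullback matrix_inv_mult[OF invertible_coframe])
    define \<delta> where "\<delta> = (\<lambda>vs. pullback ?V \<tau> vs - tau_form x vs)"
    have "wedge 2 3 (pullback ?V \<tau>) phi0 = pullback ?V (wedge 2 3 \<tau> (model_phi c x))"
      by (simp add: pullback_wedge model_phi_def inv)
    also have "\<dots> = pullback ?V (wedge 2 3 (pullback (coframe x) (tau_form x)) (model_phi c x))"
      using \<tau> by simp
    also have "\<dots> = wedge 2 3 (tau_form x) phi0" by (simp add: pullback_wedge model_phi_def inv)
    finally have "wedge 2 3 \<delta> phi0 = (\<lambda>vs. 0)" unfolding \<delta>_def wedge_diff by simp
    moreover have "alternating_form 2 \<delta>" unfolding \<delta>_def using \<tau> by simp
    ultimately have "\<delta> = (\<lambda>vs. 0)" using wedge_phi0_inj by blast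
    then have "pullback ?V \<tau> = tau_form x" by (simp add: \<delta>_def fun_eq_iff)
    then show "\<tau> = pullback (coframe x) (tau_form x)" using inv(2)[of \<tau>] by simp
  qed simp
qed

lemma quadratic_model: "quadratic_closed_G2_structure (1/3) model_atlas model_phi"
  unfolding quadratic_closed_G2_structure_def closed_G2_structure_def Let_def
proof (intro conjI ballI G2_structure_model)
  fix c :: "(real^7, 7) chart" and x :: "real^7"
  show "ext_deriv 3 (model_phi c) x = (\<lambda>vs. 0)" by (simp add: model_phi_mform ext_deriv_phi)
  let ?\<tau> = "torsion model_phi c x"
  have "torsion model_phi c = mform tau_terms" by (simp add: fun_eq_iff torsion_model pullback_tau)
  then have l: "ext_deriv 2 (torsion model_phi c) x = pullback (coframe x) (dtau_form x)" by (simp add: ext_deriv_tau)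
  have n: "g2_norm_sq (model_phi c x) 2 ?\<tau> = 126 * wexp 4 0 x"
    unfolding model_phi_def torsion_model
    by (simp add: g2_norm_sq_pullback invertible_coframe tau_form_def norm_sq0_beta0 power_mult_distrib
        power2_eq_square[of "wexp _ _ _"] wexp_mult)
  have ww: "alternating_form 4 (wedge 2 2 (tau_form x) (tau_form x))"
    unfolding tau_form_def wedge_beta0_beta0
    by (intro alternating_add alternating_scale alternating_elem_form) simp_all
  have h: "g2_hodge (model_phi c x) 4 (wedge 2 2 ?\<tau> ?\<tau>) = pullback (coframe x) (hodge0 4 (wedge 2 2 (tau_form x) (tau_form x)))"
    unfolding model_phi_def torsion_model pullback_wedge[symmetric]
    by (simp add: g2_hodge_pullback invertible_coframe ww)
  show "ext_deriv 2 (torsion model_phi c) x = (\<lambda>vs. 1 / 7 * g2_norm_sq (model_phi c x) 2 ?\<tau> * model_phi c x vs +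
      1 / 3 * (1 / 7 * g2_norm_sq (model_phi c x) 2 ?\<tau> * model_phi c x vs + g2_hodge (model_phi c x) 4 (wedge 2 2 ?\<tau> ?\<tau>) vs))"
    unfolding l n h unfolding tau_form_def hodge0_wedge_beta0 dtau_form_def model_phi_def pullback_def
    by (simp add: fun_eq_iff wexp_mult algebra_simps)
qed

lemma tau_form_generic:
  "- 3 * wexp 2 0 x \<noteq> 0" "9 * wexp 2 0 x \<noteq> 0" "- 6 * wexp 2 0 x \<noteq> 0"
  "(- 3 * wexp 2 0 x)\<^sup>2 \<noteq> (9 * wexp 2 0 x)\<^sup>2" "(- 3 * wexp 2 0 x)\<^sup>2 \<noteq> (- 6 * wexp 2 0 x)\<^sup>2"
  "(9 * wexp 2 0 x)\<^sup>2 \<noteq> (- 6 * wexp 2 0 x)\<^sup>2"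
  by (simp_all add: power_mult_distrib)

text \<open>
  If the torsion form were special, it would be fixed by two symmetries of \<open>\<phi>\<close> that do not commute, but its
  stabiliser is commutative.
\<close>

lemma not_special_model: "\<not> special_torsion model_atlas model_phi"
proof
  let ?c = "(UNIV, id) :: (real^7, 7) chart" and ?U = "coframe 0"
  have c: "?c \<in> model_atlas" by (simp add: model_atlas_def)
  note stab = symmetries_commute[OF invertible_coframe _ tau_form_generic]
  have b1: "pullback (bmat 1 \<i> 1 (- \<i>)) phi0 = phi0" "pullback (bmat 1 1 \<i> (- \<i>)) phi0 = phi0"
    by (simp_all add: bmat_stabiliser_iff)
  have b2: "pullback (bmat 1 \<i> 1 (- \<i>)) (beta0 p q r) = beta0 p q r"
    "pullback (bmat 1 1 \<i> (- \<i>)) (beta0 p q r) = beta0 p q r" for p q r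
    by (simp_all add: pullback_bmat_beta0)
  assume "special_torsion model_atlas model_phi"
  then consider
      "\<exists>u r. adapted_coframe (model_phi ?c 0) u \<and> torsion model_phi ?c 0 =
        pullback u (\<lambda>vs. r * (elem_form [4,5] vs - elem_form [6,7] vs))"
    | "\<exists>u r. adapted_coframe (model_phi ?c 0) u \<and> torsion model_phi ?c 0 =
        pullback u (\<lambda>vs. r * (- 2 * elem_form [2,3] vs + elem_form [4,5] vs + elem_form [6,7] vs))"
    unfolding special_torsion_def special_torsion_positive_def special_torsion_negative_def pointwise_multiple_of_def
    using c chart_image_model[OF c] by blast
  then show False
  proof cases
    case 1
    then obtain u r where u: "invertible u" "pullback ?U phi0 = pullback u phi0"
        "pullback ?U (tau_form 0) = pullback u (\<lambda>vs. r * (elem_form [4,5] vs - elem_form [6,7] vs))"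
      by (auto simp: adapted_coframe_def model_phi_def torsion_model)
    have "(\<lambda>vs. r * (elem_form [4,5] vs - elem_form [6,7] vs)) = beta0 0 r (- r)"
      by (simp add: beta0_def fun_eq_iff algebra_simps)
    with u(3) have "pullback ?U (tau_form 0) = pullback u (beta0 0 r (- r))" by simp
    from stab[OF u(1,2) this[unfolded tau_form_def] J_phi0(1) J_beta0(1) b1(1) b2(1)]
    show False using J_not_commute(1) by blast
  next
    case 2
    then obtain u r where u: "invertible u" "pullback ?U phi0 = pullback u phi0"
        "pullback ?U (tau_form 0) = pullback u (\<lambda>vs. r * (- 2 * elem_form [2,3] vs + elem_form [4,5] vs + elem_form [6,7] vs))"
      by (auto simp: adapted_coframe_def model_phi_def torsion_model)
    have "(\<lambda>vs. r * (- 2 * elem_form [2,3] vs + elem_form [4,5] vs + elem_form [6,7] vs)) = beta0 (- 2 * r) r r"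
      by (simp add: beta0_def fun_eq_iff algebra_simps)
    with u(3) have "pullback ?U (tau_form 0) = pullback u (beta0 (- 2 * r) r r)" by simp
    from stab[OF u(1,2) this[unfolded tau_form_def] J_phi0(2) J_beta0(2) b1(2) b2(2)]
    show False using J_not_commute(2) by blast
  qed
qed

theorem mainTheorem11:
  shows "\<exists>(X :: (real^7) topology) (\<A> :: (real^7, 7) chart set) (\<phi> :: (real^7, 7) form_field).
     smooth_manifold X \<A> \<and> topspace X \<noteq> {} \<and>
     quadratic_closed_G2_structure (1/3) \<A> \<phi> \<and>
     \<not> special_torsion \<A> \<phi> \<and>
     (\<forall>c\<in>\<A>. \<forall>x\<in>chart_image c.
        let G2 = stabiliser (carrier GL) (\<phi> c x);
            T = stabiliser G2 (torsion \<phi> c x)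
        in maximal_torus G2 T \<and> isomorphic_to_T2 T)"
proof (intro exI[of _ euclidean] exI[of _ model_atlas] exI[of _ model_phi] conjI ballI)
  fix c :: "(real^7, 7) chart" and x :: "real^7"
  show "let G2 = stabiliser (carrier GL) (model_phi c x); T = stabiliser G2 (torsion model_phi c x)
        in maximal_torus G2 T \<and> isomorphic_to_T2 T"
    unfolding Let_def torsion_model tau_form_def unfolding model_phi_def
      stabiliser_T2[OF invertible_coframe tau_form_generic]
    by (intro conjI T2_torus invertible_coframe)
next
  show "topspace (euclidean :: (real^7) topology) \<noteq> {}"
    unfolding topspace_euclidean by (rule UNIV_not_empty)
qed (rule smooth_manifold_model quadratic_model not_special_model)+

end
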